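(* Consider a linear network of $L\ge 2$ links of capacity $1$. Suppose that either (i) there exists $k_0\in\{0,\dots,L\}$ such that $\rho_{k_0}>1$, or (ii) $\rho_k<1$ for all $k\in\{0,\dots,L\}$ and $$\rho_0>\sup_{0\le x\le 1-\rho_1}\bar\phi_0(x).$$ Then the network is unstable, i.e. the Markov process $(N(t))$ is transient.
   Context: Linear network: there are $L$ links labelled $1,\dots,L$, each of capacity $1$, and $K=L+1$ classes of flows $0,1,\dots,L$. Class $0$ goes through links $1,2,\dots,L$ in this order; class $l$ ($1\le l\le L$) goes through link $l$ only. Class-$k$ flows arrive according to a Poisson process of intensity $\lambda_k>0$, have independent exponentially distributed sizes with mean $1/\mu_k$ ($\mu_k>0$), and access rate $a_k>0$; $\rho_k=\lambda_k/\mu_k$. For $x=(x_0,\dots,x_L)\in\mathbb{R}_+^{L+1}$ define $\theta_0^0(x)=x_0$ and, for $1\le k\le L$, $$\theta_0^k(x)=\min\Big(\theta_0^{k-1}(x),\tfrac{\theta_0^{k-1}(x)}{\theta_0^{k-1}(x)+x_k}\Big),\qquad \psi_k(x)=\min\Big(x_k,\tfrac{x_k}{\theta_0^{k-1}(x)+x_k}\Big),$$ and $\psi_0(x)=\theta_0^L(x)$ (with the convention that each minimum is $0$ when its denominator is $0$). Put $\phi_k(n)=\psi_k(a_0n_0,\dots,a_Ln_L)$ for $n\in\mathbb{N}^{L+1}$. $(N(t))$ is the Markov jump process on $\mathbb{N}^{L+1}$ with transitions $n\to n+e_k$ at rate $\lambda_k$ and $n\to n-e_k$ at rate $\mu_k\phi_k(n)$,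 $0\le k\le L$ ($e_k$ is the unit vector of coordinate $k$). Quasi-stationary process: for $\alpha\in[0,1]$ and $x_{2:L}=(x_2,\dots,x_L)\in\mathbb{R}_+^{L-1}$ let $\tilde\theta_0^1(\alpha,x_{2:L})=\alpha$ and, for $2\le k\le L$, $$\tilde\theta_0^k=\min\Big(\tilde\theta_0^{k-1},\tfrac{\tilde\theta_0^{k-1}}{\tilde\theta_0^{k-1}+x_k}\Big),\quad \tilde\psi_k(\alpha,x_{2:L})=\min\Big(x_k,\tfrac{x_k}{\tilde\theta_0^{k-1}+x_k}\Big),\quad \tilde\psi_0(\alpha,x_{2:L})=\tilde\theta_0^L(\alpha,x_{2:L})$$ (same convention), and $\tilde\phi_k(\alpha,n_{2:L})=\tilde\psi_k(\alpha,(a_2n_2,\dots,a_Ln_L))$ for $n_{2:L}\in\mathbb{N}^{L-1}$. Let $(\tilde N^\alpha_{2:L}(t))$ be the Markov jump process on $\mathbb{N}^{L-1}$ in which, for $2\le k\le L$, $n_k\to n_k+1$ at rate $\lambda_k$ and $n_k\to n_k-1$ at rate $\mu_k\tilde\phi_k(\alpha,n_{2:L})$. When $\rho_k<1$ for $2\le k\le L$ it is ergodic; $\tilde\pi^\alpha$ denotes its stationary distribution and $$\bar\phi_0(\alpha)=\sum_{n_{2:L}\in\mathbb{N}^{L-1}}\tilde\pi^\alpha(n_{2:L})\,\tilde\phi_0(\alpha,n_{2:L}),\qquad \alpha\in[0,1].$$ *)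

theory Defs
  imports "HOL-Probability.Probability"
begin

section \<open>Markov jump processes on a countable set\<close>

text \<open>
  A jump process is given by a set of states \<open>S\<close> and by rates \<open>q i j\<close> for \<open>i \<noteq> j\<close>; the diagonal
  values of \<open>q\<close> are never used. Total rates are assumed to be finite and positive, as they are for
  all processes below.
\<close>

definition exit_rate :: "'s set \<Rightarrow> ('s \<Rightarrow> 's \<Rightarrow> real) \<Rightarrow> 's \<Rightarrow> real" where
  "exit_rate S q i = (\<Sum>\<^sub>\<infinity>j\<in>S - {i}. q i j)"

definition jump_prob :: "'s set \<Rightarrow> ('s \<Rightarrow> 's \<Rightarrow> real) \<Rightarrow> 's \<Rightarrow> 's \<Rightarrow> real" where
  "jump_prob S q i j = (if i = j then 0 else q i j / exit_rate S q i)"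

text \<open>
  Jump chain and holding times: \<open>Y\<close> is a Markov chain with transition matrix \<open>jump_prob S q\<close> and an
  arbitrary initial distribution; given \<open>Y\<close>, the holding times \<open>H k\<close> are independent and
  exponentially distributed with parameters \<open>exit_rate S q (Y k)\<close>; and \<open>X\<close> equals \<open>Y k\<close> between the
  \<open>k\<close>-th and the next jump time. Nothing is required of \<open>X\<close> after an explosion; the processes below
  have bounded total rates, so that almost surely there is none.
\<close>

definition markov_jump_process ::
  "'w measure \<Rightarrow> 's set \<Rightarrow> ('s \<Rightarrow> 's \<Rightarrow> real) \<Rightarrow> (real \<Rightarrow> 'w \<Rightarrow> 's) \<Rightarrow> bool" where
  "markov_jump_process M S q X \<longleftrightarrow>
     prob_space M \<and>
     (\<forall>t\<ge>0. X t \<in> M \<rightarrow>\<^sub>M count_space S) \<and>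
     (\<exists>(Y :: nat \<Rightarrow> 'w \<Rightarrow> 's) (H :: nat \<Rightarrow> 'w \<Rightarrow> real).
        (\<forall>k. Y k \<in> M \<rightarrow>\<^sub>M count_space S) \<and>
        (\<forall>k. H k \<in> borel_measurable M) \<and>
        (\<forall>m i t. (\<forall>k\<le>m. i k \<in> S) \<and> (\<forall>k<m. 0 \<le> t k) \<longrightarrow>
           measure M {w \<in> space M. (\<forall>k\<le>m. Y k w = i k) \<and> (\<forall>k<m. t k < H k w)} =
           measure M {w \<in> space M. Y 0 w = i 0} *
             (\<Prod>k<m. jump_prob S q (i k) (i (Suc k)) * exp (- exit_rate S q (i k) * t k))) \<and>
        (AE w in M. \<forall>k t. (\<Sum>j<k. H j w) \<le> t \<and> t < (\<Sum>j<Suc k. H j w) \<longrightarrow> X t w = Y k w))"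

text \<open>
  Every state is almost surely not visited any more after some finite time. Since the initial
  distribution of a jump process is arbitrary, this covers the process started in any given state.
\<close>

definition transient_process :: "'w measure \<Rightarrow> 's set \<Rightarrow> (real \<Rightarrow> 'w \<Rightarrow> 's) \<Rightarrow> bool" where
  "transient_process M S X \<longleftrightarrow> (\<forall>i\<in>S. AE w in M. bounded {t. 0 \<le> t \<and> X t w = i})"

text \<open>Invariant probability distribution, that is, the global balance equations \<open>\<pi> Q = 0\<close>.\<close>

definition is_stationary_distribution :: "'s set \<Rightarrow> ('s \<Rightarrow> 's \<Rightarrow> real) \<Rightarrow> 's pmf \<Rightarrow> bool" where
  "is_stationary_distribution S q p \<longleftrightarrow>
     set_pmf p \<subseteq> S \<and>
     (\<forall>j\<in>S. ((\<lambda>i. pmf p i * q i j) has_sum (pmf p j * exit_rate S q j)) (S - {j}))"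

definition stationary_distribution :: "'s set \<Rightarrow> ('s \<Rightarrow> 's \<Rightarrow> real) \<Rightarrow> 's pmf" where
  "stationary_distribution S q = (THE p. is_stationary_distribution S q p)"


section \<open>Population processes\<close>

text \<open>
  Vectors indexed by a finite set \<open>K\<close> of classes are functions on \<open>nat\<close>; population vectors vanish
  outside \<open>K\<close>.
\<close>

definition populations :: "nat set \<Rightarrow> (nat \<Rightarrow> nat) set" where
  "populations K = {n. \<forall>k. k \<notin> K \<longrightarrow> n k = 0}"

definition birth_death_rate ::
  "nat set \<Rightarrow> (nat \<Rightarrow> real) \<Rightarrow> ((nat \<Rightarrow> nat) \<Rightarrow> nat \<Rightarrow> real) \<Rightarrow> (nat \<Rightarrow> nat) \<Rightarrow> (nat \<Rightarrow> nat) \<Rightarrow> real" where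
  "birth_death_rate K b d n m =
     (\<Sum>k\<in>K. if m = n(k := Suc (n k)) then b k else 0) +
     (\<Sum>k\<in>K. if n = m(k := Suc (m k)) then d n k else 0)"


section \<open>The linear network\<close>

text \<open>
  Below, a denominator vanishes only if the corresponding numerator does, and \<open>0 / 0 = 0\<close>; so every
  minimum is \<open>0\<close> when its denominator is \<open>0\<close>.
\<close>

primrec theta0 :: "(nat \<Rightarrow> real) \<Rightarrow> nat \<Rightarrow> real" where
  "theta0 x 0 = x 0"
| "theta0 x (Suc k) = min (theta0 x k) (theta0 x k / (theta0 x k + x (Suc k)))"

definition psi :: "nat \<Rightarrow> (nat \<Rightarrow> real) \<Rightarrow> nat \<Rightarrow> real" where
  "psi L x k =
     (if k = 0 then theta0 x L else min (x k) (x k / (theta0 x (k - 1) + x k)))"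

definition phi :: "nat \<Rightarrow> (nat \<Rightarrow> real) \<Rightarrow> (nat \<Rightarrow> nat) \<Rightarrow> nat \<Rightarrow> real" where
  "phi L a n k = psi L (\<lambda>j. a j * real (n j)) k"

definition network_rate ::
  "nat \<Rightarrow> (nat \<Rightarrow> real) \<Rightarrow> (nat \<Rightarrow> real) \<Rightarrow> (nat \<Rightarrow> real) \<Rightarrow> (nat \<Rightarrow> nat) \<Rightarrow> (nat \<Rightarrow> nat) \<Rightarrow> real" where
  "network_rate L lam mu a = birth_death_rate {0..L} lam (\<lambda>n k. mu k * phi L a n k)"


section \<open>The quasi-stationary process\<close>

text \<open>The recursion starts at index \<open>1\<close>; the value at index \<open>0\<close> is a dummy.\<close>

primrec theta0_qs :: "real \<Rightarrow> (nat \<Rightarrow> real) \<Rightarrow> nat \<Rightarrow> real" where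
  "theta0_qs \<alpha> x 0 = \<alpha>"
| "theta0_qs \<alpha> x (Suc k) =
     (if k = 0 then \<alpha>
      else min (theta0_qs \<alpha> x k) (theta0_qs \<alpha> x k / (theta0_qs \<alpha> x k + x (Suc k))))"

definition psi_qs :: "nat \<Rightarrow> real \<Rightarrow> (nat \<Rightarrow> real) \<Rightarrow> nat \<Rightarrow> real" where
  "psi_qs L \<alpha> x k =
     (if k = 0 then theta0_qs \<alpha> x L else min (x k) (x k / (theta0_qs \<alpha> x (k - 1) + x k)))"

definition phi_qs :: "nat \<Rightarrow> (nat \<Rightarrow> real) \<Rightarrow> real \<Rightarrow> (nat \<Rightarrow> nat) \<Rightarrow> nat \<Rightarrow> real" where
  "phi_qs L a \<alpha> n k = psi_qs L \<alpha> (\<lambda>j. a j * real (n j)) k"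

definition qs_rate ::
  "nat \<Rightarrow> (nat \<Rightarrow> real) \<Rightarrow> (nat \<Rightarrow> real) \<Rightarrow> (nat \<Rightarrow> real) \<Rightarrow> real \<Rightarrow>
     (nat \<Rightarrow> nat) \<Rightarrow> (nat \<Rightarrow> nat) \<Rightarrow> real" where
  "qs_rate L lam mu a \<alpha> = birth_death_rate {2..L} lam (\<lambda>n k. mu k * phi_qs L a \<alpha> n k)"

definition pi_qs ::
  "nat \<Rightarrow> (nat \<Rightarrow> real) \<Rightarrow> (nat \<Rightarrow> real) \<Rightarrow> (nat \<Rightarrow> real) \<Rightarrow> real \<Rightarrow> (nat \<Rightarrow> nat) pmf" where
  "pi_qs L lam mu a \<alpha> = stationary_distribution (populations {2..L}) (qs_rate L lam mu a \<alpha>)"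

definition phi0_bar ::
  "nat \<Rightarrow> (nat \<Rightarrow> real) \<Rightarrow> (nat \<Rightarrow> real) \<Rightarrow> (nat \<Rightarrow> real) \<Rightarrow> real \<Rightarrow> real" where
  "phi0_bar L lam mu a \<alpha> =
     (\<Sum>\<^sub>\<infinity>n\<in>populations {2..L}. pmf (pi_qs L lam mu a \<alpha>) n * phi_qs L a \<alpha> n 0)"

end

theory Submission
  imports Defs
begin

text \<open>
  Transience follows from a bounded positive function \<open>g\<close> on the populations whose expectation
  shrinks geometrically: if the generator satisfies \<open>G g \<le> - \<epsilon> g\<close> everywhere and the total rates are
  bounded, then the expectation of \<open>g\<close> along the jump chain is at most a constant times \<open>\<gamma> ^ m\<close> with
  \<open>\<gamma> < 1\<close>, so the probabilities of being in a given state are summable and Borel-Cantelli applies;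
  bounded rates also exclude explosion (\<open>transient_birth_death\<close>). It remains to find \<open>g\<close>.

  In case (i) a class \<open>k\<close> never receives more than capacity \<open>1\<close>, so its population dominates a random
  walk with positive drift, and \<open>g n = r ^ n k\<close> works for some \<open>r < 1\<close> (\<open>overloaded_class_drift\<close>).

  In case (ii) the fluid picture is two-dimensional. When \<open>n 0 + n 1\<close> is large, the share \<open>\<alpha>\<close> of the
  first link that class \<open>0\<close> obtains moves slowly, while classes \<open>2..L\<close> see a frozen \<open>\<alpha>\<close> and average out,
  so that class \<open>0\<close> receives capacity \<open>phi0_bar \<alpha>\<close> and class \<open>1\<close> capacity \<open>1 - \<alpha>\<close>. If \<open>\<alpha>\<close> is above
  \<open>1 - \<rho> 1\<close> then class \<open>1\<close> grows; otherwise class \<open>0\<close> grows by hypothesis, and it still does if \<open>\<alpha>\<close> is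
  slightly larger than \<open>1 - \<rho> 1\<close>.
  Hence \<open>min (n 0 / r) (n 1)\<close> grows linearly for a suitable slope \<open>r\<close>, and the Lyapunov function is
  the sum \<open>exp (- s n 0) + exp (- r s n 1)\<close> with small \<open>s\<close>, whose dominating term always
  decreases (\<open>averaged_drift\<close>).

  The averaging is done by multiplying the first exponential with \<open>1 + s \<mu> h\<close>, where \<open>h\<close> solves a
  resolvent version of the Poisson equation, \<open>phi0 + G h = u\<close>, and \<open>u\<close> is the mean of the service
  rate \<open>phi0\<close> of class \<open>0\<close> at an independent geometric time of the (discretised) quasi-stationary
  process. What is needed is that \<open>u\<close> is below \<open>\<rho> 0\<close> uniformly in the starting state and in \<open>\<alpha>\<close> up to
  slightly beyond \<open>1 - \<rho> 1\<close>. This is a compactness argument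
  (\<open>resolvent_le_above_quasi_stationary_mean\<close>): otherwise the laws at longer and longer geometric times have a pointwise limit which is an invariant measure of mass at
  most \<open>1\<close> giving \<open>phi0\<close> too large a mean. Mass may escape to infinity, but \<open>phi0\<close> vanishes there, so
  the escaped mass contributes nothing; normalising the limit only increases the mean, and the
  result is the stationary distribution because that is unique.

  Where \<open>n 0 + n 1\<close> is small this function need not decrease. There it is cut off at a constant, which
  keeps the drift nonpositive, and it is made strictly decreasing by a bounded factor that rewards
  arrivals of classes \<open>0\<close> and \<open>1\<close> (\<open>global_drift\<close>).
\<close>

section \<open>Jump processes with geometrically decreasing functionals\<close>

lemma nn_integral_mono_cells:
  fixes f g :: "'w \<Rightarrow> ennreal"
  assumes "countable T" and Z: "Z \<in> M \<rightarrow>\<^sub>M count_space T"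
    and f: "f \<in> borel_measurable M" and g: "g \<in> borel_measurable M"
    and le: "\<And>z. z \<in> T \<Longrightarrow>
      (\<integral>\<^sup>+w. f w * indicator (Z -` {z} \<inter> space M) w \<partial>M) \<le> (\<integral>\<^sup>+w. g w * indicator (Z -` {z} \<inter> space M) w \<partial>M)"
  shows "(\<integral>\<^sup>+w. f w \<partial>M) \<le> (\<integral>\<^sup>+w. g w \<partial>M)"
proof -
  have cell: "Z -` {z} \<inter> space M \<in> sets M" if "z \<in> T" for z
    using measurable_sets[OF Z, of "{z}"] that by auto
  have split: "(\<integral>\<^sup>+w. h w \<partial>M) = (\<integral>\<^sup>+z. \<integral>\<^sup>+w. h w * indicator (Z -` {z} \<inter> space M) w \<partial>M \<partial>count_space T)"
    if h: "h \<in> borel_measurable M" for h :: "'w \<Rightarrow> ennreal"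
  proof -
    have "(\<integral>\<^sup>+w. h w \<partial>M) = (\<integral>\<^sup>+w. \<integral>\<^sup>+z. h w * indicator (Z -` {z} \<inter> space M) w \<partial>count_space T \<partial>M)"
    proof (rule nn_integral_cong)
      fix w assume w: "w \<in> space M"
      then have "Z w \<in> T" using measurable_space[OF Z] by auto
      have "(\<integral>\<^sup>+z. h w * indicator (Z -` {z} \<inter> space M) w \<partial>count_space T) =
        (\<integral>\<^sup>+z. h w * indicator {Z w} z \<partial>count_space T)"
        using w by (intro nn_integral_cong) (auto simp: indicator_def)
      also have "\<dots> = h w * emeasure (count_space T) {Z w}"
        using \<open>Z w \<in> T\<close> by (subst nn_integral_cmult_indicator) auto
      also have "\<dots> = h w" using \<open>Z w \<in> T\<close> by simp
      finally show "h w = (\<integral>\<^sup>+z. h w * indicator (Z -` {z} \<inter> space M) w \<partial>count_space T)" ..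
    qed
    also have "\<dots> = (\<integral>\<^sup>+z. \<integral>\<^sup>+w. h w * indicator (Z -` {z} \<inter> space M) w \<partial>M \<partial>count_space T)"
    proof (rule nn_integral_count_space_nn_integral[OF \<open>countable T\<close>])
      fix z assume "z \<in> T"
      note cell[OF this, measurable] h[measurable]
      show "(\<lambda>w. h w * indicator (Z -` {z} \<inter> space M) w) \<in> borel_measurable M" by measurable
    qed
    finally show ?thesis .
  qed
  show ?thesis
    unfolding split[OF f] split[OF g] by (rule nn_integral_mono) (auto intro: le)
qed

text \<open>
  The jump chain and the holding times of a jump process whose transitions from a state \<open>i\<close> lead into
  the finite set \<open>nbs i\<close>. The law is only given jointly for paths and lower bounds of holding times;
  everything below is obtained by summing it over the countably many paths of a given length.
\<close>

locale jump_chain = prob_space M for M :: "'w measure" +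
  fixes S :: "'s set" and q :: "'s \<Rightarrow> 's \<Rightarrow> real"
    and Y :: "nat \<Rightarrow> 'w \<Rightarrow> 's" and H :: "nat \<Rightarrow> 'w \<Rightarrow> real"
    and nbs :: "'s \<Rightarrow> 's set" and C :: real
  assumes countable_S: "countable S"
    and Y_measurable: "\<And>k. Y k \<in> M \<rightarrow>\<^sub>M count_space S"
    and H_measurable: "\<And>k. H k \<in> borel_measurable M"
    and law: "\<And>m i t. \<lbrakk>\<forall>k\<le>m. i k \<in> S; \<forall>k<m. 0 \<le> t k\<rbrakk> \<Longrightarrow>
           prob {w \<in> space M. (\<forall>k\<le>m. Y k w = i k) \<and> (\<forall>k<m. t k < H k w)} =
           prob {w \<in> space M. Y 0 w = i 0} *
             (\<Prod>k<m. jump_prob S q (i k) (i (Suc k)) * exp (- exit_rate S q (i k) * t k))"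
    and jump_prob_nonneg: "\<And>i j. \<lbrakk>i \<in> S; j \<in> S\<rbrakk> \<Longrightarrow> 0 \<le> jump_prob S q i j"
    and nbs: "\<And>i. i \<in> S \<Longrightarrow> finite (nbs i) \<and> nbs i \<subseteq> S \<and> (\<Sum>j\<in>nbs i. jump_prob S q i j) = 1"
    and exit_bounds: "\<And>i. i \<in> S \<Longrightarrow> 0 \<le> exit_rate S q i \<and> exit_rate S q i \<le> C"
begin

definition path_event :: "nat \<Rightarrow> (nat \<Rightarrow> 's) \<Rightarrow> 'w set" where
  "path_event m i = {w \<in> space M. \<forall>k\<le>m. Y k w = i k}"

definition path_weight :: "nat \<Rightarrow> (nat \<Rightarrow> 's) \<Rightarrow> real" where
  "path_weight m i = prob {w \<in> space M. Y 0 w = i 0} * (\<Prod>k<m. jump_prob S q (i k) (i (Suc k)))"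

lemma Y_event[measurable]: "{w \<in> space M. Y k w = s} \<in> events"
proof (cases "s \<in> S")
  case True
  have "Y k -` {s} \<inter> space M \<in> events"
    using True by (intro measurable_sets[OF Y_measurable]) auto
  then show ?thesis by (simp add: vimage_def Int_def conj_commute)
next
  case False
  then have "{w \<in> space M. Y k w = s} = {}"
    using measurable_space[OF Y_measurable] by auto
  then show ?thesis by (simp only: sets.empty_sets)
qed

lemma path_event[measurable]: "path_event m i \<in> events"
  unfolding path_event_def by measurable

declare H_measurable[measurable]

lemma path_cells:
  fixes f g :: "'w \<Rightarrow> ennreal"
  assumes "f \<in> borel_measurable M" "g \<in> borel_measurable M"
    and "\<And>i. (\<forall>k. i k \<in> S) \<Longrightarrow>
      (\<integral>\<^sup>+w. f w * indicator (path_event m i) w \<partial>M) \<le> (\<integral>\<^sup>+w. g w * indicator (path_event m i) w \<partial>M)"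
  shows "(\<integral>\<^sup>+w. f w \<partial>M) \<le> (\<integral>\<^sup>+w. g w \<partial>M)"
proof -
  define Z where "Z = (\<lambda>w. map (\<lambda>k. Y k w) [0..<Suc m])"
  define T where "T = {p. set p \<subseteq> S \<and> length p = Suc m}"
  have T: "countable T"
    by (rule countable_subset[OF _ countable_lists[OF countable_S]]) (auto simp: T_def)
  have YS: "Y k w \<in> S" if "w \<in> space M" for k w
    using measurable_space[OF Y_measurable that, of k] by simp
  have cell: "Z -` {p} \<inter> space M = path_event m (\<lambda>k. if k \<le> m then p ! k else p ! 0)" if "p \<in> T" for p
  proof -
    have "Z w = p \<longleftrightarrow> (\<forall>k\<le>m. Y k w = p ! k)" for w
      using that by (auto simp: Z_def T_def list_eq_iff_nth_eq less_Suc_eq_le simp del: upt_Suc)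
    then show ?thesis by (auto simp: path_event_def)
  qed
  have Z: "Z \<in> M \<rightarrow>\<^sub>M count_space T"
  proof (rule measurable_count_space_eq_countable[OF T, THEN iffD2], intro conjI ballI)
    show "Z \<in> space M \<rightarrow> T" by (auto simp: Z_def T_def YS simp del: upt_Suc)
    show "Z -` {p} \<inter> space M \<in> events" if "p \<in> T" for p
      unfolding cell[OF that] by measurable
  qed
  show ?thesis
  proof (rule nn_integral_mono_cells[OF T Z assms(1,2)])
    fix p assume p: "p \<in> T"
    show "(\<integral>\<^sup>+w. f w * indicator (Z -` {p} \<inter> space M) w \<partial>M) \<le> (\<integral>\<^sup>+w. g w * indicator (Z -` {p} \<inter> space M) w \<partial>M)"
      unfolding cell[OF p] using p
      by (intro assms(3)) (auto simp: T_def subset_iff)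
  qed
qed

lemma law_pos:
  assumes "\<forall>k. i k \<in> S"
  shows "prob {w \<in> path_event m i. \<forall>k<m. 0 < H k w} = path_weight m i"
  using law[of m i "\<lambda>_. 0"] assms
  by (simp add: path_weight_def path_event_def conj_ac)

lemma path_weight_Suc:
  "path_weight (Suc m) i = path_weight m i * jump_prob S q (i m) (i (Suc m))"
  by (simp add: path_weight_def)

lemma path_weight_cong: "(\<And>k. k \<le> m \<Longrightarrow> i k = i' k) \<Longrightarrow> path_weight m i = path_weight m i'"
  unfolding path_weight_def by (intro arg_cong2[where f="(*)"] prod.cong) auto

lemma path_event_upd:
  "path_event (Suc m) (i(Suc m := j)) = path_event m i \<inter> {w \<in> space M. Y (Suc m) w = j}"
  by (auto simp: path_event_def le_Suc_eq)

lemma sum_next_pos: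
  assumes i: "\<forall>k. i k \<in> S"
  shows "(\<Sum>j\<in>nbs (i m). prob {w \<in> path_event (Suc m) (i(Suc m := j)). \<forall>k<Suc m. 0 < H k w}) = path_weight m i"
proof -
  have "(\<Sum>j\<in>nbs (i m). prob {w \<in> path_event (Suc m) (i(Suc m := j)). \<forall>k<Suc m. 0 < H k w})
      = (\<Sum>j\<in>nbs (i m). path_weight m i * jump_prob S q (i m) j)"
  proof (intro sum.cong refl)
    fix j assume "j \<in> nbs (i m)"
    then have "\<forall>k. (i(Suc m := j)) k \<in> S" using i nbs by auto
    from law_pos[OF this, of "Suc m"]
    have "prob {w \<in> path_event (Suc m) (i(Suc m := j)). \<forall>k<Suc m. 0 < H k w}
      = path_weight (Suc m) (i(Suc m := j))" .
    also have "\<dots> = path_weight m (i(Suc m := j)) * jump_prob S q (i m) j"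
      by (simp add: path_weight_Suc)
    also have "path_weight m (i(Suc m := j)) = path_weight m i"
      by (rule path_weight_cong) auto
    finally show "prob {w \<in> path_event (Suc m) (i(Suc m := j)). \<forall>k<Suc m. 0 < H k w}
      = path_weight m i * jump_prob S q (i m) j" .
  qed
  also have "\<dots> = path_weight m i"
    using nbs[of "i m"] i by (simp add: sum_distrib_left[symmetric])
  finally show ?thesis .
qed

text \<open>
  Not assumed explicitly, but forced by the law at \<open>t = 0\<close>: the weights of all one-step extensions of a
  path add up to the weight of the path, which leaves no mass for nonpositive holding times. Only
  then do the weights become the probabilities of the paths themselves.
\<close>

lemma AE_holding_pos: "AE w in M. \<forall>k<m. 0 < H k w"
proof (induction m)
  case (Suc m)
  have "emeasure M (space M) \<le> emeasure M {w \<in> space M. \<forall>k<Suc m. 0 < H k w}"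
  proof -
    have "(\<integral>\<^sup>+w. 1 \<partial>M) \<le> (\<integral>\<^sup>+w. indicator {w \<in> space M. \<forall>k<Suc m. 0 < H k w} w \<partial>M)"
    proof (rule path_cells[where m=m])
      fix i :: "nat \<Rightarrow> 's" assume i: "\<forall>k. i k \<in> S"
      let ?A = "\<lambda>j. {w \<in> path_event (Suc m) (i(Suc m := j)). \<forall>k<Suc m. 0 < H k w}"
      have "prob (path_event m i) = prob {w \<in> path_event m i. \<forall>k<m. 0 < H k w}"
        using Suc by (intro measure_eq_AE) auto
      also have "\<dots> = (\<Sum>j\<in>nbs (i m). prob (?A j))"
        by (simp only: sum_next_pos[OF i] law_pos[OF i])
      also have "\<dots> = prob (\<Union>j\<in>nbs (i m). ?A j)"
        using nbs[of "i m"] i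
        by (intro finite_measure_finite_Union[symmetric])
           (auto simp: disjoint_family_on_def path_event_def)
      also have "\<dots> \<le> prob ({w \<in> space M. \<forall>k<Suc m. 0 < H k w} \<inter> path_event m i)"
        by (intro finite_measure_mono) (auto simp: path_event_def)
      finally show "(\<integral>\<^sup>+w. 1 * indicator (path_event m i) w \<partial>M)
        \<le> (\<integral>\<^sup>+w. indicator {w \<in> space M. \<forall>k<Suc m. 0 < H k w} w * indicator (path_event m i) w \<partial>M)"
        by (simp add: indicator_inter_arith[symmetric] emeasure_eq_measure ennreal_leI)
    qed auto
    then show ?thesis by simp
  qed
  then have "prob {w \<in> space M. \<forall>k<Suc m. 0 < H k w} = 1"
    using prob_le_1 by (intro antisym) (simp_all add: emeasure_eq_measure prob_space)
  then show ?case
    by (subst (asm) prob_Collect_eq_1) auto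
qed simp

lemma prob_path: "\<forall>k. i k \<in> S \<Longrightarrow> prob (path_event m i) = path_weight m i"
  using AE_holding_pos[of m] law_pos[of i m]
  by (subst measure_eq_AE[where B="{w \<in> path_event m i. \<forall>k<m. 0 < H k w}"]) auto

lemma prob_path_next:
  assumes "\<forall>k. i k \<in> S" "j \<in> S"
  shows "prob (path_event m i \<inter> {w \<in> space M. Y (Suc m) w = j}) = prob (path_event m i) * jump_prob S q (i m) j"
proof -
  have "prob (path_event m i \<inter> {w \<in> space M. Y (Suc m) w = j}) = path_weight (Suc m) (i(Suc m := j))"
    using assms by (subst path_event_upd[symmetric], subst prob_path) auto
  also have "\<dots> = path_weight m i * jump_prob S q (i m) j"
    by (simp add: path_weight_Suc cong: path_weight_cong)
  finally show ?thesis using assms by (simp add: prob_path)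
qed

text \<open>
  The law speaks of events \<open>1 < H k\<close> only. The complementary events are reached by induction on \<open>J\<close>,
  each new index being handled by subtraction.
\<close>

lemma short_holding_times:
  assumes i: "\<forall>k. i k \<in> S" and "finite J" "I \<inter> J = {}" "I \<union> J \<subseteq> {..<m}"
  shows "prob {w \<in> path_event m i. (\<forall>k\<in>I. 1 < H k w) \<and> (\<forall>k\<in>J. H k w \<le> 1)} =
    path_weight m i * (\<Prod>k\<in>I. exp (- exit_rate S q (i k))) * (\<Prod>k\<in>J. 1 - exp (- exit_rate S q (i k)))"
  using assms(2-)
proof (induction J arbitrary: I rule: finite_induct)
  case empty
  let ?t = "\<lambda>k. if k \<in> I then 1 else 0 :: real"
  have "prob {w \<in> path_event m i. \<forall>k\<in>I. 1 < H k w} =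
     prob {w \<in> space M. (\<forall>k\<le>m. Y k w = i k) \<and> (\<forall>k<m. ?t k < H k w)}"
  proof (rule measure_eq_AE)
    show "AE w in M. (w \<in> {w \<in> path_event m i. \<forall>k\<in>I. 1 < H k w}) =
       (w \<in> {w \<in> space M. (\<forall>k\<le>m. Y k w = i k) \<and> (\<forall>k<m. ?t k < H k w)})"
      using AE_holding_pos[of m] by eventually_elim (use empty in \<open>auto simp: path_event_def\<close>)
    show "{w \<in> path_event m i. \<forall>k\<in>I. 1 < H k w} \<in> events"
      using finite_subset[OF empty(2)[simplified]] by measurable
  qed measurable
  also have "\<dots> = prob {w \<in> space M. Y 0 w = i 0} *
      (\<Prod>k<m. jump_prob S q (i k) (i (Suc k)) * exp (- exit_rate S q (i k) * ?t k))"
    using i by (intro law) auto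
  also have "\<dots> = path_weight m i * (\<Prod>k<m. exp (- exit_rate S q (i k) * ?t k))"
    by (simp add: path_weight_def prod.distrib)
  also have "(\<Prod>k<m. exp (- exit_rate S q (i k) * ?t k)) = (\<Prod>k\<in>I. exp (- exit_rate S q (i k)))"
    using empty by (intro prod.mono_neutral_cong_right) auto
  finally show ?case by simp
next
  case (insert j J)
  have fin: "finite I" using insert.prems finite_subset by (metis Un_subset_iff finite_lessThan)
  let ?B = "\<lambda>I J. {w \<in> path_event m i. (\<forall>k\<in>I. 1 < H k w) \<and> (\<forall>k\<in>J. H k w \<le> 1)}"
  have ev: "?B I' J' \<in> events" if "finite I'" "finite J'" for I' J'
    using that by measurable
  have "?B I J = ?B I (insert j J) \<union> ?B (insert j I) J" by auto
  then have "prob (?B I J) = prob (?B I (insert j J)) + prob (?B (insert j I) J)"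
    using ev fin insert.hyps by (subst finite_measure_Union[symmetric]) auto
  then have "prob (?B I (insert j J)) = prob (?B I J) - prob (?B (insert j I) J)" by simp
  also have "prob (?B I J) = path_weight m i * (\<Prod>k\<in>I. exp (- exit_rate S q (i k))) * (\<Prod>k\<in>J. 1 - exp (- exit_rate S q (i k)))"
    using insert.prems by (intro insert.IH) auto
  also have "prob (?B (insert j I) J) = path_weight m i * (\<Prod>k\<in>insert j I. exp (- exit_rate S q (i k))) * (\<Prod>k\<in>J. 1 - exp (- exit_rate S q (i k)))"
    using insert.prems insert.hyps by (intro insert.IH) auto
  also have "(\<Prod>k\<in>insert j I. exp (- exit_rate S q (i k))) =
      exp (- exit_rate S q (i j)) * (\<Prod>k\<in>I. exp (- exit_rate S q (i k)))"
    using insert.prems fin by (intro prod.insert) auto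
  finally show ?case using insert.hyps by (simp add: algebra_simps)
qed

text \<open>
  Bounded rates exclude explosion: each holding time exceeds \<open>1\<close> with conditional probability at least
  \<open>exp (- C)\<close>, so almost surely infinitely many do.
\<close>

lemma AE_long_holding_time: "AE w in M. \<exists>k\<ge>m. 1 < H k w"
proof -
  let ?E = "\<lambda>r. {w \<in> space M. \<forall>k\<in>{m..<m+r}. H k w \<le> 1}"
  define z where "z = max 0 (1 - exp (- C))"
  have z: "0 \<le> z" "z < 1" by (auto simp: z_def)
  have bound: "prob (?E r) \<le> z ^ r" for r
  proof -
    have "(\<integral>\<^sup>+w. indicator (?E r) w \<partial>M) \<le> (\<integral>\<^sup>+w. ennreal (z ^ r) \<partial>M)"
    proof (rule path_cells[where m="m+r"])
      fix i :: "nat \<Rightarrow> 's" assume i: "\<forall>k. i k \<in> S"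
      have "prob (?E r \<inter> path_event (m + r) i) =
        prob {w \<in> path_event (m+r) i. (\<forall>k\<in>{}. 1 < H k w) \<and> (\<forall>k\<in>{m..<m+r}. H k w \<le> 1)}"
        by (rule arg_cong[where f=prob]) (auto simp: path_event_def)
      also have "\<dots> = path_weight (m+r) i * (\<Prod>k\<in>{m..<m+r}. 1 - exp (- exit_rate S q (i k)))"
        by (subst short_holding_times[OF i]) auto
      also have "\<dots> \<le> path_weight (m+r) i * z ^ r"
      proof (rule mult_left_mono)
        have "(\<Prod>k\<in>{m..<m+r}. 1 - exp (- exit_rate S q (i k))) \<le> (\<Prod>k\<in>{m..<m+r}. z)"
          using exit_bounds i by (intro prod_mono) (auto simp: z_def intro: max.coboundedI2)
        then show "(\<Prod>k\<in>{m..<m+r}. 1 - exp (- exit_rate S q (i k))) \<le> z ^ r" by simp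
        show "0 \<le> path_weight (m+r) i" using prob_path[OF i] by (metis measure_nonneg)
      qed
      finally show "(\<integral>\<^sup>+w. indicator (?E r) w * indicator (path_event (m+r) i) w \<partial>M)
        \<le> (\<integral>\<^sup>+w. ennreal (z ^ r) * indicator (path_event (m+r) i) w \<partial>M)"
        using z by (simp add: indicator_inter_arith[symmetric] emeasure_eq_measure prob_path[OF i, symmetric]
            nn_integral_cmult_indicator ennreal_mult[symmetric] ennreal_leI mult.commute Int_commute)
    qed auto
    then show ?thesis using z by (simp add: emeasure_eq_measure prob_space ennreal_le_iff)
  qed
  have "prob {w \<in> space M. \<forall>k\<ge>m. H k w \<le> 1} \<le> 0"
  proof (rule LIMSEQ_le_const[OF LIMSEQ_realpow_zero[OF z]], intro exI allI impI)
    fix r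
    have "prob {w \<in> space M. \<forall>k\<ge>m. H k w \<le> 1} \<le> prob (?E r)"
      by (intro finite_measure_mono) auto
    then show "prob {w \<in> space M. \<forall>k\<ge>m. H k w \<le> 1} \<le> z ^ r" using bound[of r] by simp
  qed
  then have "prob {w \<in> space M. \<forall>k\<ge>m. H k w \<le> 1} = 0" by (simp add: measure_le_0_iff)
  then have "AE w in M. \<not> (\<forall>k\<ge>m. H k w \<le> 1)"
    by (subst (asm) prob_Collect_eq_0) auto
  then show ?thesis by eventually_elim (auto simp: not_le)
qed

lemma drift_expectation:
  fixes g :: "'s \<Rightarrow> real"
  assumes g: "\<And>i. i \<in> S \<Longrightarrow> 0 \<le> g i" and gam: "0 \<le> \<gamma>"
    and drift: "\<And>i. i \<in> S \<Longrightarrow> (\<Sum>j\<in>nbs i. jump_prob S q i j * g j) \<le> \<gamma> * g i"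
  shows "(\<integral>\<^sup>+w. g (Y (Suc m) w) \<partial>M) \<le> \<gamma> * (\<integral>\<^sup>+w. g (Y m w) \<partial>M)"
proof -
  have meas: "(\<lambda>w. ennreal (g (Y k w))) \<in> borel_measurable M" for k
    by (rule measurable_compose[OF Y_measurable]) simp
  have "(\<integral>\<^sup>+w. g (Y (Suc m) w) \<partial>M) \<le> (\<integral>\<^sup>+w. \<gamma> * g (Y m w) \<partial>M)"
  proof (rule path_cells[where m=m])
    show "(\<lambda>w. ennreal (\<gamma> * g (Y m w))) \<in> borel_measurable M"
      by (rule measurable_compose[OF Y_measurable]) simp
  next
    fix i :: "nat \<Rightarrow> 's" assume i: "\<forall>k. i k \<in> S"
    let ?P = "path_event m i" and ?Y = "\<lambda>j. {w \<in> space M. Y (Suc m) w = j}" and ?N = "nbs (i m)"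
    have N: "finite ?N" "?N \<subseteq> S" "(\<Sum>j\<in>?N. jump_prob S q (i m) j) = 1" using nbs i by auto
    have next_P: "prob (?P \<inter> ?Y j) = prob ?P * jump_prob S q (i m) j" if "j \<in> ?N" for j
      using prob_path_next[OF i, of j m] that N by auto
    have "prob (\<Union>j\<in>?N. ?P \<inter> ?Y j) = (\<Sum>j\<in>?N. prob (?P \<inter> ?Y j))"
      using N by (intro finite_measure_finite_Union) (auto simp: disjoint_family_on_def)
    also have "\<dots> = prob ?P"
      using N(3) by (simp add: next_P sum_distrib_left[symmetric])
    finally have "prob (?P - (\<Union>j\<in>?N. ?P \<inter> ?Y j)) = 0"
      using N by (subst finite_measure_Diff) (auto intro!: sets.finite_UN)
    then have "emeasure M (?P - (\<Union>j\<in>?N. ?P \<inter> ?Y j)) = 0" by (simp add: emeasure_eq_measure)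
    then have "AE w in M. w \<notin> ?P - (\<Union>j\<in>?N. ?P \<inter> ?Y j)"
      using N by (intro AE_not_in) (auto simp: null_sets_def intro!: sets.finite_UN sets.Diff)
    then have "(\<integral>\<^sup>+w. ennreal (g (Y (Suc m) w)) * indicator ?P w \<partial>M)
       = (\<integral>\<^sup>+w. (\<Sum>j\<in>?N. ennreal (g j) * indicator (?P \<inter> ?Y j) w) \<partial>M)"
    proof (intro nn_integral_cong_AE, eventually_elim)
      case (elim w)
      show ?case
      proof (cases "w \<in> ?P")
        case True
        then have "Y (Suc m) w \<in> ?N" "w \<in> space M" using elim by (auto simp: path_event_def)
        then have "(\<Sum>j\<in>?N. ennreal (g j) * indicator (?P \<inter> ?Y j) w) =
            (\<Sum>j\<in>?N. if j = Y (Suc m) w then ennreal (g j) else 0)"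
          using True by (intro sum.cong) (auto simp: indicator_def)
        then show ?thesis using True N \<open>Y (Suc m) w \<in> ?N\<close> by simp
      qed auto
    qed
    also have "\<dots> = (\<Sum>j\<in>?N. ennreal (g j) * emeasure M (?P \<inter> ?Y j))"
      by (subst nn_integral_sum) (auto simp: nn_integral_cmult_indicator)
    also have "\<dots> = (\<Sum>j\<in>?N. ennreal (g j * (prob ?P * jump_prob S q (i m) j)))"
      using g N(2) by (intro sum.cong refl)
        (auto simp: emeasure_eq_measure next_P ennreal_mult' [symmetric] subset_iff)
    also have "\<dots> = ennreal (prob ?P * (\<Sum>j\<in>?N. jump_prob S q (i m) j * g j))"
      using g N(2) jump_prob_nonneg i
      by (subst sum_ennreal) (auto simp: sum_distrib_left mult_ac subset_iff intro!: mult_nonneg_nonneg)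
    also have "\<dots> \<le> ennreal (prob ?P * (\<gamma> * g (i m)))"
      using drift i by (intro ennreal_leI mult_left_mono) auto
    also have "\<dots> = (\<integral>\<^sup>+w. ennreal (\<gamma> * g (i m)) * indicator ?P w \<partial>M)"
      using g gam i by (simp add: nn_integral_cmult_indicator emeasure_eq_measure ennreal_mult'[symmetric] mult.commute)
    also have "\<dots> = (\<integral>\<^sup>+w. ennreal (\<gamma> * g (Y m w)) * indicator ?P w \<partial>M)"
      by (intro nn_integral_cong) (auto simp: indicator_def path_event_def)
    finally show "(\<integral>\<^sup>+w. ennreal (g (Y (Suc m) w)) * indicator ?P w \<partial>M)
       \<le> (\<integral>\<^sup>+w. ennreal (\<gamma> * g (Y m w)) * indicator ?P w \<partial>M)" .
  qed (fact meas)
  also have "\<dots> = (\<integral>\<^sup>+w. ennreal \<gamma> * ennreal (g (Y m w)) \<partial>M)"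
    using gam by (simp add: ennreal_mult')
  also have "\<dots> = \<gamma> * (\<integral>\<^sup>+w. g (Y m w) \<partial>M)"
    by (rule nn_integral_cmult[OF meas])
  finally show ?thesis .
qed

text \<open>
  A geometric drift is stronger than the usual supermartingale criterion: visits to \<open>s\<close> at time \<open>m\<close> have
  probability at most \<open>\<gamma> ^ m * B / g s\<close>, which is summable.
\<close>

lemma AE_finitely_many_visits:
  fixes g :: "'s \<Rightarrow> real"
  assumes g: "\<And>i. i \<in> S \<Longrightarrow> 0 < g i \<and> g i \<le> B" and gam: "0 \<le> \<gamma>" "\<gamma> < 1"
    and drift: "\<And>i. i \<in> S \<Longrightarrow> (\<Sum>j\<in>nbs i. jump_prob S q i j * g j) \<le> \<gamma> * g i"
    and s: "s \<in> S"
  shows "AE w in M. \<exists>m. \<forall>k\<ge>m. Y k w \<noteq> s"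
proof -
  have B: "0 \<le> B" using g[OF s] by linarith
  have E: "(\<integral>\<^sup>+w. g (Y m w) \<partial>M) \<le> ennreal (\<gamma> ^ m * B)" for m
  proof (induction m)
    case 0
    have "(\<integral>\<^sup>+w. g (Y 0 w) \<partial>M) \<le> (\<integral>\<^sup>+w. ennreal B \<partial>M)"
      using g measurable_space[OF Y_measurable] by (intro nn_integral_mono ennreal_leI) auto
    then show ?case by (simp add: emeasure_space_1)
  next
    case (Suc m)
    have "(\<integral>\<^sup>+w. g (Y (Suc m) w) \<partial>M) \<le> \<gamma> * (\<integral>\<^sup>+w. g (Y m w) \<partial>M)"
      using g gam drift by (intro drift_expectation) (auto intro: less_imp_le)
    also have "\<dots> \<le> \<gamma> * ennreal (\<gamma> ^ m * B)"
      by (intro mult_left_mono Suc) auto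
    also have "\<dots> = ennreal (\<gamma> ^ Suc m * B)" using gam by (simp add: ennreal_mult'[symmetric] mult.assoc)
    finally show ?case .
  qed
  have P: "prob {w \<in> space M. Y m w = s} \<le> \<gamma> ^ m * (B / g s)" for m
  proof -
    have "ennreal (g s * prob {w \<in> space M. Y m w = s}) =
       (\<integral>\<^sup>+w. ennreal (g s) * indicator {w \<in> space M. Y m w = s} w \<partial>M)"
      using g[OF s] by (simp add: nn_integral_cmult_indicator emeasure_eq_measure ennreal_mult')
    also have "\<dots> \<le> (\<integral>\<^sup>+w. g (Y m w) \<partial>M)"
      by (intro nn_integral_mono) (auto simp: indicator_def)
    also have "\<dots> \<le> ennreal (\<gamma> ^ m * B)" by (rule E)
    finally have "g s * prob {w \<in> space M. Y m w = s} \<le> \<gamma> ^ m * B"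
      using gam B by (subst (asm) ennreal_le_iff) auto
    then show ?thesis using g[OF s] by (simp add: field_simps)
  qed
  have "AE w in M. eventually (\<lambda>m. w \<in> space M - {w \<in> space M. Y m w = s}) sequentially"
  proof (rule borel_cantelli_AE1)
    show "summable (\<lambda>m. prob {w \<in> space M. Y m w = s})"
    proof (rule summable_comparison_test')
      show "summable (\<lambda>m. \<gamma> ^ m * (B / g s))"
        using gam by (intro summable_mult2 summable_geometric) auto
    qed (use P in auto)
  qed (auto simp: emeasure_eq_measure)
  then show ?thesis
    by (auto simp: eventually_sequentially elim!: eventually_mono)
qed

end

lemma exit_rate_finite:
  assumes "finite N" "N \<subseteq> S - {i}" "\<And>j. j \<in> S - {i} - N \<Longrightarrow> q i j = 0"
  shows "exit_rate S q i = (\<Sum>j\<in>N. q i j)"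
proof -
  have "exit_rate S q i = (\<Sum>\<^sub>\<infinity>j\<in>N. q i j)"
    unfolding exit_rate_def using assms by (intro infsum_cong_neutral) auto
  then show ?thesis using assms by simp
qed

text \<open>
  After the last visit of the jump chain to \<open>s\<close> the process never returns, and the time of that visit is
  finite; as the holding times add up to infinity, every later time lies in a holding interval.
\<close>

theorem transient_by_drift:
  fixes S :: "'s set" and q :: "'s \<Rightarrow> 's \<Rightarrow> real" and g :: "'s \<Rightarrow> real"
  assumes X: "markov_jump_process M S q X"
    and "countable S"
    and q_nonneg: "\<And>i j. i \<in> S \<Longrightarrow> j \<in> S \<Longrightarrow> 0 \<le> q i j"
    and nbs: "\<And>i. i \<in> S \<Longrightarrow> finite (nbs i) \<and> nbs i \<subseteq> S - {i} \<and> (\<forall>j\<in>S - {i} - nbs i. q i j = 0)"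
    and rates: "\<And>i. i \<in> S \<Longrightarrow> 0 < (\<Sum>j\<in>nbs i. q i j) \<and> (\<Sum>j\<in>nbs i. q i j) \<le> C"
    and g: "\<And>i. i \<in> S \<Longrightarrow> 0 < g i \<and> g i \<le> B"
    and "0 < \<epsilon>"
    and drift: "\<And>i. i \<in> S \<Longrightarrow> (\<Sum>j\<in>nbs i. q i j * (g j - g i)) \<le> - \<epsilon> * g i"
  shows "transient_process M S X"
proof -
  have exit: "exit_rate S q i = (\<Sum>j\<in>nbs i. q i j)" if "i \<in> S" for i
    using nbs[OF that] by (intro exit_rate_finite) auto
  obtain Y H where Y: "\<And>k. Y k \<in> M \<rightarrow>\<^sub>M count_space S" and H: "\<And>k. H k \<in> borel_measurable M"
    and law: "\<And>m i t. \<lbrakk>\<forall>k\<le>m. i k \<in> S; \<forall>k<m. 0 \<le> t k\<rbrakk> \<Longrightarrow>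
           measure M {w \<in> space M. (\<forall>k\<le>m. Y k w = i k) \<and> (\<forall>k<m. t k < H k w)} =
           measure M {w \<in> space M. Y 0 w = i 0} *
             (\<Prod>k<m. jump_prob S q (i k) (i (Suc k)) * exp (- exit_rate S q (i k) * t k))"
    and XY: "AE w in M. \<forall>k t. (\<Sum>j<k. H j w) \<le> t \<and> t < (\<Sum>j<Suc k. H j w) \<longrightarrow> X t w = Y k w"
    and "prob_space M"
    using X unfolding markov_jump_process_def by blast
  interpret prob_space M by fact
  have jp: "jump_prob S q i j = q i j / exit_rate S q i" if "i \<in> S" "j \<in> nbs i" for i j
    using nbs that by (auto simp: jump_prob_def)
  interpret jump_chain M S q Y H nbs C
  proof
    show "0 \<le> jump_prob S q i j" if "i \<in> S" "j \<in> S" for i j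
      using rates that q_nonneg by (auto simp: jump_prob_def exit intro!: divide_nonneg_pos)
    show "finite (nbs i) \<and> nbs i \<subseteq> S \<and> (\<Sum>j\<in>nbs i. jump_prob S q i j) = 1" if "i \<in> S" for i
    proof -
      have "(\<Sum>j\<in>nbs i. jump_prob S q i j) = (\<Sum>j\<in>nbs i. q i j) / exit_rate S q i"
        by (simp add: jp that sum_divide_distrib)
      then show ?thesis using nbs[OF that] rates[OF that] by (auto simp: exit that)
    qed
    show "0 \<le> exit_rate S q i \<and> exit_rate S q i \<le> C" if "i \<in> S" for i
      using rates that by (force simp: exit)
  qed (use \<open>countable S\<close> Y H law in auto)
  define \<gamma> where "\<gamma> = max 0 (1 - \<epsilon> / C)"
  have drift': "(\<Sum>j\<in>nbs i. jump_prob S q i j * g j) \<le> \<gamma> * g i" if i: "i \<in> S" for i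
  proof -
    let ?e = "exit_rate S q i"
    have e: "0 < ?e" "?e \<le> C" using rates i by (auto simp: exit)
    have "(\<Sum>j\<in>nbs i. jump_prob S q i j * g j) = (\<Sum>j\<in>nbs i. q i j * g j) / ?e"
      by (simp add: jp i sum_divide_distrib)
    also have "(\<Sum>j\<in>nbs i. q i j * g j) = (\<Sum>j\<in>nbs i. q i j * (g j - g i)) + ?e * g i"
      by (simp add: exit i right_diff_distrib sum_subtractf sum_distrib_right)
    also have "\<dots> / ?e \<le> (- \<epsilon> * g i + ?e * g i) / ?e"
      using drift[OF i] e by (intro divide_right_mono) auto
    also have "\<dots> = (1 - \<epsilon> / ?e) * g i" using e by (simp add: field_simps)
    also have "\<dots> \<le> \<gamma> * g i"
    proof (rule mult_right_mono)
      have "\<epsilon> / C \<le> \<epsilon> / ?e" using e \<open>0 < \<epsilon>\<close> by (intro divide_left_mono) auto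
      then show "1 - \<epsilon> / ?e \<le> \<gamma>" by (simp add: \<gamma>_def)
    qed (use g i in \<open>auto intro: less_imp_le\<close>)
    finally show ?thesis .
  qed
  show ?thesis
    unfolding transient_process_def
  proof
    fix s assume s: "s \<in> S"
    then have "0 < C" using rates[OF s] by linarith
    then have "AE w in M. \<exists>m. \<forall>k\<ge>m. Y k w \<noteq> s"
      using \<open>0 < \<epsilon>\<close> s by (intro AE_finitely_many_visits[where g=g and B=B, OF g _ _ drift']) (auto simp: \<gamma>_def)
    moreover have "AE w in M. \<forall>m. \<exists>k\<ge>m. 1 < H k w"
      using AE_long_holding_time by (simp add: AE_all_countable)
    moreover have "AE w in M. \<forall>m. \<forall>k<m. 0 < H k w"
      using AE_holding_pos by (simp add: AE_all_countable)
    ultimately show "AE w in M. bounded {t. 0 \<le> t \<and> X t w = s}"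
      using XY
    proof eventually_elim
      case (elim w)
      then obtain m where m: "\<forall>k\<ge>m. Y k w \<noteq> s" by blast
      let ?T = "\<lambda>k. \<Sum>j<k. H j w"
      have pos: "0 < H k w" for k using elim(3) by blast
      have mono: "?T k \<le> ?T k'" if "k \<le> k'" for k k'
        using pos that by (intro sum_mono2) (auto intro: less_imp_le)
      have large: "\<exists>k. real n \<le> ?T k" for n
      proof (induction n)
        case 0
        show ?case by (auto intro!: exI[of _ 0])
      next
        case (Suc n)
        then obtain k where k: "real n \<le> ?T k" ..
        obtain l where l: "k \<le> l" "1 < H l w" using elim(2) by blast
        have "real (Suc n) \<le> ?T k + H l w" using k l by simp
        also have "\<dots> \<le> ?T (Suc l)" using mono[OF l(1)] by simp
        finally show ?case ..
      qed
      have "t \<le> ?T m" if t: "0 \<le> t" "X t w = s" for t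
      proof (rule ccontr)
        assume "\<not> t \<le> ?T m"
        obtain n where "t < real n" using reals_Archimedean2 by blast
        then obtain k1 where "t < ?T k1" using large[of n] less_le_trans by blast
        \<comment> \<open>the holding interval containing \<open>t\<close> is the one before the first partial sum beyond \<open>t\<close>\<close>
        define k where "k = (LEAST k. t < ?T k)"
        have k: "t < ?T k" unfolding k_def using \<open>t < ?T k1\<close> by (rule LeastI)
        then have "m < k" using \<open>\<not> t \<le> ?T m\<close> mono[of k m] by (cases "m < k") auto
        then obtain k' where k': "k = Suc k'" by (cases k) auto
        have "\<not> t < ?T k'" using k' unfolding k_def by (intro not_less_Least) auto
        then have "X t w = Y k' w" using elim(4) k k' by (auto simp: not_less)
        moreover have "m \<le> k'" using \<open>m < k\<close> k' by simp
        ultimately show False using m t by auto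
      qed
      then have "{t. 0 \<le> t \<and> X t w = s} \<subseteq> {0..?T m}" by auto
      then show ?case by (rule bounded_subset[OF bounded_closed_interval])
    qed
  qed
qed

section \<open>Generators of population processes\<close>

abbreviation inc :: "nat \<Rightarrow> (nat \<Rightarrow> nat) \<Rightarrow> nat \<Rightarrow> nat" where
  "inc k n \<equiv> n(k := Suc (n k))"

text \<open>
  At \<open>n k = 0\<close> the truncated subtraction makes this a void transition.
\<close>

abbreviation dec :: "nat \<Rightarrow> (nat \<Rightarrow> nat) \<Rightarrow> nat \<Rightarrow> nat" where
  "dec k n \<equiv> n(k := n k - Suc 0)"

text \<open>
  The generator of \<open>birth_death_rate\<close>, on functions of all vectors. It agrees with the sum over target
  states as long as death rates vanish for absent classes.
\<close>

definition gen ::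
  "nat set \<Rightarrow> (nat \<Rightarrow> real) \<Rightarrow> ((nat \<Rightarrow> nat) \<Rightarrow> nat \<Rightarrow> real) \<Rightarrow> ((nat \<Rightarrow> nat) \<Rightarrow> real) \<Rightarrow> (nat \<Rightarrow> nat) \<Rightarrow> real" where
  "gen K b d f n = (\<Sum>k\<in>K. b k * (f (inc k n) - f n)) + (\<Sum>k\<in>K. d n k * (f (dec k n) - f n))"

definition neighbours :: "nat set \<Rightarrow> (nat \<Rightarrow> nat) \<Rightarrow> (nat \<Rightarrow> nat) set" where
  "neighbours K n = (\<lambda>k. inc k n) ` K \<union> (\<lambda>k. dec k n) ` {k \<in> K. 0 < n k}"

text \<open>
  The probability flow into \<open>j\<close> under weights \<open>v\<close>: the action of the generator on measures.
\<close>

definition inflow ::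
  "nat set \<Rightarrow> (nat \<Rightarrow> real) \<Rightarrow> ((nat \<Rightarrow> nat) \<Rightarrow> nat \<Rightarrow> real) \<Rightarrow> ((nat \<Rightarrow> nat) \<Rightarrow> real) \<Rightarrow> (nat \<Rightarrow> nat) \<Rightarrow> real" where
  "inflow K b d v j = (\<Sum>k\<in>K. b k * (if 0 < j k then v (dec k j) else 0)) + (\<Sum>k\<in>K. d (inc k j) k * v (inc k j))"

definition total_rate ::
  "nat set \<Rightarrow> (nat \<Rightarrow> real) \<Rightarrow> ((nat \<Rightarrow> nat) \<Rightarrow> nat \<Rightarrow> real) \<Rightarrow> (nat \<Rightarrow> nat) \<Rightarrow> real" where
  "total_rate K b d n = (\<Sum>k\<in>K. b k) + (\<Sum>k\<in>K. d n k)"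

lemma countable_populations:
  assumes "finite K"
  shows "countable (populations K)"
proof -
  have "inj_on (\<lambda>n. restrict n K) (populations K)"
  proof (rule inj_onI, rule ext)
    fix n m k assume "n \<in> populations K" "m \<in> populations K" "restrict n K = restrict m K"
    then show "n k = m k" by (cases "k \<in> K") (auto simp: populations_def dest!: fun_cong[of _ _ k])
  qed
  moreover have "(\<lambda>n. restrict n K) ` populations K \<subseteq> PiE K (\<lambda>_. UNIV)" by auto
  moreover have "countable (PiE K (\<lambda>_. UNIV :: nat set))" by (intro countable_PiE assms) auto
  ultimately show ?thesis by (meson countable_image_inj_on countable_subset)
qed

lemma eq_inc_iff: "n = inc k m \<longleftrightarrow> 0 < n k \<and> m = dec k n"
  by (auto simp: fun_eq_iff)

lemma inc_populations: "n \<in> populations K \<Longrightarrow> k \<in> K \<Longrightarrow> inc k n \<in> populations K"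
  by (auto simp: populations_def)

lemma dec_populations: "n \<in> populations K \<Longrightarrow> dec k n \<in> populations K"
  by (auto simp: populations_def)

lemma inc_neq: "inc k n \<noteq> n"
  by (auto dest: fun_cong[of _ _ k])

lemma dec_neq: "0 < n k \<Longrightarrow> dec k n \<noteq> n"
  by (auto dest: fun_cong[of _ _ k])

lemma neighbours:
  assumes "finite K" "n \<in> populations K"
  shows "finite (neighbours K n)" "neighbours K n \<subseteq> populations K - {n}"
  using assms by (auto simp: neighbours_def inc_populations dec_populations inc_neq dec_neq simp del: fun_upd_apply)

lemma rate_outside_neighbours:
  "m \<notin> neighbours K n \<Longrightarrow> birth_death_rate K b d n m = 0"
  "m \<notin> neighbours K n \<Longrightarrow> birth_death_rate K b d m n = 0"
proof -
  assume "m \<notin> neighbours K n"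
  then have "m \<noteq> inc k n" "n \<noteq> inc k m" if "k \<in> K" for k
    using that by (auto simp: neighbours_def eq_inc_iff[of n])
  then show "birth_death_rate K b d n m = 0" "birth_death_rate K b d m n = 0"
    by (auto simp: birth_death_rate_def intro!: sum.neutral)
qed

lemma sum_rate_out:
  assumes K: "finite K" and d: "\<And>k. k \<in> K \<Longrightarrow> n k = 0 \<Longrightarrow> d n k = 0"
  shows "(\<Sum>m\<in>neighbours K n. birth_death_rate K b d n m * F m) =
    (\<Sum>k\<in>K. b k * F (inc k n)) + (\<Sum>k\<in>K. d n k * F (dec k n))"
proof -
  have fin: "finite (neighbours K n)" using K by (simp add: neighbours_def)
  have "(\<Sum>m\<in>neighbours K n. birth_death_rate K b d n m * F m) =
     (\<Sum>m\<in>neighbours K n. (\<Sum>k\<in>K. if m = inc k n then b k * F m else 0)) +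
     (\<Sum>m\<in>neighbours K n. (\<Sum>k\<in>K. if n = inc k m then d n k * F m else 0))"
    by (simp add: birth_death_rate_def distrib_right sum_distrib_right sum.distrib if_distrib[of "\<lambda>x. x * _"] cong: if_cong)
  also have "(\<Sum>m\<in>neighbours K n. (\<Sum>k\<in>K. if m = inc k n then b k * F m else 0)) =
      (\<Sum>k\<in>K. b k * F (inc k n))"
    using fin by (subst sum.swap, intro sum.cong refl) (auto simp: neighbours_def)
  also have "(\<Sum>m\<in>neighbours K n. (\<Sum>k\<in>K. if n = inc k m then d n k * F m else 0)) =
      (\<Sum>k\<in>K. d n k * F (dec k n))"
  proof (subst sum.swap, intro sum.cong refl)
    fix k assume k: "k \<in> K"
    show "(\<Sum>m\<in>neighbours K n. if n = inc k m then d n k * F m else 0) = d n k * F (dec k n)"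
    proof (cases "n k = 0")
      case True
      then show ?thesis using d[OF k] by (auto intro!: sum.neutral)
    next
      case False
      then have "dec k n \<in> neighbours K n" using k by (auto simp: neighbours_def)
      then show ?thesis using False fin by (simp add: eq_inc_iff[of n])
    qed
  qed
  finally show ?thesis .
qed

lemma sum_rate_in:
  assumes K: "finite K"
  shows "(\<Sum>i\<in>neighbours K j. v i * birth_death_rate K b d i j) = inflow K b d v j"
proof -
  have fin: "finite (neighbours K j)" using K by (simp add: neighbours_def)
  have "(\<Sum>i\<in>neighbours K j. v i * birth_death_rate K b d i j) =
     (\<Sum>i\<in>neighbours K j. (\<Sum>k\<in>K. if j = inc k i then b k * v i else 0)) +
     (\<Sum>i\<in>neighbours K j. (\<Sum>k\<in>K. if i = inc k j then d i k * v i else 0))"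
    by (simp add: birth_death_rate_def distrib_left sum_distrib_left sum.distrib if_distrib[of "\<lambda>x. _ * x"] mult.commute cong: if_cong)
  also have "(\<Sum>i\<in>neighbours K j. (\<Sum>k\<in>K. if i = inc k j then d i k * v i else 0)) =
      (\<Sum>k\<in>K. d (inc k j) k * v (inc k j))"
    using fin by (subst sum.swap, intro sum.cong refl) (auto simp: neighbours_def)
  also have "(\<Sum>i\<in>neighbours K j. (\<Sum>k\<in>K. if j = inc k i then b k * v i else 0)) =
      (\<Sum>k\<in>K. b k * (if 0 < j k then v (dec k j) else 0))"
  proof (subst sum.swap, intro sum.cong refl)
    fix k assume k: "k \<in> K"
    show "(\<Sum>i\<in>neighbours K j. if j = inc k i then b k * v i else 0) = b k * (if 0 < j k then v (dec k j) else 0)"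
    proof (cases "j k = 0")
      case True
      then show ?thesis by (auto intro!: sum.neutral)
    next
      case False
      then have "dec k j \<in> neighbours K j" using k by (auto simp: neighbours_def)
      then show ?thesis using False fin by (simp add: eq_inc_iff[of j])
    qed
  qed
  finally show ?thesis by (simp only: inflow_def)
qed

lemma exit_rate_birth_death:
  assumes K: "finite K" and n: "n \<in> populations K" and d: "\<And>k. k \<in> K \<Longrightarrow> n k = 0 \<Longrightarrow> d n k = 0"
  shows "exit_rate (populations K) (birth_death_rate K b d) n = total_rate K b d n"
  using sum_rate_out[of K n d b "\<lambda>_. 1", OF K d] neighbours[OF K n]
  by (subst exit_rate_finite[where N="neighbours K n"]) (auto simp: total_rate_def rate_outside_neighbours)

theorem transient_birth_death:
  assumes X: "markov_jump_process M (populations K) (birth_death_rate K b d) X"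
    and K: "finite K" "K \<noteq> {}" and b: "\<And>k. k \<in> K \<Longrightarrow> 0 < b k"
    and d: "\<And>n k. n \<in> populations K \<Longrightarrow> k \<in> K \<Longrightarrow> 0 \<le> d n k \<and> d n k \<le> D k"
    and d0: "\<And>n k. n \<in> populations K \<Longrightarrow> k \<in> K \<Longrightarrow> n k = 0 \<Longrightarrow> d n k = 0"
    and g: "\<And>n. n \<in> populations K \<Longrightarrow> 0 < g n \<and> g n \<le> B"
    and "0 < \<epsilon>"
    and drift: "\<And>n. n \<in> populations K \<Longrightarrow> gen K b d g n \<le> - \<epsilon> * g n"
  shows "transient_process M (populations K) X"
proof (rule transient_by_drift[OF X countable_populations[OF K(1)] _ _ _ g \<open>0 < \<epsilon>\<close>,
      where nbs="neighbours K" and C="sum b K + sum D K"])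
  show "0 \<le> birth_death_rate K b d i j" if "i \<in> populations K" for i j
    unfolding birth_death_rate_def using that b d by (intro add_nonneg_nonneg sum_nonneg) (auto intro: less_imp_le)
  show "finite (neighbours K i) \<and> neighbours K i \<subseteq> populations K - {i} \<and>
     (\<forall>j\<in>populations K - {i} - neighbours K i. birth_death_rate K b d i j = 0)" if "i \<in> populations K" for i
    using neighbours[OF K(1) that] by (auto simp: rate_outside_neighbours)
  fix i assume i: "i \<in> populations K"
  have "(\<Sum>j\<in>neighbours K i. birth_death_rate K b d i j) = sum b K + sum (d i) K"
    using sum_rate_out[of K i d b "\<lambda>_. 1"] K(1) d0[OF i] by simp
  moreover have "0 < sum b K" using K b by (intro sum_pos) auto
  moreover have "0 \<le> sum (d i) K" "sum (d i) K \<le> sum D K" using d[OF i] by (auto intro!: sum_nonneg sum_mono)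
  ultimately show "0 < (\<Sum>j\<in>neighbours K i. birth_death_rate K b d i j) \<and>
     (\<Sum>j\<in>neighbours K i. birth_death_rate K b d i j) \<le> sum b K + sum D K" by simp
  show "(\<Sum>j\<in>neighbours K i. birth_death_rate K b d i j * (g j - g i)) \<le> - \<epsilon> * g i"
    using drift[OF i] K(1) d0[OF i] by (subst sum_rate_out) (auto simp: gen_def)
qed

lemma is_stationary_distribution_iff:
  assumes K: "finite K" and d: "\<And>n k. n \<in> populations K \<Longrightarrow> k \<in> K \<Longrightarrow> n k = 0 \<Longrightarrow> d n k = 0"
  shows "is_stationary_distribution (populations K) (birth_death_rate K b d) p \<longleftrightarrow>
    set_pmf p \<subseteq> populations K \<and>
    (\<forall>j\<in>populations K. inflow K b d (pmf p) j = pmf p j * total_rate K b d j)"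
proof -
  have "((\<lambda>i. pmf p i * birth_death_rate K b d i j) has_sum s) (populations K - {j}) \<longleftrightarrow>
      inflow K b d (pmf p) j = s" if j: "j \<in> populations K" for j s
  proof -
    have "((\<lambda>i. pmf p i * birth_death_rate K b d i j) has_sum s) (populations K - {j}) \<longleftrightarrow>
        ((\<lambda>i. pmf p i * birth_death_rate K b d i j) has_sum s) (neighbours K j)"
      using neighbours[OF K j] by (intro has_sum_cong_neutral) (auto simp: rate_outside_neighbours)
    also have "\<dots> \<longleftrightarrow> inflow K b d (pmf p) j = s"
      using neighbours[OF K j] sum_rate_in[OF K, of "pmf p" b d j] has_sum_finite_iff by metis
    finally show ?thesis .
  qed
  then show ?thesis
    using exit_rate_birth_death[OF K _ d] by (auto simp: is_stationary_distribution_def)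
qed

section \<open>Uniqueness of the stationary distribution\<close>

text \<open>
  A zero spreads to all states from which there is a transition into it. Going down to the empty
  population and up again reaches every state.
\<close>

lemma invariant_zero_everywhere:
  assumes K: "finite K" and b: "\<And>k. k \<in> K \<Longrightarrow> 0 < b k"
    and d: "\<And>n k. n \<in> populations K \<Longrightarrow> k \<in> K \<Longrightarrow> 0 < n k \<Longrightarrow> 0 < d n k"
    and v: "\<And>n. n \<in> populations K \<Longrightarrow> 0 \<le> v n"
    and inv: "\<And>n. n \<in> populations K \<Longrightarrow> inflow K b d v n = v n * total_rate K b d n"
    and j: "j \<in> populations K" "v j = 0" and n: "n \<in> populations K"
  shows "v n = 0"
proof -
  have step: "(0 < i k \<longrightarrow> v (dec k i) = 0) \<and> v (inc k i) = 0"
    if i: "i \<in> populations K" "v i = 0" and k: "k \<in> K" for i k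
  proof -
    have dp: "0 < d (inc k i) k" if "k \<in> K" for k
      using that i by (intro d inc_populations) auto
    have nn: "0 \<le> b k * (if 0 < i k then v (dec k i) else 0)" "0 \<le> d (inc k i) k * v (inc k i)" if "k \<in> K" for k
      using that b[OF that] dp[OF that] v i by (auto intro!: mult_nonneg_nonneg v inc_populations dec_populations simp: less_imp_le)
    have "inflow K b d v i = 0" using inv[OF i(1)] i by simp
    then have "(\<Sum>k\<in>K. b k * (if 0 < i k then v (dec k i) else 0)) = 0"
        "(\<Sum>k\<in>K. d (inc k i) k * v (inc k i)) = 0"
      using sum_nonneg[of K "\<lambda>k. b k * (if 0 < i k then v (dec k i) else 0)", OF nn(1)]
        sum_nonneg[of K "\<lambda>k. d (inc k i) k * v (inc k i)", OF nn(2)] unfolding inflow_def by linarith+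
    then have "b k * (if 0 < i k then v (dec k i) else 0) = 0" "d (inc k i) k * v (inc k i) = 0"
      using sum_nonneg_eq_0_iff[of K "\<lambda>k. b k * (if 0 < i k then v (dec k i) else 0)", OF K nn(1)]
        sum_nonneg_eq_0_iff[of K "\<lambda>k. d (inc k i) k * v (inc k i)", OF K nn(2)] k by blast+
    then show ?thesis using b[OF k] dp[OF k] by (auto split: if_splits)
  qed
  have ex: "\<exists>k\<in>K. 0 < i k" if "i \<in> populations K" "i \<noteq> (\<lambda>_. 0)" for i
    using that by (auto simp: populations_def fun_eq_iff)
  have less: "sum (dec k i) K < sum i K" if "k \<in> K" "0 < i k" for i :: "nat \<Rightarrow> nat" and k
    using that K by (intro sum_strict_mono_ex1) auto
  have zero: "i \<in> populations K \<Longrightarrow> v i = 0 \<Longrightarrow> v (\<lambda>_. 0) = 0" for i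
  proof (induction "sum i K" arbitrary: i rule: less_induct)
    case less': less
    show ?case
    proof (cases "i = (\<lambda>_. 0)")
      case False
      then obtain k where k: "k \<in> K" "0 < i k" using ex less' by blast
      show ?thesis using less'(1)[OF less[of k i, OF k]] step[OF less'(2,3) k(1)] k less'(2) by (simp add: dec_populations)
    qed (use less' in simp)
  qed
  show ?thesis using n
  proof (induction "sum n K" arbitrary: n rule: less_induct)
    case less': less
    show ?case
    proof (cases "n = (\<lambda>_. 0)")
      case False
      then obtain k where k: "k \<in> K" "0 < n k" using ex less' by blast
      have "v (inc k (dec k n)) = 0"
        using less'(1)[OF less[of k n, OF k]] step[of "dec k n" k] k less'(2) by (simp add: dec_populations)
      then show ?thesis using k by simp
    qed (use zero[OF j] in simp)
  qed
qed

lemma has_sum_finite_sum: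
  fixes f :: "'i \<Rightarrow> 'a \<Rightarrow> real"
  assumes "finite I" "\<And>i. i \<in> I \<Longrightarrow> (f i has_sum s i) A"
  shows "((\<lambda>x. \<Sum>i\<in>I. f i x) has_sum (\<Sum>i\<in>I. s i)) A"
  using assms by (induction I rule: finite_induct) (auto intro: has_sum_add)

text \<open>
  Total inflow equals total outflow: each transition is counted once on either side, after shifting
  the summation index by one unit.
\<close>

lemma has_sum_inflow:
  assumes K: "finite K" and d: "\<And>n k. n \<in> populations K \<Longrightarrow> k \<in> K \<Longrightarrow> 0 \<le> d n k \<and> d n k \<le> D k"
    and d0: "\<And>n k. n \<in> populations K \<Longrightarrow> k \<in> K \<Longrightarrow> n k = 0 \<Longrightarrow> d n k = 0"
    and v: "\<And>n. n \<in> populations K \<Longrightarrow> 0 \<le> v n" and sv: "v summable_on populations K"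
  obtains s where "(inflow K b d v has_sum s) (populations K)"
    "((\<lambda>n. v n * total_rate K b d n) has_sum s) (populations K)"
proof -
  let ?S = "populations K"
  have inj: "inj_on (inc k) ?S" for k
    by (auto simp: inj_on_def eq_inc_iff)
  have img: "inc k ` ?S = {j \<in> ?S. 0 < j k}" if "k \<in> K" for k
  proof (intro equalityI subsetI)
    fix j assume "j \<in> {j \<in> ?S. 0 < j k}"
    then have "j = inc k (dec k j)" "dec k j \<in> ?S" by (auto simp: dec_populations)
    then show "j \<in> inc k ` ?S" by blast
  qed (auto simp: that inc_populations)
  have births: "((\<lambda>j. if 0 < j k then v (dec k j) else 0) has_sum infsum v ?S) ?S" if k: "k \<in> K" for k
  proof -
    have "((\<lambda>j. v (dec k j)) has_sum infsum v ?S) (inc k ` ?S)"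
      using sv by (subst has_sum_reindex[OF inj]) (auto simp: o_def)
    then show ?thesis
      by (subst (asm) img[OF k], subst has_sum_cong_neutral[where T="{j \<in> ?S. 0 < j k}"]) auto
  qed
  have sd: "(\<lambda>n. d n k * v n) summable_on ?S" if k: "k \<in> K" for k
    using d k v by (intro summable_on_comparison_test[OF summable_on_cmult_right[OF sv, of "D k"]]) (auto intro: mult_right_mono)
  have deaths: "((\<lambda>j. d (inc k j) k * v (inc k j)) has_sum (infsum (\<lambda>n. d n k * v n) ?S)) ?S" if k: "k \<in> K" for k
  proof -
    have "((\<lambda>n. d n k * v n) has_sum (infsum (\<lambda>n. d n k * v n) ?S)) ?S" using sd[OF k] by simp
    then have "((\<lambda>n. d n k * v n) has_sum (infsum (\<lambda>n. d n k * v n) ?S)) (inc k ` ?S)"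
      using d0 k by (subst img[OF k], subst (asm) has_sum_cong_neutral[where T="{j \<in> ?S. 0 < j k}"]) auto
    then show ?thesis by (subst (asm) has_sum_reindex[OF inj]) (auto simp: o_def)
  qed
  have "(inflow K b d v has_sum (\<Sum>k\<in>K. b k * infsum v ?S) + (\<Sum>k\<in>K. infsum (\<lambda>n. d n k * v n) ?S)) ?S"
    unfolding inflow_def[abs_def]
    by (intro has_sum_add has_sum_finite_sum has_sum_cmult_right births deaths K)
  moreover have "((\<lambda>n. v n * total_rate K b d n) has_sum (\<Sum>k\<in>K. b k * infsum v ?S) + (\<Sum>k\<in>K. infsum (\<lambda>n. d n k * v n) ?S)) ?S"
  proof -
    have "((\<lambda>n. (\<Sum>k\<in>K. b k * v n) + (\<Sum>k\<in>K. d n k * v n)) has_sum (\<Sum>k\<in>K. b k * infsum v ?S) + (\<Sum>k\<in>K. infsum (\<lambda>n. d n k * v n) ?S)) ?S"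
      using sv sd by (intro has_sum_add has_sum_finite_sum has_sum_cmult_right K) auto
    then show ?thesis by (simp add: total_rate_def distrib_left sum_distrib_left mult.commute)
  qed
  ultimately show ?thesis using that by blast
qed

text \<open>
  The minimum \<open>v\<close> of two stationary distributions satisfies \<open>inflow v \<le> v * total_rate\<close>. Both sides have
  the same sum, so \<open>v\<close> is invariant, and so are the differences to \<open>v\<close>. At the empty population one of
  the differences vanishes, hence it vanishes everywhere.
\<close>

lemma stationary_distribution_unique:
  assumes K: "finite K" and b: "\<And>k. k \<in> K \<Longrightarrow> 0 < b k"
    and d: "\<And>n k. n \<in> populations K \<Longrightarrow> k \<in> K \<Longrightarrow> 0 \<le> d n k \<and> d n k \<le> D k \<and> (d n k = 0 \<longleftrightarrow> n k = 0)"
    and p: "is_stationary_distribution (populations K) (birth_death_rate K b d) p"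
    and r: "is_stationary_distribution (populations K) (birth_death_rate K b d) r"
  shows "p = r"
proof -
  let ?S = "populations K" and ?in = "inflow K b d"
  have p': "set_pmf p \<subseteq> ?S" "\<And>j. j \<in> ?S \<Longrightarrow> ?in (pmf p) j = pmf p j * total_rate K b d j"
    and r': "set_pmf r \<subseteq> ?S" "\<And>j. j \<in> ?S \<Longrightarrow> ?in (pmf r) j = pmf r j * total_rate K b d j"
    using p r d by (auto simp: is_stationary_distribution_iff[OF K])
  define v where "v = (\<lambda>n. min (pmf p n) (pmf r n))"
  have v: "0 \<le> v n" "v n \<le> pmf p n" "v n \<le> pmf r n" for n by (auto simp: v_def)
  have sp: "pmf p summable_on ?S"
    using pmf_abs_summable[of p ?S] by (subst (asm) abs_summable_equivalent[symmetric]) (rule abs_summable_summable)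
  have sv: "v summable_on ?S"
    using v by (intro summable_on_comparison_test[OF sp]) auto
  obtain s where s: "(?in v has_sum s) ?S" "((\<lambda>n. v n * total_rate K b d n) has_sum s) ?S"
    using has_sum_inflow[OF K, of d D v] d v sv by blast
  have in_mono: "?in f j \<le> ?in h j" if "\<And>n. f n \<le> h n" "j \<in> ?S" for f h j
  proof -
    have "0 \<le> d (inc k j) k" if "k \<in> K" for k
      using d[OF inc_populations[OF \<open>j \<in> ?S\<close> that] that] by simp
    then show ?thesis
      unfolding inflow_def using that b
      by (intro add_mono sum_mono mult_left_mono) (auto intro: less_imp_le)
  qed
  have tot: "0 \<le> total_rate K b d j" if "j \<in> ?S" for j
    unfolding total_rate_def using b d that by (intro add_nonneg_nonneg sum_nonneg) (auto intro: less_imp_le)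
  have le: "?in v j \<le> v j * total_rate K b d j" if j: "j \<in> ?S" for j
    using in_mono[of v "pmf p", OF v(2) j] in_mono[of v "pmf r", OF v(3) j] p'(2)[OF j] r'(2)[OF j]
    by (auto simp: v_def min_def)
  have inv: "?in v j = v j * total_rate K b d j" if j: "j \<in> ?S" for j
  proof -
    have hs: "((\<lambda>n. v n * total_rate K b d n - ?in v n) has_sum 0) ?S"
      using has_sum_add[OF s(2) has_sum_cmult_right[OF s(1), of "-1"]] by simp
    have "v j * total_rate K b d j - ?in v j = 0"
      by (rule nonneg_has_sum_le_0D[OF hs _ _ j]) (use le in auto)
    then show ?thesis by simp
  qed
  have diff: "?in (\<lambda>n. f n - v n) j = (f j - v j) * total_rate K b d j"
    if "\<And>j. j \<in> ?S \<Longrightarrow> ?in f j = f j * total_rate K b d j" "j \<in> ?S" for f j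
  proof -
    have "?in (\<lambda>n. f n - v n) j = ?in f j - ?in v j"
    proof -
      have "(\<Sum>k\<in>K. b k * (if 0 < j k then f (dec k j) - v (dec k j) else 0)) =
         (\<Sum>k\<in>K. b k * (if 0 < j k then f (dec k j) else 0) - b k * (if 0 < j k then v (dec k j) else 0))"
        by (intro sum.cong) (auto simp: right_diff_distrib)
      then show ?thesis by (simp add: inflow_def right_diff_distrib sum_subtractf)
    qed
    then show ?thesis using inv that by (simp add: left_diff_distrib)
  qed
  have pos: "0 < d n k" if "n \<in> ?S" "k \<in> K" "0 < n k" for n k using d[of n k] that by auto
  have zero: "(\<lambda>_. 0) \<in> ?S" by (simp add: populations_def)
  have dominated: "f = h" if "\<And>n. n \<in> ?S \<Longrightarrow> pmf f n - v n = 0" "set_pmf f \<subseteq> ?S" "\<And>n. v n \<le> pmf h n" for f h :: "(nat \<Rightarrow> nat) pmf"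
  proof (rule pmf_eqI, rule antisym)
    have le: "pmf f n \<le> pmf h n" for n
    proof (cases "n \<in> ?S")
      case True
      then show ?thesis using that(1)[of n] that(3)[of n] by simp
    next
      case False
      then have "pmf f n = 0" using that(2) by (auto simp: set_pmf_eq)
      then show ?thesis by simp
    qed
    fix n
    show "pmf f n \<le> pmf h n" by (rule le)
    show "pmf h n \<le> pmf f n"
    proof -
      have "measure_pmf.prob f {n} + measure_pmf.prob f (-{n}) = 1" "measure_pmf.prob h {n} + measure_pmf.prob h (-{n}) = 1"
        using measure_pmf.prob_compl[of "{n}"] by (simp_all add: Compl_eq_Diff_UNIV)
      moreover have "measure_pmf.prob f (-{n}) \<le> measure_pmf.prob h (-{n})"
        unfolding measure_pmf_conv_infsetsum
        by (intro infsetsum_mono pmf_abs_summable le)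
      ultimately show ?thesis by (simp add: measure_pmf_single)
    qed
  qed
  have vanish: "pmf f n - v n = 0"
    if f: "\<And>j. j \<in> ?S \<Longrightarrow> ?in (pmf f) j = pmf f j * total_rate K b d j"
      and le: "\<And>n. v n \<le> pmf f n" and z: "pmf f (\<lambda>_. 0) = v (\<lambda>_. 0)" and n: "n \<in> ?S" for f n
  proof (rule invariant_zero_everywhere[where v="\<lambda>n. pmf f n - v n" and b=b and d=d and j="\<lambda>_. 0", OF K b pos _ _ zero _ n])
    show "0 \<le> pmf f m - v m" for m using le[of m] by simp
    show "?in (\<lambda>n. pmf f n - v n) m = (pmf f m - v m) * total_rate K b d m" if "m \<in> ?S" for m
      by (rule diff[OF f that])
    show "pmf f (\<lambda>_. 0) - v (\<lambda>_. 0) = 0" using z by simp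
  qed
  show ?thesis
  proof (cases "pmf p (\<lambda>_. 0) \<le> pmf r (\<lambda>_. 0)")
    case True
    then have "v (\<lambda>_. 0) = pmf p (\<lambda>_. 0)" by (simp add: v_def)
    then show ?thesis by (intro dominated vanish p'(1) p'(2) v) auto
  next
    case False
    then have "v (\<lambda>_. 0) = pmf r (\<lambda>_. 0)" by (simp add: v_def)
    then show ?thesis by (intro dominated[symmetric] vanish r'(1) r'(2) v) auto
  qed
qed

section \<open>Bandwidth shares along the line\<close>

text \<open>
  On a link with demands \<open>t\<close> and \<open>x\<close> the share of \<open>t\<close> is \<open>t / max 1 (t + x)\<close>. In this form there is no case
  distinction between saturated and unsaturated links, and no exception at \<open>0\<close>.
\<close>

lemma min_div_eq_capped_share:
  fixes t x :: real
  assumes "0 \<le> t" "0 \<le> x"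
  shows "min t (t / (t + x)) = t / max 1 (t + x)"
proof (cases "t + x \<le> 1")
  case True
  have "t \<le> t / (t + x)"
  proof (cases "t + x = 0")
    case False
    then show ?thesis
      using True assms by (simp add: pos_le_divide_eq mult_left_le)
  qed (use assms in simp)
  then have "min t (t / (t + x)) = t" by (rule min.absorb1)
  moreover have "max 1 (t + x) = 1" using True by (rule max.absorb1)
  ultimately show ?thesis by simp
next
  case False
  then have "t / (t + x) \<le> t / 1" using assms by (intro divide_left_mono) auto
  then have "min t (t / (t + x)) = t / (t + x)" by (intro min.absorb2) simp
  moreover have "max 1 (t + x) = t + x" using False by (intro max.absorb2) simp
  ultimately show ?thesis by simp
qed

lemma capped_share_bounds:
  fixes t x :: real
  assumes "0 \<le> t" "0 \<le> x"
  shows "0 \<le> x / max 1 (t + x)" "x / max 1 (t + x) \<le> 1"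
proof -
  have m: "0 < max 1 (t + x)" "x \<le> max 1 (t + x)" using assms by linarith+
  show "0 \<le> x / max 1 (t + x)" using m assms by (intro divide_nonneg_pos)
  show "x / max 1 (t + x) \<le> 1" using m by (simp only: divide_le_eq_1_pos)
qed

lemma capped_share_mono:
  fixes t t' x :: real
  assumes "0 \<le> t" "t \<le> t'" "0 \<le> x"
  shows "t / max 1 (t + x) \<le> t' / max 1 (t' + x)"
proof -
  have "t * max 1 (t' + x) \<le> t' * max 1 (t + x)"
  proof -
    have "t * x \<le> t' * x" "t * 1 \<le> t' * 1" using assms by (intro mult_right_mono; simp)+
    moreover have "t * max 1 (t' + x) = max t (t * t' + t * x)" "t' * max 1 (t + x) = max t' (t' * t + t' * x)"
      using assms by (simp_all add: max_mult_distrib_left distrib_left)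
    ultimately show ?thesis by (simp only: mult.commute[of t' t])
  qed
  moreover have "0 < max 1 (t + x)" "0 < max 1 (t' + x)" by linarith+
  ultimately show ?thesis by (simp add: pos_divide_le_eq pos_le_divide_eq del: less_max_iff_disj)
qed

lemma capped_share_lipschitz_le:
  fixes t t' x :: real
  assumes "0 \<le> t" "t \<le> t'" "0 \<le> x"
  shows "t' / max 1 (t' + x) - t / max 1 (t + x) \<le> t' - t"
    "\<bar>x / max 1 (t' + x) - x / max 1 (t + x)\<bar> \<le> t' - t"
proof -
  let ?m = "max 1 (t + x)" and ?m' = "max 1 (t' + x)"
  have m: "1 \<le> ?m" "?m \<le> ?m'" using assms by auto
  have "t / ?m' \<le> t / ?m" using assms m by (intro divide_left_mono) auto
  moreover have "(t' - t) / ?m' \<le> (t' - t) / 1" using assms m by (intro divide_left_mono) auto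
  ultimately show 1: "t' / ?m' - t / ?m \<le> t' - t" by (simp add: diff_divide_distrib)
  have e: "x / max 1 (s + x) = min 1 (s + x) - s / max 1 (s + x)" if "0 \<le> s" for s
    using that assms by (auto simp: max_def min_def field_simps)
  have "x / ?m' \<le> x / ?m" using assms m by (intro divide_left_mono) auto
  moreover have "x / ?m - x / ?m' \<le> t' - t"
  proof -
    have "min 1 (t + x) \<le> min 1 (t' + x)" using assms by auto
    then show ?thesis using 1 e[of t] e[of t'] assms by linarith
  qed
  ultimately show "\<bar>x / ?m' - x / ?m\<bar> \<le> t' - t" by linarith
qed

text \<open>
  Both shares are 1-Lipschitz in the incoming rate, whatever the demand \<open>x\<close>, which
  makes all service rates of the quasi-stationary process 1-Lipschitz in \<open>\<alpha>\<close>, uniformly over states.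
\<close>

lemma capped_share_lipschitz:
  fixes t t' x :: real
  assumes "0 \<le> t" "0 \<le> t'" "0 \<le> x"
  shows "\<bar>t' / max 1 (t' + x) - t / max 1 (t + x)\<bar> \<le> \<bar>t' - t\<bar>"
    "\<bar>x / max 1 (t' + x) - x / max 1 (t + x)\<bar> \<le> \<bar>t' - t\<bar>"
proof -
  have abs: "\<bar>A' - A\<bar> \<le> \<bar>u' - u\<bar> \<and> \<bar>B' - B\<bar> \<le> \<bar>u' - u\<bar>"
    if "A \<le> A'" "A' - A \<le> u' - u" "\<bar>B' - B\<bar> \<le> u' - u" for A A' B B' u u' :: real
    using that by linarith
  have "\<bar>t' / max 1 (t' + x) - t / max 1 (t + x)\<bar> \<le> \<bar>t' - t\<bar> \<and>
    \<bar>x / max 1 (t' + x) - x / max 1 (t + x)\<bar> \<le> \<bar>t' - t\<bar>"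
  proof (cases "t \<le> t'")
    case True
    show ?thesis
      by (rule abs[OF capped_share_mono[OF assms(1) True assms(3)] capped_share_lipschitz_le[OF assms(1) True assms(3)]])
  next
    case False
    then have le: "t' \<le> t" by simp
    show ?thesis
      using abs[OF capped_share_mono[OF assms(2) le assms(3)] capped_share_lipschitz_le[OF assms(2) le assms(3)]]
      by (simp only: abs_minus_commute)
  qed
  then show "\<bar>t' / max 1 (t' + x) - t / max 1 (t + x)\<bar> \<le> \<bar>t' - t\<bar>"
    "\<bar>x / max 1 (t' + x) - x / max 1 (t + x)\<bar> \<le> \<bar>t' - t\<bar>" by blast+
qed

lemma theta0_nonneg: "(\<And>k. 0 \<le> x k) \<Longrightarrow> 0 \<le> theta0 x k"
  by (induction k) (auto intro!: divide_nonneg_nonneg)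

lemma theta0_Suc: "(\<And>k. 0 \<le> x k) \<Longrightarrow> theta0 x (Suc k) = theta0 x k / max 1 (theta0 x k + x (Suc k))"
  by (simp add: min_div_eq_capped_share theta0_nonneg)

lemma theta0_le_1:
  assumes "\<And>k. 0 \<le> x k"
  shows "theta0 x (Suc k) \<le> 1"
  unfolding theta0_Suc[OF assms]
  using capped_share_bounds(2)[OF assms[of "Suc k"] theta0_nonneg[of x k, OF assms]] by (simp only: add.commute)

lemma theta0_qs_bounds:
  assumes "0 \<le> \<alpha>" "\<alpha> \<le> 1" "\<And>k. 0 \<le> x k"
  shows "0 \<le> theta0_qs \<alpha> x k \<and> theta0_qs \<alpha> x k \<le> 1"
  by (induction k) (use assms in \<open>auto intro!: divide_nonneg_nonneg simp: min_le_iff_disj\<close>)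

lemma theta0_qs_Suc:
  assumes "0 \<le> \<alpha>" "\<alpha> \<le> 1" "\<And>k. 0 \<le> x k" "0 < k"
  shows "theta0_qs \<alpha> x (Suc k) = theta0_qs \<alpha> x k / max 1 (theta0_qs \<alpha> x k + x (Suc k))"
  using assms by (simp add: min_div_eq_capped_share theta0_qs_bounds)

lemma theta0_qs_eq: "theta0_qs (theta0 x 1) x (Suc k) = theta0 x (Suc k)"
  by (induction k) auto

lemma theta0_qs_lipschitz:
  assumes "0 \<le> \<alpha>" "\<alpha> \<le> 1" "0 \<le> \<beta>" "\<beta> \<le> 1" "\<And>k. 0 \<le> x k"
  shows "\<bar>theta0_qs \<alpha> x k - theta0_qs \<beta> x k\<bar> \<le> \<bar>\<alpha> - \<beta>\<bar>"
proof (induction k)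
  case (Suc k)
  show ?case
  proof (cases "k = 0")
    case False
    then have "\<bar>theta0_qs \<alpha> x (Suc k) - theta0_qs \<beta> x (Suc k)\<bar> \<le> \<bar>theta0_qs \<alpha> x k - theta0_qs \<beta> x k\<bar>"
      using assms theta0_qs_bounds[of \<alpha> x k] theta0_qs_bounds[of \<beta> x k]
      by (subst (1 2) theta0_qs_Suc) (auto intro!: capped_share_lipschitz)
    with Suc show ?thesis by linarith
  qed simp
qed simp

lemma theta0_qs_antimono:
  assumes "0 \<le> \<alpha>" "\<alpha> \<le> 1" "\<And>k. 0 \<le> x k" "1 \<le> j" "j \<le> k"
  shows "theta0_qs \<alpha> x k \<le> theta0_qs \<alpha> x j"
  using assms(5)
proof (induction k rule: dec_induct)
  case (step k)
  have "theta0_qs \<alpha> x (Suc k) \<le> theta0_qs \<alpha> x k" using step assms(4) by simp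
  then show ?case using step by linarith
qed simp

text \<open>
  A class with many flows leaves little of its link to class \<open>0\<close>, whatever happens on the other links.
\<close>

lemma theta0_qs_le_inverse:
  assumes "0 \<le> \<alpha>" "\<alpha> \<le> 1" "\<And>k. 0 \<le> x k" "2 \<le> k" "k \<le> L"
  shows "theta0_qs \<alpha> x L \<le> 1 / (1 + x k)"
proof -
  obtain j where j: "k = Suc j" "0 < j"
    using assms(4) by (metis Suc_le_D Suc_1 Suc_le_mono le_numeral_extra(4) less_eq_Suc_le One_nat_def)
  let ?t = "theta0_qs \<alpha> x j"
  have t: "0 \<le> ?t" "?t \<le> 1" using theta0_qs_bounds[of \<alpha> x j] assms by auto
  have "theta0_qs \<alpha> x L \<le> theta0_qs \<alpha> x k" using assms by (intro theta0_qs_antimono) auto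
  also have "\<dots> = ?t / max 1 (?t + x k)" using assms j by (simp add: theta0_qs_Suc del: theta0_qs.simps)
  also have "\<dots> \<le> 1 / max 1 (1 + x k)" using t assms by (intro capped_share_mono) auto
  also have "\<dots> = 1 / (1 + x k)" using assms(3)[of k] by (simp add: max_def)
  finally show ?thesis .
qed

text \<open>
  The quasi-stationary rates are not an approximation: given the share on the first link, they are the
  rates of the network.
\<close>

lemma phi_eq_phi_qs:
  assumes "1 \<le> L" "k = 0 \<or> 2 \<le> k"
  shows "phi L a n k = phi_qs L a (theta0 (\<lambda>j. a j * real (n j)) 1) n k"
proof -
  let ?x = "\<lambda>j. a j * real (n j)"
  have "theta0_qs (theta0 ?x 1) ?x j = theta0 ?x j" if "1 \<le> j" for j
    using that theta0_qs_eq[of ?x "j - 1"] by simp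
  then show ?thesis using assms by (auto simp: phi_def phi_qs_def psi_def psi_qs_def)
qed

lemma phi_bounds:
  assumes "1 \<le> L" and a: "\<And>k. k \<le> L \<Longrightarrow> 0 < a k" and n: "n \<in> populations {0..L}" and k: "k \<le> L"
  shows "0 \<le> phi L a n k \<and> phi L a n k \<le> 1"
proof -
  let ?x = "\<lambda>j. a j * real (n j)"
  have x: "0 \<le> ?x j" for j using a[of j] n by (cases "j \<le> L") (auto simp: populations_def)
  have "theta0 ?x L \<le> 1" using theta0_le_1[of ?x "L - 1", OF x] assms(1) by (simp del: theta0.simps)
  have "0 \<le> theta0 ?x j" for j by (rule theta0_nonneg[OF x])
  show ?thesis
  proof (cases "k = 0")
    case True
    with \<open>theta0 ?x L \<le> 1\<close> \<open>\<And>j. 0 \<le> theta0 ?x j\<close> show ?thesis by (simp add: phi_def psi_def)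
  next
    case False
    have "phi L a n k = ?x k / max 1 (theta0 ?x (k - 1) + ?x k)"
      using False min_div_eq_capped_share[OF x[of k] theta0_nonneg[of ?x "k - 1", OF x]] by (simp add: phi_def psi_def add.commute)
    then show ?thesis using capped_share_bounds[OF theta0_nonneg[of ?x "k - 1", OF x] x[of k]] by simp
  qed
qed

lemma theta0_zero: "x 0 = 0 \<Longrightarrow> theta0 x k = 0"
  by (induction k) auto

lemma phi_eq_0: "n k = 0 \<Longrightarrow> phi L a n k = 0"
  by (cases "k = 0") (auto simp: phi_def psi_def theta0_zero)

lemma psi_qs_service_eq:
  assumes "0 \<le> \<alpha>" "\<alpha> \<le> 1" "\<And>k. 0 \<le> x k" "k \<noteq> 0"
  shows "psi_qs L \<alpha> x k = x k / max 1 (theta0_qs \<alpha> x (k - 1) + x k)"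
  using assms min_div_eq_capped_share[of "x k" "theta0_qs \<alpha> x (k-1)"] theta0_qs_bounds[of \<alpha> x "k-1"]
  by (simp add: psi_qs_def add.commute)

lemma access_nonneg:
  assumes "\<And>k. k \<in> {2..L} \<Longrightarrow> 0 < a k" "n \<in> populations {2..L}"
  shows "0 \<le> a j * real (n j)"
  using assms by (cases "j \<in> {2..L}") (auto simp: populations_def less_imp_le)

lemma phi_qs_bounds:
  assumes a: "\<And>k. k \<in> {2..L} \<Longrightarrow> 0 < a k" and n: "n \<in> populations {2..L}" and \<alpha>: "0 \<le> \<alpha>" "\<alpha> \<le> 1"
  shows "0 \<le> phi_qs L a \<alpha> n k \<and> phi_qs L a \<alpha> n k \<le> 1"
proof -
  let ?x = "\<lambda>j. a j * real (n j)"
  have x: "0 \<le> ?x j" for j using a n by (rule access_nonneg)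
  show ?thesis
  proof (cases "k = 0")
    case True
    then show ?thesis using theta0_qs_bounds[OF \<alpha>, of ?x L, OF x] by (simp add: phi_qs_def psi_qs_def)
  next
    case False
    show ?thesis
      unfolding phi_qs_def psi_qs_service_eq[OF \<alpha> x False]
      using theta0_qs_bounds[OF \<alpha>, of ?x "k - 1", OF x] by (intro conjI capped_share_bounds x) auto
  qed
qed

lemma phi_qs_eq_0_iff:
  assumes a: "\<And>k. k \<in> {2..L} \<Longrightarrow> 0 < a k" and n: "n \<in> populations {2..L}" and \<alpha>: "0 \<le> \<alpha>" "\<alpha> \<le> 1" and k: "k \<in> {2..L}"
  shows "phi_qs L a \<alpha> n k = 0 \<longleftrightarrow> n k = 0"
proof -
  let ?x = "\<lambda>j. a j * real (n j)"
  have x: "0 \<le> ?x j" for j using a n by (rule access_nonneg)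
  have "phi_qs L a \<alpha> n k = ?x k / max 1 (theta0_qs \<alpha> ?x (k - 1) + ?x k)"
    unfolding phi_qs_def using k by (intro psi_qs_service_eq[OF \<alpha> x]) auto
  then show ?thesis using a[OF k] by auto
qed

lemma phi_qs_lipschitz:
  assumes a: "\<And>k. k \<in> {2..L} \<Longrightarrow> 0 < a k" and n: "n \<in> populations {2..L}"
    and \<alpha>: "0 \<le> \<alpha>" "\<alpha> \<le> 1" and \<beta>: "0 \<le> \<beta>" "\<beta> \<le> 1"
  shows "\<bar>phi_qs L a \<alpha> n k - phi_qs L a \<beta> n k\<bar> \<le> \<bar>\<alpha> - \<beta>\<bar>"
proof -
  let ?x = "\<lambda>j. a j * real (n j)"
  have x: "0 \<le> ?x j" for j using a n by (rule access_nonneg)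
  show ?thesis
  proof (cases "k = 0")
    case True
    then show ?thesis using theta0_qs_lipschitz[OF \<alpha> \<beta>, of ?x L, OF x] by (simp add: phi_qs_def psi_qs_def)
  next
    case False
    have "\<bar>phi_qs L a \<alpha> n k - phi_qs L a \<beta> n k\<bar> \<le> \<bar>theta0_qs \<alpha> ?x (k - 1) - theta0_qs \<beta> ?x (k - 1)\<bar>"
      unfolding phi_qs_def psi_qs_service_eq[OF \<alpha> x False] psi_qs_service_eq[OF \<beta> x False]
      using theta0_qs_bounds[OF \<alpha>, of ?x, OF x] theta0_qs_bounds[OF \<beta>, of ?x, OF x] x
      by (intro capped_share_lipschitz) auto
    also have "\<dots> \<le> \<bar>\<alpha> - \<beta>\<bar>" by (rule theta0_qs_lipschitz[OF \<alpha> \<beta> x])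
    finally show ?thesis .
  qed
qed

text \<open>
  This is what makes escaping mass harmless: outside a finite set of populations, chosen
  independently of \<open>\<alpha>\<close>, class \<open>0\<close> receives almost nothing.
\<close>

lemma phi_qs_vanishes_at_infinity:
  assumes a: "\<And>k. k \<in> {2..L} \<Longrightarrow> 0 < a k" and "0 < \<epsilon>"
  shows "\<exists>F. finite F \<and> F \<subseteq> populations {2..L} \<and>
    (\<forall>\<alpha> n. 0 \<le> \<alpha> \<longrightarrow> \<alpha> \<le> 1 \<longrightarrow> n \<in> populations {2..L} - F \<longrightarrow> phi_qs L a \<alpha> n 0 \<le> \<epsilon>)"
proof -
  define b where "b = (\<lambda>k. nat \<lceil>1 / (\<epsilon> * a k)\<rceil>)"
  define F where "F = {n \<in> populations {2..L}. \<forall>k\<in>{2..L}. n k \<le> b k}"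
  have "F \<subseteq> {n. \<forall>k. (k \<in> {2..L} \<longrightarrow> n k \<in> {..Max (b ` {2..L})}) \<and> (k \<notin> {2..L} \<longrightarrow> n k = 0)}"
    by (auto simp: F_def populations_def) (meson Max_ge atLeastAtMost_iff finite_atLeastAtMost finite_imageI image_eqI le_trans)
  then have "finite F"
    by (rule finite_subset) (intro finite_set_of_finite_funs, auto)
  moreover have "phi_qs L a \<alpha> n 0 \<le> \<epsilon>" if \<alpha>: "0 \<le> \<alpha>" "\<alpha> \<le> 1" and n: "n \<in> populations {2..L} - F" for \<alpha> n
  proof -
    let ?x = "\<lambda>j. a j * real (n j)"
    obtain k where k: "k \<in> {2..L}" "b k < n k" using n by (auto simp: F_def not_le)
    have "0 < a k" using a k by auto
    have "phi_qs L a \<alpha> n 0 \<le> 1 / (1 + ?x k)"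
      using k \<alpha> access_nonneg[where a=a and n=n and L=L] a n unfolding phi_qs_def psi_qs_def
      by (simp, intro theta0_qs_le_inverse) auto
    also have "\<dots> \<le> \<epsilon>"
    proof -
      have "1 / (\<epsilon> * a k) \<le> real (n k)" using k(2) unfolding b_def by linarith
      then have "1 \<le> \<epsilon> * ?x k" using \<open>0 < \<epsilon>\<close> \<open>0 < a k\<close> by (simp add: field_simps)
      then have "1 \<le> \<epsilon> * (1 + ?x k)" using \<open>0 < \<epsilon>\<close> by (simp add: distrib_left)
      moreover have "0 < 1 + ?x k" using \<open>0 < a k\<close> by (simp add: add_pos_nonneg)
      ultimately show ?thesis by (simp add: pos_divide_le_eq)
    qed
    finally show ?thesis .
  qed
  moreover have "F \<subseteq> populations {2..L}" by (auto simp: F_def)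
  ultimately show ?thesis by blast
qed

section \<open>Resolvents\<close>

text \<open>
  The transition operator of the process uniformised at rate \<open>C\<close>, acting on functions.
\<close>

definition step ::
  "nat set \<Rightarrow> (nat \<Rightarrow> real) \<Rightarrow> ((nat \<Rightarrow> nat) \<Rightarrow> nat \<Rightarrow> real) \<Rightarrow> real \<Rightarrow> ((nat \<Rightarrow> nat) \<Rightarrow> real) \<Rightarrow> (nat \<Rightarrow> nat) \<Rightarrow> real" where
  "step K b d C f n = f n + gen K b d f n / C"

text \<open>
  The mean of \<open>f\<close> at an independent geometric time, the chain being started in \<open>n\<close>.
\<close>

definition resolvent ::
  "nat set \<Rightarrow> (nat \<Rightarrow> real) \<Rightarrow> ((nat \<Rightarrow> nat) \<Rightarrow> nat \<Rightarrow> real) \<Rightarrow> real \<Rightarrow> real \<Rightarrow>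
    ((nat \<Rightarrow> nat) \<Rightarrow> real) \<Rightarrow> (nat \<Rightarrow> nat) \<Rightarrow> real" where
  "resolvent K b d C \<gamma> f n = (1 - \<gamma>) * (\<Sum>t. \<gamma> ^ t * (step K b d C ^^ t) f n)"

lemma gen_linear:
  "gen K b d (\<lambda>n. c * f n + g n) n = c * gen K b d f n + gen K b d g n"
  by (simp add: gen_def algebra_simps sum.distrib sum_subtractf sum_distrib_left)

lemma gen_const: "gen K b d (\<lambda>_. c) n = 0"
  by (simp add: gen_def)

lemma gen_sums:
  assumes "finite K" "\<And>m. m = n \<or> (\<exists>k\<in>K. m = inc k n \<or> m = dec k n) \<Longrightarrow> (\<lambda>t. F t m) sums f m"
  shows "(\<lambda>t. gen K b d (F t) n) sums gen K b d f n"
  unfolding gen_def using assms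
  by (intro sums_add sums_sum sums_mult sums_diff) auto

lemma gen_alt:
  "gen K b d f n = (\<Sum>k\<in>K. b k * f (inc k n)) + (\<Sum>k\<in>K. d n k * f (dec k n)) - total_rate K b d n * f n"
  by (simp add: gen_def total_rate_def right_diff_distrib sum_subtractf sum_distrib_right distrib_right)

locale bounded_rates =
  fixes K :: "nat set" and b :: "nat \<Rightarrow> real" and d :: "(nat \<Rightarrow> nat) \<Rightarrow> nat \<Rightarrow> real" and C :: real
  assumes finite_K: "finite K"
    and birth_nonneg: "\<And>k. k \<in> K \<Longrightarrow> 0 \<le> b k"
    and death_nonneg: "\<And>n k. n \<in> populations K \<Longrightarrow> k \<in> K \<Longrightarrow> 0 \<le> d n k"
    and total_le: "\<And>n. n \<in> populations K \<Longrightarrow> total_rate K b d n \<le> C"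
    and C_pos: "0 < C"
begin

abbreviation S where "S \<equiv> populations K"
abbreviation G where "G \<equiv> gen K b d"
abbreviation P where "P \<equiv> step K b d C"
abbreviation R where "R \<equiv> resolvent K b d C"

lemma P_linear: "P (\<lambda>n. c * f n + g n) = (\<lambda>n. c * P f n + P g n)"
  by (rule ext) (simp only: step_def gen_linear add_divide_distrib distrib_left times_divide_eq_right add.assoc add.left_commute)

lemma P_const: "P (\<lambda>_. c) = (\<lambda>_. c)"
  by (rule ext) (simp add: step_def gen_const)

lemma P_mono:
  assumes le: "\<And>m. m \<in> S \<Longrightarrow> f m \<le> g m" and n: "n \<in> S"
  shows "P f n \<le> P g n"
proof -
  have "P f n = (1 - total_rate K b d n / C) * f n +
      ((\<Sum>k\<in>K. b k * f (inc k n)) + (\<Sum>k\<in>K. d n k * f (dec k n))) / C" for f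
    using C_pos by (simp add: step_def gen_alt field_simps)
  moreover have "(1 - total_rate K b d n / C) * f n \<le> (1 - total_rate K b d n / C) * g n"
    using total_le[OF n] C_pos by (intro mult_left_mono le n) simp
  moreover have "(\<Sum>k\<in>K. b k * f (inc k n)) \<le> (\<Sum>k\<in>K. b k * g (inc k n))"
    by (intro sum_mono mult_left_mono le inc_populations n birth_nonneg)
  moreover have "(\<Sum>k\<in>K. d n k * f (dec k n)) \<le> (\<Sum>k\<in>K. d n k * g (dec k n))"
    by (intro sum_mono mult_left_mono le dec_populations n death_nonneg)
  ultimately show ?thesis
    using C_pos by (simp only:) (intro add_mono divide_right_mono, simp_all)
qed

lemma Pt_linear: "(P ^^ t) (\<lambda>n. c * f n + g n) = (\<lambda>n. c * (P ^^ t) f n + (P ^^ t) g n)"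
  by (induction t) (auto simp: P_linear)

lemma Pt_const: "(P ^^ t) (\<lambda>_. c) = (\<lambda>_. c)"
  by (induction t) (auto simp: P_const)

lemma Pt_mono:
  assumes "\<And>m. m \<in> S \<Longrightarrow> f m \<le> g m" "n \<in> S"
  shows "(P ^^ t) f n \<le> (P ^^ t) g n"
  using assms(2) by (induction t arbitrary: n) (auto intro: assms(1) P_mono)

lemma Pt_bound:
  assumes "\<And>m. m \<in> S \<Longrightarrow> \<bar>f m\<bar> \<le> B" "n \<in> S"
  shows "\<bar>(P ^^ t) f n\<bar> \<le> B"
proof -
  have "(P ^^ t) f n \<le> (P ^^ t) (\<lambda>_. B) n" "(P ^^ t) (\<lambda>_. - B) n \<le> (P ^^ t) f n"
    using assms(1) by (intro Pt_mono assms(2); force simp: abs_le_iff)+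
  then show ?thesis by (simp add: Pt_const)
qed

definition bdd :: "((nat \<Rightarrow> nat) \<Rightarrow> real) \<Rightarrow> bool" where
  "bdd f \<longleftrightarrow> (\<exists>B. \<forall>m\<in>S. \<bar>f m\<bar> \<le> B)"

lemma bddI: "(\<And>m. m \<in> S \<Longrightarrow> \<bar>f m\<bar> \<le> B) \<Longrightarrow> bdd f"
  by (auto simp: bdd_def)

lemma bdd_const: "bdd (\<lambda>_. c)"
  by (rule bddI[of _ "\<bar>c\<bar>"]) simp

lemma bdd_linear:
  assumes "bdd f" "bdd g"
  shows "bdd (\<lambda>n. c * f n + g n)"
proof -
  obtain A B where "\<forall>m\<in>S. \<bar>f m\<bar> \<le> A" "\<forall>m\<in>S. \<bar>g m\<bar> \<le> B" using assms by (auto simp: bdd_def)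
  then show ?thesis
    by (intro bddI[of _ "\<bar>c\<bar> * A + B"] order_trans[OF abs_triangle_ineq] add_mono)
      (simp_all add: abs_mult mult_left_mono)
qed

lemma bdd_P: "bdd f \<Longrightarrow> bdd (P f)"
  using Pt_bound[of f _ _ 1] unfolding bdd_def funpow.simps(2) One_nat_def funpow_0 o_apply by blast

lemma G_eq: "G f n = C * P f n + (- C * f n)"
  using C_pos by (simp add: step_def field_simps)

lemma bdd_G:
  assumes "bdd f"
  shows "bdd (G f)"
proof -
  have "bdd (\<lambda>n. (- C) * f n + 0)" by (rule bdd_linear[OF assms bdd_const])
  then have "bdd (\<lambda>n. C * P f n + ((- C) * f n + 0))" by (rule bdd_linear[OF bdd_P[OF assms]])
  moreover have "G f = (\<lambda>n. C * P f n + ((- C) * f n + 0))" by (rule ext) (simp add: G_eq)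
  ultimately show ?thesis by simp
qed

lemma bdd_sum: "finite F \<Longrightarrow> (\<And>j. j \<in> F \<Longrightarrow> bdd (f j)) \<Longrightarrow> bdd (\<lambda>n. \<Sum>j\<in>F. c j * f j n)"
proof (induction F rule: finite_induct)
  case empty
  show ?case using bdd_const[of 0] by simp
next
  case (insert i F)
  have "bdd (\<lambda>n. c i * f i n + (\<Sum>j\<in>F. c j * f j n))" using insert by (intro bdd_linear) auto
  then show ?case using insert by simp
qed

context
  fixes \<gamma> :: real
  assumes \<gamma>: "0 < \<gamma>" "\<gamma> < 1"
begin

lemma summable_R: "bdd f \<Longrightarrow> n \<in> S \<Longrightarrow> summable (\<lambda>t. \<gamma> ^ t * (P ^^ t) f n)"
proof -
  assume "bdd f" "n \<in> S"
  then obtain B where "\<forall>m\<in>S. \<bar>f m\<bar> \<le> B" by (auto simp: bdd_def)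
  then have "\<bar>(P ^^ t) f n\<bar> \<le> B" for t using \<open>n \<in> S\<close> by (intro Pt_bound) auto
  then have bound: "norm (\<gamma> ^ t * (P ^^ t) f n) \<le> \<gamma> ^ t * B" for t
    using \<gamma> by (simp add: abs_mult)
  have "summable (\<lambda>t. \<gamma> ^ t * B)"
    by (rule summable_mult2, rule summable_geometric) (use \<gamma> in simp)
  then show ?thesis by (rule summable_comparison_test'[where N=0]) (rule bound)
qed

lemma R_linear:
  assumes "bdd f" "bdd g" "n \<in> S"
  shows "R \<gamma> (\<lambda>n. c * f n + g n) n = c * R \<gamma> f n + R \<gamma> g n"
proof -
  have "(\<lambda>t. c * (\<gamma> ^ t * (P ^^ t) f n) + \<gamma> ^ t * (P ^^ t) g n) sums
     (c * (\<Sum>t. \<gamma> ^ t * (P ^^ t) f n) + (\<Sum>t. \<gamma> ^ t * (P ^^ t) g n))"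
    using assms by (intro sums_add sums_mult summable_sums summable_R)
  then have "(\<Sum>t. c * (\<gamma> ^ t * (P ^^ t) f n) + \<gamma> ^ t * (P ^^ t) g n) =
     c * (\<Sum>t. \<gamma> ^ t * (P ^^ t) f n) + (\<Sum>t. \<gamma> ^ t * (P ^^ t) g n)"
    by (rule sums_unique[symmetric])
  moreover have "\<gamma> ^ t * (P ^^ t) (\<lambda>n. c * f n + g n) n = c * (\<gamma> ^ t * (P ^^ t) f n) + \<gamma> ^ t * (P ^^ t) g n" for t
    by (simp only: Pt_linear distrib_left mult.left_commute)
  ultimately show ?thesis
    by (simp only: resolvent_def distrib_left mult.left_commute)
qed

lemma R_const: "R \<gamma> (\<lambda>_. c) n = c"
proof -
  have "(\<lambda>t. \<gamma> ^ t * c) sums (1 / (1 - \<gamma>) * c)"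
    by (rule sums_mult2, rule geometric_sums) (use \<gamma> in simp)
  from sums_unique[OF this, symmetric] show ?thesis
    using \<gamma> by (simp add: resolvent_def Pt_const)
qed

lemma R_sum:
  assumes "finite F" "\<And>j. j \<in> F \<Longrightarrow> bdd (f j)" "n \<in> S"
  shows "R \<gamma> (\<lambda>n. \<Sum>j\<in>F. c j * f j n) n = (\<Sum>j\<in>F. c j * R \<gamma> (f j) n)"
  using assms(1,2)
proof (induction F rule: finite_induct)
  case empty
  show ?case using R_const[of 0 n] by simp
next
  case (insert i F)
  have "R \<gamma> (\<lambda>n. c i * f i n + (\<Sum>j\<in>F. c j * f j n)) n = c i * R \<gamma> (f i) n + R \<gamma> (\<lambda>n. \<Sum>j\<in>F. c j * f j n) n"
    using insert by (intro R_linear assms(3) bdd_sum) auto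
  then show ?case using insert by simp
qed

lemma R_mono:
  assumes "bdd f" "bdd g" "\<And>m. m \<in> S \<Longrightarrow> f m \<le> g m" "n \<in> S"
  shows "R \<gamma> f n \<le> R \<gamma> g n"
  unfolding resolvent_def using assms \<gamma>
  by (intro mult_left_mono[OF suminf_le[OF mult_left_mono[OF Pt_mono]]] summable_R) auto

lemma R_bounds:
  assumes "\<And>m. m \<in> S \<Longrightarrow> A \<le> f m \<and> f m \<le> B" "n \<in> S"
  shows "A \<le> R \<gamma> f n" "R \<gamma> f n \<le> B"
proof -
  have "bdd f" using assms(1) by (intro bddI[of _ "max \<bar>A\<bar> \<bar>B\<bar>"]) force
  then show "A \<le> R \<gamma> f n" "R \<gamma> f n \<le> B"
    using R_mono[of "\<lambda>_. A" f n] R_mono[of f "\<lambda>_. B" n] assms bdd_const by (auto simp: R_const)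
qed

lemma bdd_R: "bdd f \<Longrightarrow> bdd (R \<gamma> f)"
proof -
  assume "bdd f"
  then obtain B where "\<forall>m\<in>S. \<bar>f m\<bar> \<le> B" by (auto simp: bdd_def)
  then have "- B \<le> f m \<and> f m \<le> B" if "m \<in> S" for m using that by (force simp: abs_le_iff)
  from R_bounds[OF this] show ?thesis by (intro bddI[of _ B] abs_leI) force+
qed

lemma R_unfold:
  assumes "bdd f" "n \<in> S"
  shows "R \<gamma> f n = (1 - \<gamma>) * f n + \<gamma> * R \<gamma> (P f) n"
proof -
  have "(\<Sum>t. \<gamma> ^ t * (P ^^ t) f n) = f n + (\<Sum>t. \<gamma> ^ Suc t * (P ^^ Suc t) f n)"
    using suminf_split_head[OF summable_R[OF assms]] by simp
  also have "(\<Sum>t. \<gamma> ^ Suc t * (P ^^ Suc t) f n) = (\<Sum>t. \<gamma> * (\<gamma> ^ t * (P ^^ t) (P f) n))"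
    by (simp only: funpow.simps o_apply funpow_swap1 power_Suc mult.assoc)
  also have "\<dots> = \<gamma> * (\<Sum>t. \<gamma> ^ t * (P ^^ t) (P f) n)"
    using summable_R[OF bdd_P[OF assms(1)] assms(2)] by (rule suminf_mult)
  finally show ?thesis by (simp add: resolvent_def algebra_simps)
qed

lemma R_G:
  assumes "bdd f" "n \<in> S"
  shows "R \<gamma> (G f) n = C * (1 - \<gamma>) / \<gamma> * (R \<gamma> f n - f n)"
proof -
  have "R \<gamma> (P f) n = R \<gamma> (\<lambda>n. (1 / C) * G f n + f n) n" by (simp add: step_def[abs_def] add.commute)
  also have "\<dots> = R \<gamma> (G f) n / C + R \<gamma> f n"
    using assms by (subst R_linear) (auto intro: bdd_G)
  finally have "R \<gamma> f n = (1 - \<gamma>) * f n + \<gamma> * (R \<gamma> (G f) n / C + R \<gamma> f n)"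
    using R_unfold[OF assms] by simp
  then show ?thesis using \<gamma> C_pos by (simp add: field_simps)
qed

text \<open>
  The resolvent and the generator commute, so by \<open>R_G\<close> the function \<open>R f\<close> scaled by \<open>\<gamma> / (C * (1 - \<gamma>))\<close> has generator
  \<open>R f - f\<close>: it solves the Poisson equation for \<open>f\<close> up to the error \<open>R f\<close>.
\<close>

lemma G_R:
  assumes "bdd f" "n \<in> S"
  shows "G (R \<gamma> f) n = R \<gamma> (G f) n"
proof -
  have sums: "(\<lambda>t. (1 - \<gamma>) * (\<gamma> ^ t * (P ^^ t) f m)) sums R \<gamma> f m" if "m \<in> S" for m
    unfolding resolvent_def using that assms by (intro sums_mult summable_sums summable_R)
  have "(\<lambda>t. G (\<lambda>m. (1 - \<gamma>) * (\<gamma> ^ t * (P ^^ t) f m)) n) sums G (R \<gamma> f) n"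
    using assms(2) by (intro gen_sums finite_K sums) (auto intro: inc_populations dec_populations)
  moreover have "G (\<lambda>m. (1 - \<gamma>) * (\<gamma> ^ t * (P ^^ t) f m)) n = (1 - \<gamma>) * (\<gamma> ^ t * (P ^^ t) (G f) n)" for t
  proof -
    have "G (\<lambda>m. ((1 - \<gamma>) * \<gamma> ^ t) * (P ^^ t) f m + 0) n = ((1 - \<gamma>) * \<gamma> ^ t) * G ((P ^^ t) f) n"
      by (subst gen_linear) (simp add: gen_const)
    moreover have "G ((P ^^ t) f) n = (P ^^ t) (G f) n"
    proof -
      have "G f = (\<lambda>n. C * P f n + (\<lambda>n. (- C) * f n + 0) n)" for f by (auto simp: G_eq)
      then have "(P ^^ t) (G f) n = C * (P ^^ t) (P f) n + (- C) * (P ^^ t) f n"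
        by (simp only: Pt_linear Pt_const)
      then show ?thesis by (simp add: G_eq funpow_swap1)
    qed
    ultimately show ?thesis by (simp add: mult.assoc)
  qed
  ultimately have "(\<lambda>t. (1 - \<gamma>) * (\<gamma> ^ t * (P ^^ t) (G f) n)) sums G (R \<gamma> f) n" by simp
  moreover have "(\<lambda>t. (1 - \<gamma>) * (\<gamma> ^ t * (P ^^ t) (G f) n)) sums R \<gamma> (G f) n"
    unfolding resolvent_def using assms by (intro sums_mult summable_sums summable_R bdd_G)
  ultimately show ?thesis by (rule sums_unique2)
qed

lemma fixpoint_bound:
  assumes w: "bdd w" and E: "\<And>n. n \<in> S \<Longrightarrow> \<bar>w n - \<gamma> * P w n\<bar> \<le> E" and n: "n \<in> S"
  shows "\<bar>w n\<bar> \<le> E / (1 - \<gamma>)"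
proof -
  obtain B where B: "\<And>m. m \<in> S \<Longrightarrow> \<bar>w m\<bar> \<le> B" using w by (auto simp: bdd_def)
  have E0: "0 \<le> E" using E[OF n] by linarith
  have iter: "\<forall>m\<in>S. \<bar>w m\<bar> \<le> E / (1 - \<gamma>) + \<gamma> ^ t * B" for t
  proof (induction t)
    case 0
    then show ?case using B E0 \<gamma> by (auto intro!: add_increasing)
  next
    case (Suc t)
    show ?case
    proof
      fix m assume m: "m \<in> S"
      have "\<bar>P w m\<bar> \<le> E / (1 - \<gamma>) + \<gamma> ^ t * B" using Pt_bound[of w _ m 1] Suc m by simp
      then have "\<gamma> * \<bar>P w m\<bar> \<le> \<gamma> * (E / (1 - \<gamma>) + \<gamma> ^ t * B)" using \<gamma> by (intro mult_left_mono) auto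
      moreover have "\<bar>w m\<bar> \<le> E + \<gamma> * \<bar>P w m\<bar>"
        using E[OF m] \<gamma> abs_triangle_ineq[of "w m - \<gamma> * P w m" "\<gamma> * P w m"] by (simp add: abs_mult)
      ultimately have "\<bar>w m\<bar> \<le> E + \<gamma> * (E / (1 - \<gamma>) + \<gamma> ^ t * B)" by linarith
      also have "\<dots> = E / (1 - \<gamma>) + \<gamma> ^ Suc t * B" using \<gamma> by (simp add: field_simps)
      finally show "\<bar>w m\<bar> \<le> E / (1 - \<gamma>) + \<gamma> ^ Suc t * B" .
    qed
  qed
  have "(\<lambda>t. E / (1 - \<gamma>) + \<gamma> ^ t * B) \<longlonglongrightarrow> E / (1 - \<gamma>) + 0 * B"
    using \<gamma> by (intro tendsto_intros LIMSEQ_realpow_zero) auto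
  then show ?thesis
    using iter n by (intro LIMSEQ_le_const[of _ "E / (1 - \<gamma>)"]) auto
qed

end

end

text \<open>
  The difference \<open>w\<close> of the two resolvents satisfies \<open>w = \<gamma> P w + error\<close>, where the error is of the order
  of the perturbation of \<open>f\<close> and of the death rates, and \<open>\<gamma> P\<close> is a contraction.
\<close>

lemma resolvent_lipschitz:
  assumes r: "bounded_rates K b d C" and r': "bounded_rates K b d' C" and \<gamma>: "0 < \<gamma>" "\<gamma> < 1"
    and f: "\<And>n. n \<in> populations K \<Longrightarrow> 0 \<le> f n \<and> f n \<le> 1"
    and f': "\<And>n. n \<in> populations K \<Longrightarrow> 0 \<le> f' n \<and> f' n \<le> 1"
    and ff': "\<And>n. n \<in> populations K \<Longrightarrow> \<bar>f n - f' n\<bar> \<le> \<delta>"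
    and dd': "\<And>n k. n \<in> populations K \<Longrightarrow> k \<in> K \<Longrightarrow> \<bar>d n k - d' n k\<bar> \<le> D k * \<delta>"
    and n: "n \<in> populations K"
  shows "\<bar>resolvent K b d C \<gamma> f n - resolvent K b d' C \<gamma> f' n\<bar> \<le> (1 + (\<Sum>k\<in>K. D k) / C) / (1 - \<gamma>) * \<delta>"
proof -
  interpret A: bounded_rates K b d C by fact
  interpret B: bounded_rates K b d' C by fact
  define u where "u = A.R \<gamma> f"
  define u' where "u' = B.R \<gamma> f'"
  have bf: "A.bdd f" "B.bdd f'" using f f' by (auto intro!: A.bddI[of _ 1] B.bddI[of _ 1])
  have u': "0 \<le> u' m \<and> u' m \<le> 1" if "m \<in> A.S" for m
    using B.R_bounds[OF \<gamma>, of 0 f' 1 m] f' that by (auto simp: u'_def)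
  have bu: "A.bdd u" "A.bdd u'"
    using A.bdd_R[OF \<gamma> bf(1)] B.bdd_R[OF \<gamma> bf(2)] by (auto simp: u_def u'_def A.bdd_def B.bdd_def)
  define w where "w = (\<lambda>n. (-1) * u' n + u n)"
  have "\<bar>w m - \<gamma> * A.P w m\<bar> \<le> (1 + (\<Sum>k\<in>K. D k) / C) * \<delta>" if m: "m \<in> A.S" for m
  proof -
    have e: "w m - \<gamma> * A.P w m = (1 - \<gamma>) * (f m - f' m) + \<gamma> * ((A.G u' m - B.G u' m) / C)"
    proof -
      have alg: "(x - x') - \<gamma> * (p - r) = (1 - \<gamma>) * (y - y') + \<gamma> * (r - p')"
        if "x = (1 - \<gamma>) * y + \<gamma> * p" "x' = (1 - \<gamma>) * y' + \<gamma> * p'" for x x' y y' p p' r :: real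
        using that by (simp add: algebra_simps)
      have 1: "u m = (1 - \<gamma>) * f m + \<gamma> * A.P u m"
        using A.R_unfold[OF \<gamma> bf(1) m] A.G_R[OF \<gamma> bf(1) m] A.R_G[OF \<gamma> bf(1) m] \<gamma> A.C_pos
        by (simp add: u_def step_def[of _ _ _ _ "A.R \<gamma> f"] field_simps)
      have 2: "u' m = (1 - \<gamma>) * f' m + \<gamma> * B.P u' m"
        using B.R_unfold[OF \<gamma> bf(2) m] B.G_R[OF \<gamma> bf(2) m] B.R_G[OF \<gamma> bf(2) m] \<gamma> A.C_pos
        by (simp add: u'_def step_def[of _ _ _ _ "B.R \<gamma> f'"] field_simps)
      have "A.P w m = A.P u m - A.P u' m" unfolding w_def A.P_linear by simp
      then have "w m - \<gamma> * A.P w m = (u m - u' m) - \<gamma> * (A.P u m - A.P u' m)" by (simp add: w_def)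
      also have "\<dots> = (1 - \<gamma>) * (f m - f' m) + \<gamma> * (A.P u' m - B.P u' m)"
        by (rule alg[OF 1 2])
      also have "A.P u' m - B.P u' m = (A.G u' m - B.G u' m) / C" by (simp add: step_def diff_divide_distrib)
      finally show ?thesis .
    qed
    have "A.G u' m - B.G u' m = (\<Sum>k\<in>K. (d m k - d' m k) * (u' (dec k m) - u' m))"
      by (simp add: gen_def sum_subtractf[symmetric] left_diff_distrib)
    also have "\<bar>\<dots>\<bar> \<le> (\<Sum>k\<in>K. D k * \<delta>)"
    proof (rule order_trans[OF sum_abs], rule sum_mono)
      fix k assume k: "k \<in> K"
      have "\<bar>u' (dec k m) - u' m\<bar> \<le> 1" using u'[OF m] u'[OF dec_populations[OF m, of k]] by linarith
      then have "\<bar>d m k - d' m k\<bar> * \<bar>u' (dec k m) - u' m\<bar> \<le> \<bar>d m k - d' m k\<bar> * 1"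
        by (intro mult_left_mono) auto
      then show "\<bar>(d m k - d' m k) * (u' (dec k m) - u' m)\<bar> \<le> D k * \<delta>"
        using dd'[OF m k] by (simp add: abs_mult)
    qed
    finally have G: "\<bar>A.G u' m - B.G u' m\<bar> \<le> (\<Sum>k\<in>K. D k) * \<delta>" by (simp add: sum_distrib_right)
    have "\<bar>w m - \<gamma> * A.P w m\<bar> \<le> (1 - \<gamma>) * \<bar>f m - f' m\<bar> + \<gamma> * (\<bar>A.G u' m - B.G u' m\<bar> / C)"
      unfolding e using \<gamma> A.C_pos by (intro order_trans[OF abs_triangle_ineq]) (simp add: abs_mult)
    also have "\<dots> \<le> 1 * \<delta> + 1 * ((\<Sum>k\<in>K. D k) * \<delta> / C)"
      using \<gamma> G ff'[OF m] A.C_pos by (intro add_mono mult_mono divide_right_mono) auto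
    finally show ?thesis by (simp add: distrib_right)
  qed
  moreover have "A.bdd w" unfolding w_def by (intro A.bdd_linear bu)
  ultimately have "\<bar>w n\<bar> \<le> (1 + (\<Sum>k\<in>K. D k) / C) * \<delta> / (1 - \<gamma>)"
    using A.fixpoint_bound[OF \<gamma> _ _ n] by blast
  then show ?thesis by (simp add: w_def u_def u'_def)
qed

section \<open>Averaging over the quasi-stationary process\<close>

lemma pointwise_convergent_subsequence:
  fixes X :: "nat \<Rightarrow> nat \<Rightarrow> real"
  assumes "\<And>m i. X m i \<in> {0..1}"
  obtains l r where "strict_mono (r :: nat \<Rightarrow> nat)" "\<And>i. (\<lambda>m. X (r m) i) \<longlonglongrightarrow> l i"
proof -
  have "compactin (product_topology (\<lambda>_. euclidean) UNIV) (PiE UNIV (\<lambda>_::nat. {0..1::real}))"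
    by (subst compactin_PiE) simp
  then have "seq_compact (PiE UNIV (\<lambda>_::nat. {0..1::real}))"
    by (simp only: euclidean_product_topology compactin_euclidean_iff compact_imp_seq_compact)
  moreover have "\<forall>m. X m \<in> PiE UNIV (\<lambda>_::nat. {0..1::real})" using assms by auto
  ultimately obtain l r where r: "strict_mono (r :: nat \<Rightarrow> nat)" "(X \<circ> r) \<longlonglongrightarrow> l"
    by (metis seq_compactE)
  have "(\<lambda>m. X (r m) i) \<longlonglongrightarrow> l i" for i
  proof -
    have "isCont (\<lambda>x :: nat \<Rightarrow> real. x i) l"
      by (rule continuous_on_interior[OF continuous_on_product_coordinates]) simp
    from isCont_tendsto_compose[OF this r(2)] show ?thesis by (simp add: o_def)
  qed
  then show ?thesis using that r by blast
qed

abbreviation point :: "'s \<Rightarrow> 's \<Rightarrow> real" where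
  "point j \<equiv> (\<lambda>n. if n = j then 1 else 0)"

text \<open>
  The resolvent of indicators of points is the law at a geometric time. Applying \<open>R_G\<close> to an indicator
  shows that this law is invariant up to an error of order \<open>1 - \<gamma>\<close>.
\<close>

lemma (in bounded_rates) resolvent_inflow:
  assumes \<gamma>: "0 < \<gamma>" "\<gamma> < 1" and n: "n \<in> S" and j: "j \<in> S"
    and d0: "\<And>n k. n \<in> S \<Longrightarrow> k \<in> K \<Longrightarrow> n k = 0 \<Longrightarrow> d n k = 0"
  shows "inflow K b d (\<lambda>j. R \<gamma> (point j) n) j - total_rate K b d j * R \<gamma> (point j) n =
    C * (1 - \<gamma>) / \<gamma> * (R \<gamma> (point j) n - point j n)"
proof -
  have bp: "bdd (point i)" for i by (rule bddI[of _ 1]) simp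
  define f1 where "f1 = (\<lambda>k n. if 0 < j k then point (dec k j) n else 0 :: real)"
  define f2 where "f2 = (\<lambda>k n. d (inc k j) k * point (inc k j) n)"
  have b1: "bdd (f1 k)" for k by (rule bddI[of _ 1]) (simp add: f1_def)
  have b2: "bdd (f2 k)" for k by (rule bddI[of _ "\<bar>d (inc k j) k\<bar>"]) (simp add: f2_def)
  have G: "G (point j) i = (\<Sum>k\<in>K. b k * f1 k i) + ((\<Sum>k\<in>K. 1 * f2 k i) + ((- total_rate K b d j) * point j i + 0))"
    if i: "i \<in> S" for i
  proof -
    have "point j (inc k i) = f1 k i" for k
    proof -
      have "inc k i = j \<longleftrightarrow> 0 < j k \<and> i = dec k j" using eq_inc_iff[of j i k] by (simp only: eq_commute[of "inc k i" j])
      then show ?thesis by (simp add: f1_def)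
    qed
    moreover have "d i k * point j (dec k i) = 1 * f2 k i" if k: "k \<in> K" for k
    proof (cases "i k = 0")
      case True
      then have "i \<noteq> inc k j" by auto
      then show ?thesis using d0[OF i k True] by (simp add: f2_def)
    next
      case False
      then have "0 < i k" by simp
      then have "dec k i = j \<longleftrightarrow> i = inc k j"
        using eq_inc_iff[of i j k] by (simp only: eq_commute[of "dec k i" j] simp_thms)
      then show ?thesis by (simp add: f2_def)
    qed
    ultimately show ?thesis by (simp add: gen_alt)
  qed
  let ?F = "\<lambda>i. 1 * (\<Sum>k\<in>K. b k * f1 k i) + (1 * (\<Sum>k\<in>K. 1 * f2 k i) + ((- total_rate K b d j) * point j i + 0))"
  have c0: "bdd (\<lambda>i. (- total_rate K b d j) * point j i + 0)" by (rule bdd_linear[OF bp bdd_const])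
  have s1: "bdd (\<lambda>i. \<Sum>k\<in>K. b k * f1 k i)" by (rule bdd_sum[OF finite_K b1])
  have s2: "bdd (\<lambda>i. \<Sum>k\<in>K. 1 * f2 k i)" by (rule bdd_sum[OF finite_K b2])
  have s3: "bdd (\<lambda>i. 1 * (\<Sum>k\<in>K. 1 * f2 k i) + ((- total_rate K b d j) * point j i + 0))"
    by (rule bdd_linear[OF s2 c0])
  have Rf1: "R \<gamma> (f1 k) n = (if 0 < j k then R \<gamma> (point (dec k j)) n else 0)" for k
    unfolding f1_def using R_const[OF \<gamma>, of 0 n] by simp
  have Rf2: "R \<gamma> (f2 k) n = d (inc k j) k * R \<gamma> (point (inc k j)) n" for k
    using R_linear[OF \<gamma> bp bdd_const n, of "d (inc k j) k" "inc k j" 0]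
    unfolding f2_def by (simp add: R_const[OF \<gamma>])
  have "R \<gamma> (G (point j)) n = R \<gamma> ?F n"
  proof -
    have "R \<gamma> (G (point j)) n \<le> R \<gamma> ?F n"
      by (rule R_mono[OF \<gamma> bdd_G[OF bp] bdd_linear[OF s1 s3] _ n]) (simp add: G)
    moreover have "R \<gamma> ?F n \<le> R \<gamma> (G (point j)) n"
      by (rule R_mono[OF \<gamma> bdd_linear[OF s1 s3] bdd_G[OF bp] _ n]) (simp add: G)
    ultimately show ?thesis by simp
  qed
  also have "\<dots> = 1 * (\<Sum>k\<in>K. b k * R \<gamma> (f1 k) n) + (1 * (\<Sum>k\<in>K. 1 * R \<gamma> (f2 k) n) + ((- total_rate K b d j) * R \<gamma> (point j) n + 0))"
    by (simp only: R_linear[OF \<gamma> s1 s3 n] R_linear[OF \<gamma> s2 c0 n] R_linear[OF \<gamma> bp bdd_const n]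
        R_sum[OF \<gamma> finite_K b1 n] R_sum[OF \<gamma> finite_K b2 n] R_const[OF \<gamma>])
  also have "\<dots> = inflow K b d (\<lambda>j. R \<gamma> (point j) n) j - total_rate K b d j * R \<gamma> (point j) n"
    unfolding inflow_def Rf1 Rf2 by simp
  finally show ?thesis using R_G[OF \<gamma> bp n, of j] by simp
qed

text \<open>
  By uniqueness, any nonzero finite invariant measure yields the stationary distribution.
\<close>

lemma stationary_distribution_eq:
  assumes K: "finite K" and b: "\<And>k. k \<in> K \<Longrightarrow> 0 < b k"
    and d: "\<And>n k. n \<in> populations K \<Longrightarrow> k \<in> K \<Longrightarrow> 0 \<le> d n k \<and> d n k \<le> D k \<and> (d n k = 0 \<longleftrightarrow> n k = 0)"
    and v: "\<And>n. n \<in> populations K \<Longrightarrow> 0 \<le> v n"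
    and inv: "\<And>n. n \<in> populations K \<Longrightarrow> inflow K b d v n = v n * total_rate K b d n"
    and sv: "v summable_on populations K" and pos: "0 < infsum v (populations K)" and n: "n \<in> populations K"
  shows "pmf (stationary_distribution (populations K) (birth_death_rate K b d)) n = v n / infsum v (populations K)"
proof -
  let ?S = "populations K"
  define c where "c = infsum v ?S"
  define f where "f = (\<lambda>n. if n \<in> ?S then v n / c else 0)"
  have c: "0 < c" using pos by (simp add: c_def)
  have f: "0 \<le> f m" for m using v c by (simp add: f_def)
  have vc: "(\<lambda>n. v n / c) summable_on ?S" using summable_on_cmult_right[OF sv, of "1 / c"] by simp
  have vc1: "infsum (\<lambda>n. v n / c) ?S = 1"
    using infsum_cmult_right'[of "1 / c" v ?S] c by (simp add: c_def)
  have abs: "Infinite_Set_Sum.abs_summable_on (\<lambda>n. v n / c) ?S"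
    using vc v c by (subst abs_summable_equivalent[symmetric]) (auto intro!: summable_on_cong[THEN iffD1, OF _ vc])
  have "(\<integral>\<^sup>+ m. ennreal (f m) \<partial>count_space UNIV) = (\<integral>\<^sup>+ m. ennreal (v m / c) * indicator ?S m \<partial>count_space UNIV)"
    by (intro nn_integral_cong) (auto simp: f_def)
  also have "\<dots> = (\<integral>\<^sup>+ m. ennreal (v m / c) \<partial>count_space ?S)"
    by (simp add: nn_integral_count_space_indicator)
  also have "\<dots> = ennreal (infsetsum (\<lambda>n. v n / c) ?S)"
    using v c by (intro nn_integral_conv_infsetsum abs) auto
  also have "\<dots> = 1" using infsetsum_infsum[OF abs] vc1 by simp
  finally have "pmf (embed_pmf f) m = f m" for m using f by (intro pmf_embed_pmf) auto
  moreover define p where "p = embed_pmf f"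
  ultimately have pf: "pmf p m = (if m \<in> ?S then v m / c else 0)" for m by (simp add: f_def)
  have "is_stationary_distribution ?S (birth_death_rate K b d) p"
  proof (subst is_stationary_distribution_iff[OF K], use d in blast, intro conjI ballI)
    show "set_pmf p \<subseteq> ?S" by (auto simp: set_pmf_eq pf split: if_splits)
    fix j assume j: "j \<in> ?S"
    have "inflow K b d (pmf p) j = inflow K b d (\<lambda>n. v n / c) j"
      unfolding inflow_def using j
      by (intro arg_cong2[where f="(+)"] sum.cong) (simp_all add: pf inc_populations dec_populations)
    also have "\<dots> = inflow K b d v j / c"
      unfolding inflow_def add_divide_distrib sum_divide_distrib
      by (intro arg_cong2[where f="(+)"] sum.cong) simp_all
    finally show "inflow K b d (pmf p) j = pmf p j * total_rate K b d j"
      using inv[OF j] j by (simp add: pf)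
  qed
  then have "stationary_distribution ?S (birth_death_rate K b d) = p"
    unfolding stationary_distribution_def
    using stationary_distribution_unique[of K b d D, OF K b d] by (intro the_equality) blast+
  then show ?thesis using n by (simp add: pf c_def)
qed

text \<open>
  If the bound failed for every choice of \<open>\<gamma>\<close> and \<open>\<delta>\<close>, there would be shares \<open>al m\<close> approaching \<open>[0, c]\<close>,
  states \<open>st m\<close> and geometric times with \<open>g m \<longlonglongrightarrow> 1\<close> violating it. Along a subsequence the shares and
  the laws \<open>\<nu> m\<close> at these times converge pointwise. The balance equations involve finitely many states
  each, so they pass to the limit \<open>\<pi>\<close>, and so does the lower bound for the mean of the service rate of
  class \<open>0\<close>, because this rate is small outside a finite set. As \<open>\<pi>\<close> has mass at most \<open>1\<close>, its
  normalisation has at least the same mean, contradicting \<open>mean\<close>.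
\<close>

lemma resolvent_le_above_quasi_stationary_mean:
  fixes L :: nat and lam mu a :: "nat \<Rightarrow> real"
  defines "K \<equiv> {2..L}" and "D \<equiv> \<lambda>\<alpha> n k. mu k * phi_qs L a \<alpha> n k"
  assumes lam: "\<And>k. k \<in> K \<Longrightarrow> 0 < lam k" and mu: "\<And>k. k \<in> K \<Longrightarrow> 0 < mu k" and a: "\<And>k. k \<in> K \<Longrightarrow> 0 < a k"
    and c: "0 \<le> c" "c \<le> 1" and \<eta>: "0 \<le> \<eta>0" "\<eta>0 < \<eta>"
    and mean: "\<And>x. x \<in> {0..c} \<Longrightarrow> phi0_bar L lam mu a x \<le> \<eta>0"
    and rates: "\<And>\<alpha>. 0 \<le> \<alpha> \<Longrightarrow> \<alpha> \<le> 1 \<Longrightarrow> bounded_rates K lam (D \<alpha>) C"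
  shows "\<exists>\<gamma> \<delta>. 0 < \<gamma> \<and> \<gamma> < 1 \<and> 0 < \<delta> \<and> (\<forall>\<alpha> n. 0 \<le> \<alpha> \<and> \<alpha> \<le> 1 \<and> \<alpha> \<le> c + \<delta> \<and> n \<in> populations K \<longrightarrow>
    resolvent K lam (D \<alpha>) C \<gamma> (\<lambda>n. phi_qs L a \<alpha> n 0) n \<le> \<eta>)"
proof (rule ccontr)
  assume contra: "\<not> ?thesis"
  let ?S = "populations K" and ?\<phi> = "\<lambda>\<alpha> n. phi_qs L a \<alpha> n 0"
  define g where "g = (\<lambda>m::nat. 1 - 1 / (real m + 2))"
  have g: "0 < g m" "g m < 1" for m by (simp_all add: g_def)
  have "\<exists>\<alpha> n. 0 \<le> \<alpha> \<and> \<alpha> \<le> 1 \<and> \<alpha> \<le> c + 1 / (real m + 1) \<and> n \<in> ?S \<and>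
      \<eta> < resolvent K lam (D \<alpha>) C (g m) (?\<phi> \<alpha>) n" for m
  proof -
    let ?H = "\<lambda>\<gamma> \<delta>. \<forall>\<alpha> n. 0 \<le> \<alpha> \<and> \<alpha> \<le> 1 \<and> \<alpha> \<le> c + \<delta> \<and> n \<in> ?S \<longrightarrow>
      resolvent K lam (D \<alpha>) C \<gamma> (?\<phi> \<alpha>) n \<le> \<eta>"
    have "\<not> ?H (g m) (1 / (real m + 1))"
    proof
      assume H: "?H (g m) (1 / (real m + 1))"
      have "0 < 1 / (real m + 1)" by simp
      then have "0 < g m \<and> g m < 1 \<and> 0 < 1 / (real m + 1) \<and> ?H (g m) (1 / (real m + 1))"
        using g[of m] H by (intro conjI)
      then show False using contra by blast
    qed
    then show ?thesis unfolding not_all not_imp not_le by blast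
  qed
  then obtain al st where al: "\<And>m. 0 \<le> al m" "\<And>m. al m \<le> 1" "\<And>m. al m \<le> c + 1 / (real m + 1)"
    and st: "\<And>m. st m \<in> ?S"
    and large: "\<And>m. \<eta> < resolvent K lam (D (al m)) C (g m) (?\<phi> (al m)) (st m)"
    by metis
  have br: "bounded_rates K lam (D (al m)) C" for m by (rule rates[OF al(1,2)])
  define \<nu> where "\<nu> = (\<lambda>m j. resolvent K lam (D (al m)) C (g m) (point j) (st m))"
  have \<nu>: "0 \<le> \<nu> m j" "\<nu> m j \<le> 1" for m j
    using bounded_rates.R_bounds[OF br g, of 0 "point j" 1 "st m"] st by (simp_all add: \<nu>_def)
  have countable: "countable ?S" by (rule countable_populations) (simp add: K_def)
  \<comment> \<open>the shares and the laws, as one sequence of points of a compact product of unit intervals\<close>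
  define X where "X = (\<lambda>m i. case i of 0 \<Rightarrow> al m | Suc i \<Rightarrow> \<nu> m (from_nat_into ?S i))"
  have "X m i \<in> {0..1}" for m i using al \<nu> by (simp add: X_def split: nat.split)
  then obtain l r where r: "strict_mono r" "\<And>i. (\<lambda>m. X (r m) i) \<longlonglongrightarrow> l i"
    using pointwise_convergent_subsequence by metis
  define \<alpha> where "\<alpha> = l 0"
  define \<pi> where "\<pi> = (\<lambda>j. l (Suc (to_nat_on ?S j)))"
  have lim_al: "(\<lambda>m. al (r m)) \<longlonglongrightarrow> \<alpha>" using r(2)[of 0] by (simp add: X_def \<alpha>_def)
  have lim_\<nu>: "(\<lambda>m. \<nu> (r m) j) \<longlonglongrightarrow> \<pi> j" if "j \<in> ?S" for j
    using r(2)[of "Suc (to_nat_on ?S j)"] countable that by (simp add: X_def \<pi>_def)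
  have r_le: "m \<le> r m" for m by (rule seq_suble[OF r(1)])
  have "\<alpha> \<le> c"
  proof (rule LIMSEQ_le[OF lim_al])
    have "(\<lambda>m. c + 1 / (real m + 1)) \<longlonglongrightarrow> c + 0"
      using LIMSEQ_inverse_real_of_nat by (intro tendsto_add tendsto_const) (simp add: inverse_eq_divide add.commute)
    then show "(\<lambda>m. c + 1 / (real m + 1)) \<longlonglongrightarrow> c" by simp
    show "\<exists>N. \<forall>m\<ge>N. al (r m) \<le> c + 1 / (real m + 1)"
    proof (intro exI allI impI)
      fix m
      have "al (r m) \<le> c + 1 / (real (r m) + 1)" by (rule al)
      also have "\<dots> \<le> c + 1 / (real m + 1)" using r_le[of m] by (simp add: frac_le)
      finally show "al (r m) \<le> c + 1 / (real m + 1)" .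
    qed
  qed
  moreover have "0 \<le> \<alpha>" by (rule LIMSEQ_le_const[OF lim_al]) (use al in auto)
  ultimately have \<alpha>: "0 \<le> \<alpha>" "\<alpha> \<le> 1" "\<alpha> \<in> {0..c}" using c by auto
  have a': "\<And>k. k \<in> {2..L} \<Longrightarrow> 0 < a k" using a by (simp add: K_def)
  have lim_phi: "(\<lambda>m. phi_qs L a (al (r m)) n k) \<longlonglongrightarrow> phi_qs L a \<alpha> n k" if "n \<in> ?S" for n k
  proof (rule metric_LIMSEQ_I)
    fix e :: real assume "0 < e"
    obtain N where N: "\<forall>m\<ge>N. dist (al (r m)) \<alpha> < e" using metric_LIMSEQ_D[OF lim_al \<open>0 < e\<close>] by blast
    show "\<exists>N. \<forall>m\<ge>N. dist (phi_qs L a (al (r m)) n k) (phi_qs L a \<alpha> n k) < e"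
    proof (intro exI[of _ N] allI impI)
      fix m assume "N \<le> m"
      then have "\<bar>al (r m) - \<alpha>\<bar> < e" using N by (simp add: dist_real_def)
      moreover have "\<bar>phi_qs L a (al (r m)) n k - phi_qs L a \<alpha> n k\<bar> \<le> \<bar>al (r m) - \<alpha>\<bar>"
        using a' that[unfolded K_def] al(1,2) \<alpha>(1,2) by (rule phi_qs_lipschitz)
      ultimately show "dist (phi_qs L a (al (r m)) n k) (phi_qs L a \<alpha> n k) < e"
        by (simp add: dist_real_def)
    qed
  qed
  have finite_K: "finite K" by (simp add: K_def)
  have \<pi>_nonneg: "0 \<le> \<pi> j" if "j \<in> ?S" for j by (rule LIMSEQ_le_const[OF lim_\<nu>[OF that]]) (use \<nu> in auto)
  have d0: "D \<beta> n k = 0" if "n k = 0" "k \<in> K" for \<beta> n k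
    using that by (simp add: D_def phi_qs_def psi_qs_def K_def)
  have invariant: "inflow K lam (D \<alpha>) \<pi> j = \<pi> j * total_rate K lam (D \<alpha>) j" if j: "j \<in> ?S" for j
  proof -
    let ?e = "\<lambda>m. C * (1 - g m) / g m * (\<nu> m j - point j (st m))"
    have eq: "inflow K lam (D (al m)) (\<nu> m) j - total_rate K lam (D (al m)) j * \<nu> m j = ?e m" for m
      unfolding \<nu>_def by (rule bounded_rates.resolvent_inflow[OF br g st j]) (use d0 in blast)
    have "(\<lambda>m. ?e (r m)) \<longlonglongrightarrow> 0"
    proof (rule Lim_null_comparison)
      have "norm (?e m) \<le> C / (real m + 1)" for m
      proof -
        have C: "0 < C" using bounded_rates.C_pos[OF br] .
        have "norm (\<nu> m j - point j (st m)) \<le> 1" using \<nu>[of m j] by simp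
        then have "norm (?e m) \<le> C * (1 - g m) / g m * 1"
          using C g[of m] by (simp only: norm_mult) (intro mult_mono, auto)
        also have "\<dots> = C / (real m + 1)"
        proof -
          have "g m = (real m + 1) / (real m + 2)" "1 - g m = 1 / (real m + 2)"
            by (simp_all add: g_def field_simps)
          then show ?thesis by simp
        qed
        finally show ?thesis .
      qed
      then show "\<forall>\<^sub>F m in sequentially. norm (?e (r m)) \<le> C / (real (r m) + 1)" by simp
      have "(\<lambda>m. C * inverse (real (Suc m))) \<longlonglongrightarrow> C * 0" by (intro tendsto_mult tendsto_const LIMSEQ_inverse_real_of_nat)
      then have "(\<lambda>m. C / (real m + 1)) \<longlonglongrightarrow> 0" by (simp add: inverse_eq_divide add.commute)
      from LIMSEQ_subseq_LIMSEQ[OF this r(1)] show "(\<lambda>m. C / (real (r m) + 1)) \<longlonglongrightarrow> 0" by (simp add: o_def)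
    qed
    moreover have "(\<lambda>m. inflow K lam (D (al (r m))) (\<nu> (r m)) j - total_rate K lam (D (al (r m))) j * \<nu> (r m) j)
       \<longlonglongrightarrow> inflow K lam (D \<alpha>) \<pi> j - total_rate K lam (D \<alpha>) j * \<pi> j"
    proof -
      have 1: "(\<lambda>m. lam k * (if 0 < j k then \<nu> (r m) (dec k j) else 0)) \<longlonglongrightarrow> lam k * (if 0 < j k then \<pi> (dec k j) else 0)" for k
        using lim_\<nu>[OF dec_populations[OF j, of k]] by (cases "0 < j k") (auto intro: tendsto_mult)
      have 2: "(\<lambda>m. D (al (r m)) (inc k j) k * \<nu> (r m) (inc k j)) \<longlonglongrightarrow> D \<alpha> (inc k j) k * \<pi> (inc k j)" if "k \<in> K" for k
        unfolding D_def by (intro tendsto_mult tendsto_const lim_phi lim_\<nu> inc_populations j that)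
      have 3: "(\<lambda>m. D (al (r m)) j k) \<longlonglongrightarrow> D \<alpha> j k" for k
        unfolding D_def by (intro tendsto_mult tendsto_const lim_phi j)
      show ?thesis unfolding inflow_def total_rate_def
        by (intro tendsto_diff tendsto_add tendsto_sum tendsto_mult[of "\<lambda>m. sum lam K + sum (D (al (r m)) j) K"] tendsto_const lim_\<nu> j 1 2 3)
    qed
    ultimately have "inflow K lam (D \<alpha>) \<pi> j - total_rate K lam (D \<alpha>) j * \<pi> j = 0"
      using LIMSEQ_unique by (simp only: eq) blast
    then show ?thesis by (simp add: mult.commute)
  qed
  have bp: "bounded_rates.bdd K (point j)" for j by (rule bounded_rates.bddI[OF br[of 0], of _ 1]) simp
  have mass: "sum \<pi> F \<le> 1" if F: "finite F" "F \<subseteq> ?S" for F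
  proof (rule LIMSEQ_le_const2)
    show "(\<lambda>m. \<Sum>j\<in>F. \<nu> (r m) j) \<longlonglongrightarrow> sum \<pi> F" using F by (intro tendsto_sum lim_\<nu>) auto
    have "(\<Sum>j\<in>F. \<nu> m j) \<le> 1" for m
    proof -
      have "(\<Sum>j\<in>F. 1 * \<nu> m j) = resolvent K lam (D (al m)) C (g m) (\<lambda>n. \<Sum>j\<in>F. 1 * point j n) (st m)"
        unfolding \<nu>_def by (rule bounded_rates.R_sum[OF br g F(1) bp st, symmetric])
      also have "\<dots> \<le> 1"
        by (rule bounded_rates.R_bounds(2)[OF br g _ st, of 0]) (use F in simp)
      finally show ?thesis by simp
    qed
    then show "\<exists>N. \<forall>m\<ge>N. (\<Sum>j\<in>F. \<nu> (r m) j) \<le> 1" by auto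
  qed
  have \<pi>_summable: "\<pi> summable_on ?S"
  proof (rule nonneg_bdd_above_summable_on[OF \<pi>_nonneg])
    show "bdd_above (sum \<pi> ` {F. F \<subseteq> ?S \<and> finite F})" using mass by (intro bdd_aboveI[of _ 1]) auto
  qed
  define z where "z = infsum \<pi> ?S"
  have z1: "z \<le> 1" unfolding z_def by (rule infsum_le_finite_sums[OF \<pi>_summable]) (use mass in auto)
  \<comment> \<open>the service rate outside \<open>F\<close> below may be as large as half of the gap\<close>
  define \<epsilon> where "\<epsilon> = (\<eta> - \<eta>0) / 2"
  have \<epsilon>: "0 < \<epsilon>" "0 < \<eta> - \<epsilon>" "\<eta>0 < \<eta> - \<epsilon>" using \<eta> by (auto simp: \<epsilon>_def field_simps)
  obtain F where F: "finite F" "F \<subseteq> ?S"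
    "\<And>\<alpha> n. 0 \<le> \<alpha> \<Longrightarrow> \<alpha> \<le> 1 \<Longrightarrow> n \<in> ?S - F \<Longrightarrow> phi_qs L a \<alpha> n 0 \<le> \<epsilon>"
  proof -
    have "\<exists>F. finite F \<and> F \<subseteq> ?S \<and>
      (\<forall>\<alpha> n. 0 \<le> \<alpha> \<longrightarrow> \<alpha> \<le> 1 \<longrightarrow> n \<in> ?S - F \<longrightarrow> phi_qs L a \<alpha> n 0 \<le> \<epsilon>)"
      unfolding K_def using a' \<epsilon>(1) by (rule phi_qs_vanishes_at_infinity)
    then show ?thesis using that by blast
  qed
  have phi01: "0 \<le> ?\<phi> \<beta> n" "?\<phi> \<beta> n \<le> 1" if "0 \<le> \<beta>" "\<beta> \<le> 1" "n \<in> ?S" for \<beta> n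
  proof -
    have "0 \<le> ?\<phi> \<beta> n \<and> ?\<phi> \<beta> n \<le> 1"
      using a' that(3)[unfolded K_def] that(1,2) by (rule phi_qs_bounds)
    then show "0 \<le> ?\<phi> \<beta> n" "?\<phi> \<beta> n \<le> 1" by auto
  qed
  have lower: "\<eta> - \<epsilon> \<le> (\<Sum>j\<in>F. ?\<phi> \<alpha> j * \<pi> j)"
  proof (rule LIMSEQ_le_const)
    show "(\<lambda>m. \<Sum>j\<in>F. ?\<phi> (al (r m)) j * \<nu> (r m) j) \<longlonglongrightarrow> (\<Sum>j\<in>F. ?\<phi> \<alpha> j * \<pi> j)"
      using F(2) by (intro tendsto_sum tendsto_mult lim_phi lim_\<nu>) auto
    have "\<eta> - \<epsilon> \<le> (\<Sum>j\<in>F. ?\<phi> (al m) j * \<nu> m j)" for m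
    proof -
      let ?f = "\<lambda>n. \<Sum>j\<in>F. ?\<phi> (al m) j * point j n"
      have bf: "bounded_rates.bdd K ?f"
        by (rule bounded_rates.bdd_sum[OF br[of m] F(1) bp])
      have bc: "bounded_rates.bdd K (\<lambda>_. \<epsilon>)" by (rule bounded_rates.bdd_const[OF br[of m]])
      have bphi: "bounded_rates.bdd K (?\<phi> (al m))"
        by (rule bounded_rates.bddI[OF br[of m], of _ 1]) (use phi01[OF al(1,2)] in auto)
      have "resolvent K lam (D (al m)) C (g m) (?\<phi> (al m)) (st m) \<le>
          resolvent K lam (D (al m)) C (g m) (\<lambda>n. 1 * ?f n + \<epsilon>) (st m)"
      proof (rule bounded_rates.R_mono[OF br g bphi bounded_rates.bdd_linear[OF br bf bc] _ st])
        fix n assume n: "n \<in> ?S"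
        have "?f n = (if n \<in> F then ?\<phi> (al m) n else 0)"
          using F(1) by (simp add: if_distrib[of "\<lambda>x. _ * x"] cong: if_cong)
        then show "?\<phi> (al m) n \<le> 1 * ?f n + \<epsilon>"
          using F(3)[OF al(1,2), of n m] n \<epsilon>(1) by simp
      qed
      also have "\<dots> = 1 * resolvent K lam (D (al m)) C (g m) ?f (st m) + resolvent K lam (D (al m)) C (g m) (\<lambda>_. \<epsilon>) (st m)"
        by (rule bounded_rates.R_linear[OF br g bf bc st])
      also have "resolvent K lam (D (al m)) C (g m) (\<lambda>_. \<epsilon>) (st m) = \<epsilon>" by (rule bounded_rates.R_const[OF br g])
      also have "resolvent K lam (D (al m)) C (g m) ?f (st m) = (\<Sum>j\<in>F. ?\<phi> (al m) j * \<nu> m j)"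
        unfolding \<nu>_def by (rule bounded_rates.R_sum[OF br g F(1) bp st])
      finally show ?thesis using large[of m] by linarith
    qed
    then show "\<exists>N. \<forall>m\<ge>N. \<eta> - \<epsilon> \<le> (\<Sum>j\<in>F. ?\<phi> (al (r m)) j * \<nu> (r m) j)" by auto
  qed
  also have "(\<Sum>j\<in>F. ?\<phi> \<alpha> j * \<pi> j) \<le> (\<Sum>j\<in>F. 1 * \<pi> j)"
    using F(2) phi01[OF \<alpha>(1,2)] \<pi>_nonneg by (intro sum_mono mult_right_mono) auto
  also have "(\<Sum>j\<in>F. 1 * \<pi> j) \<le> z"
    unfolding z_def using F \<pi>_nonneg by (simp, intro finite_sum_le_infsum[OF \<pi>_summable]) auto
  finally have z0: "0 < z" using \<epsilon> by linarith
  have D_eq: "D \<alpha> = (\<lambda>n k. mu k * phi_qs L a \<alpha> n k)" by (simp add: D_def)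
  have pmf: "pmf (pi_qs L lam mu a \<alpha>) n = \<pi> n / z" if n: "n \<in> ?S" for n
    unfolding pi_qs_def qs_rate_def z_def K_def[symmetric] D_eq[symmetric]
  proof (rule stationary_distribution_eq[where D=mu, OF finite_K lam _ \<pi>_nonneg invariant \<pi>_summable _ n])
    show "0 < infsum \<pi> ?S" using z0 by (simp add: z_def)
    show "0 \<le> D \<alpha> n k \<and> D \<alpha> n k \<le> mu k \<and> (D \<alpha> n k = 0 \<longleftrightarrow> n k = 0)" if "n \<in> ?S" "k \<in> K" for n k
    proof -
      have "0 \<le> phi_qs L a \<alpha> n k \<and> phi_qs L a \<alpha> n k \<le> 1"
        using a' that(1)[unfolded K_def] \<alpha>(1,2) by (rule phi_qs_bounds)
      moreover have "phi_qs L a \<alpha> n k = 0 \<longleftrightarrow> n k = 0"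
        using a' that(1)[unfolded K_def] \<alpha>(1,2) that(2)[unfolded K_def] by (rule phi_qs_eq_0_iff)
      ultimately show ?thesis
        using mu[OF that(2)] by (simp add: D_def mult_left_le)
    qed
  qed
  have "\<eta> - \<epsilon> \<le> (\<Sum>j\<in>F. ?\<phi> \<alpha> j * \<pi> j)" by (rule lower)
  also have "\<dots> \<le> (\<Sum>j\<in>F. ?\<phi> \<alpha> j * \<pi> j) / z"
    using z0 z1 lower \<epsilon> by (simp add: pos_le_divide_eq mult_left_le)
  also have "\<dots> = (\<Sum>j\<in>F. pmf (pi_qs L lam mu a \<alpha>) j * ?\<phi> \<alpha> j)"
    unfolding sum_divide_distrib using F(2) by (intro sum.cong) (auto simp: pmf mult.commute)
  also have "\<dots> \<le> phi0_bar L lam mu a \<alpha>"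
    unfolding phi0_bar_def K_def[symmetric]
  proof (rule finite_sum_le_infsum[OF _ F(1,2)])
    show "(\<lambda>n. pmf (pi_qs L lam mu a \<alpha>) n * ?\<phi> \<alpha> n) summable_on ?S"
    proof (rule summable_on_comparison_test)
      show "(\<lambda>n. \<pi> n * (1 / z)) summable_on ?S" by (rule summable_on_cmult_left[OF \<pi>_summable])
      show "pmf (pi_qs L lam mu a \<alpha>) n * ?\<phi> \<alpha> n \<le> \<pi> n * (1 / z)" if "n \<in> ?S" for n
        using that phi01[OF \<alpha>(1,2)] \<pi>_nonneg z0 by (simp add: pmf divide_right_mono mult_left_le)
      show "0 \<le> pmf (pi_qs L lam mu a \<alpha>) n * ?\<phi> \<alpha> n" if "n \<in> ?S" for n
        using that phi01[OF \<alpha>(1,2)] by simp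
    qed
    show "0 \<le> pmf (pi_qs L lam mu a \<alpha>) n * ?\<phi> \<alpha> n" if "n \<in> ?S - F" for n
      using that phi01[OF \<alpha>(1,2)] by simp
  qed
  also have "\<dots> \<le> \<eta>0" by (rule mean[OF \<alpha>(3)])
  finally show False using \<epsilon> by linarith
qed

section \<open>Lyapunov functions\<close>

lemma gen_le:
  assumes b: "\<And>k. k \<in> K \<Longrightarrow> 0 \<le> b k" and d: "\<And>k. k \<in> K \<Longrightarrow> 0 \<le> d n k"
    and up: "\<And>k. k \<in> K \<Longrightarrow> g (inc k n) - g n \<le> A * (f (inc k n) - f n) + e"
    and down: "\<And>k. k \<in> K \<Longrightarrow> g (dec k n) - g n \<le> A * (f (dec k n) - f n) + e"
  shows "gen K b d g n \<le> A * gen K b d f n + e * total_rate K b d n"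
proof -
  have "gen K b d g n \<le> (\<Sum>k\<in>K. b k * (A * (f (inc k n) - f n) + e)) + (\<Sum>k\<in>K. d n k * (A * (f (dec k n) - f n) + e))"
    unfolding gen_def using assms by (intro add_mono sum_mono mult_left_mono) simp_all
  also have "\<dots> = A * gen K b d f n + e * total_rate K b d n"
    unfolding gen_def total_rate_def
    by (simp only: distrib_left sum.distrib sum_distrib_left mult.left_commute mult.commute[of e])
  finally show ?thesis .
qed

lemma gen_add: "gen K b d (\<lambda>n. f n + g n) n = gen K b d f n + gen K b d g n"
  using gen_linear[of K b d 1 f g n] by simp

text \<open>
  Suppose \<open>f\<close> decreases geometrically where it is below \<open>M\<close>, and states with \<open>M \<le> f\<close> have few flows of
  class \<open>0\<close> or of class \<open>1\<close>. Cutting \<open>f\<close> off at \<open>M\<close> gives a function with nonpositive drift everywhere. It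
  becomes strictly decreasing after multiplication by \<open>1 + \<kappa> * w\<close>, where \<open>w\<close> is bounded and has strictly
  negative drift wherever \<open>n 0 < J\<close> or \<open>n 1 < J\<close>: it depends on \<open>min (n 0) J + min (n 1) J\<close>, whose arrivals
  have a rate bounded below there, and its increments grow so fast that a possible arrival outweighs
  all departures. With \<open>\<kappa>\<close> small this factor does not spoil the drift where \<open>f < M\<close>.
\<close>

lemma global_drift:
  fixes K :: "nat set"
  assumes K: "finite K" "0 \<in> K" "1 \<in> K" and b: "\<And>k. k \<in> K \<Longrightarrow> 0 < b k"
    and d: "\<And>n k. n \<in> populations K \<Longrightarrow> k \<in> K \<Longrightarrow> 0 \<le> d n k \<and> d n k \<le> D k"
    and f: "\<And>n. n \<in> populations K \<Longrightarrow> 0 < f n" and "0 < M" "0 < \<epsilon>"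
    and drift: "\<And>n. n \<in> populations K \<Longrightarrow> f n < M \<Longrightarrow> gen K b d f n \<le> - \<epsilon> * f n"
    and strip: "\<And>n. n \<in> populations K \<Longrightarrow> M \<le> f n \<Longrightarrow> n 0 < J \<or> n 1 < J"
  shows "\<exists>g B \<epsilon>'. 0 < \<epsilon>' \<and> (\<forall>n\<in>populations K. 0 < g n \<and> g n \<le> B \<and> gen K b d g n \<le> - \<epsilon>' * g n)"
proof -
  let ?S = "populations K" and ?G = "gen K b d"
  have D: "0 \<le> D k" if "k \<in> K" for k
    using d[of "\<lambda>_. 0" k] that by (simp add: populations_def)
  define l where "l = min (b 0) (b 1)"
  have l: "0 < l" "l \<le> b 0" "l \<le> b 1" using b[OF K(2)] b[OF K(3)] by (auto simp: l_def)
  define C where "C = sum b K + sum D K"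
  have "0 < sum b K" using K b by (intro sum_pos) auto
  moreover have "0 \<le> sum D K" by (rule sum_nonneg[OF D])
  ultimately have C: "0 < C" by (simp add: C_def)
  have total: "0 \<le> total_rate K b d n" "total_rate K b d n \<le> C" if "n \<in> ?S" for n
    unfolding total_rate_def C_def using d[OF that] b
    by (auto intro!: add_nonneg_nonneg sum_nonneg sum_mono intro: less_imp_le)
  \<comment> \<open>chosen such that \<open>lR\<close> below holds\<close>
  define R where "R = 2 + (D 0 + D 1) / l"
  have R: "2 \<le> R" using D[OF K(2)] D[OF K(3)] l by (simp add: R_def)
  have lR: "l * (R - 1) - (D 0 + D 1) = l" using l by (simp add: R_def field_simps)
  define m where "m = (\<lambda>n :: nat \<Rightarrow> nat. min (n 0) J + min (n 1) J)"
  define W where "W = R ^ (2 * J)"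
  define w where "w = (\<lambda>n. W - R ^ m n)"
  have m2: "m n \<le> 2 * J" for n by (simp add: m_def)
  have w: "0 \<le> w n" "w n \<le> W" for n
    using power_increasing[OF m2, of R n] R by (simp_all add: w_def W_def)
  have W: "1 \<le> W" using one_le_power[of R "2 * J"] R by (simp add: W_def)
  define \<kappa> where "\<kappa> = \<epsilon> / (2 * W * C)"
  have \<kappa>: "0 < \<kappa>" using \<open>0 < \<epsilon>\<close> W C by (simp add: \<kappa>_def)
  have \<kappa>W: "\<kappa> * W * C = \<epsilon> / 2" using W C by (simp add: \<kappa>_def)
  define h where "h = (\<lambda>n. min (f n) M)"
  have h: "0 < h n" "h n \<le> M" "h n \<le> f n" if "n \<in> ?S" for n
    using f[OF that] \<open>0 < M\<close> by (auto simp: h_def)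
  define g where "g = (\<lambda>n. h n * (1 + \<kappa> * w n))"
  have kw: "1 \<le> 1 + \<kappa> * w n" "1 + \<kappa> * w n \<le> 1 + \<kappa> * W" for n
    using \<kappa> w[of n] by (simp_all add: mult_left_mono)
  define \<epsilon>' where "\<epsilon>' = min (\<epsilon> / 2) (\<kappa> * l) / (1 + \<kappa> * W)"
  have kW: "0 < 1 + \<kappa> * W" using \<kappa> W by (simp add: add_pos_nonneg)
  have \<epsilon>': "0 < \<epsilon>'" using \<open>0 < \<epsilon>\<close> \<kappa> l kW by (simp add: \<epsilon>'_def)
  have gh: "g n \<le> (1 + \<kappa> * W) * h n" if "n \<in> ?S" for n
    using mult_left_mono[OF kw(2)[of n], of "h n"] h[OF that] by (simp add: g_def mult.commute)
  have conclude: "?G g n \<le> - \<epsilon>' * g n" if n: "n \<in> ?S" and le: "?G g n \<le> - min (\<epsilon> / 2) (\<kappa> * l) * h n" for n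
  proof -
    have "\<epsilon>' * g n \<le> \<epsilon>' * ((1 + \<kappa> * W) * h n)" using \<epsilon>' gh[OF n] by (intro mult_left_mono) auto
    also have "\<dots> = min (\<epsilon> / 2) (\<kappa> * l) * h n" using kW by (simp add: \<epsilon>'_def)
    finally show ?thesis using le by simp
  qed
  have pos: "0 < g n" if "n \<in> ?S" for n
    unfolding g_def using h(1)[OF that] kw(1)[of n] by (intro mult_pos_pos) linarith+
  have bound: "g n \<le> M * (1 + \<kappa> * W)" if "n \<in> ?S" for n
    unfolding g_def using h[OF that] kw[of n] \<open>0 < M\<close> by (intro mult_mono) auto
  have nn: "0 \<le> b k" if "k \<in> K" for k using b[OF that] by simp
  have "?G g n \<le> - \<epsilon>' * g n" if n: "n \<in> ?S" for n
  proof (cases "f n < M")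
    case True
    let ?A = "1 + \<kappa> * w n + \<kappa> * W"
    have hn: "h n = f n" using True by (simp add: h_def)
    have step: "g n' - g n \<le> ?A * (f n' - f n) + \<kappa> * W * f n" if n': "n' \<in> ?S" for n'
    proof -
      have "h n' * (1 + \<kappa> * w n') \<le> h n' * (1 + \<kappa> * W)"
        using kw(2)[of n'] h(1)[OF n'] by (intro mult_left_mono) auto
      also have "\<dots> \<le> f n' * ?A"
        using h[OF n'] kw(1)[of n] f[OF n'] \<kappa> W w(1)[of n]
        by (intro mult_mono) (auto intro: add_nonneg_nonneg mult_nonneg_nonneg)
      finally show ?thesis by (simp add: g_def hn algebra_simps)
    qed
    have "?G g n \<le> ?A * ?G f n + \<kappa> * W * f n * total_rate K b d n"
      using d[OF n] by (intro gen_le step inc_populations dec_populations n nn) auto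
    also have "?A * ?G f n \<le> 1 * (- \<epsilon> * f n)"
    proof -
      have G: "?G f n \<le> - \<epsilon> * f n" by (rule drift[OF n True])
      have "- \<epsilon> * f n \<le> 0" using f[OF n] \<open>0 < \<epsilon>\<close> by simp
      have "?A * ?G f n \<le> ?A * (- \<epsilon> * f n)" using G kw(1)[of n] \<kappa> W by (intro mult_left_mono) auto
      also have "\<dots> \<le> 1 * (- \<epsilon> * f n)"
        using kw(1)[of n] \<kappa> W \<open>- \<epsilon> * f n \<le> 0\<close> by (intro mult_right_mono_neg) auto
      finally show ?thesis .
    qed
    also have "\<kappa> * W * f n * total_rate K b d n \<le> \<kappa> * W * f n * C"
      using total[OF n] \<kappa> W f[OF n] by (intro mult_left_mono) auto
    also have "\<kappa> * W * f n * C = \<epsilon> / 2 * f n" using \<kappa>W by (simp add: mult.commute mult.left_commute)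
    finally have "?G g n \<le> - (\<epsilon> / 2) * h n" by (simp add: hn)
    also have "\<dots> \<le> - min (\<epsilon> / 2) (\<kappa> * l) * h n"
      using h(1)[OF n] by (intro mult_right_mono) auto
    finally show ?thesis by (rule conclude[OF n])
  next
    case False
    then have hn: "h n = M" by (simp add: h_def)
    have step: "g n' - g n \<le> M * \<kappa> * (w n' - w n) + 0" if n': "n' \<in> ?S" for n'
    proof -
      have "h n' * (1 + \<kappa> * w n') \<le> M * (1 + \<kappa> * w n')"
        using h[OF n'] kw(1)[of n'] by (intro mult_right_mono) auto
      then show ?thesis by (simp add: g_def hn algebra_simps)
    qed
    have "?G g n \<le> M * \<kappa> * ?G w n + 0 * total_rate K b d n"
      using d[OF n] by (intro gen_le step inc_populations dec_populations n nn) auto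
    also have "?G w n \<le> - l"
    proof -
      let ?r = "R ^ m n"
      have r: "1 \<le> ?r" using R by (intro one_le_power) simp
      obtain k where k: "k = 0 \<or> k = 1" "n k < J" using strip[OF n] False by force
      have kK: "k \<in> K" using k K by auto
      have up: "0 \<le> b i * (R ^ m (inc i n) - ?r)" if "i \<in> K" for i
      proof -
        have "m n \<le> m (inc i n)" by (auto simp: m_def)
        then show ?thesis using nn[OF that] R by (intro mult_nonneg_nonneg) (auto intro: power_increasing)
      qed
      have mk: "m (inc k n) = Suc (m n)" using k by (auto simp: m_def)
      have "l * (R - 1) * ?r \<le> b k * (R - 1) * ?r" using k l r R by (intro mult_right_mono) auto
      also have "\<dots> = b k * (R ^ m (inc k n) - ?r)" by (simp add: mk algebra_simps)
      also have "\<dots> \<le> (\<Sum>i\<in>K. b i * (R ^ m (inc i n) - ?r))"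
        using kK K(1) up by (intro member_le_sum) auto
      finally have ups: "l * (R - 1) * ?r \<le> (\<Sum>i\<in>K. b i * (R ^ m (inc i n) - ?r))" .
      have "(\<Sum>i\<in>K. (if i = 0 then - D 0 * ?r else 0) + (if i = 1 then - D 1 * ?r else 0)) \<le> (\<Sum>i\<in>K. d n i * (R ^ m (dec i n) - ?r))"
      proof (rule sum_mono)
        fix i assume i: "i \<in> K"
        show "(if i = 0 then - D 0 * ?r else 0) + (if i = 1 then - D 1 * ?r else 0) \<le> d n i * (R ^ m (dec i n) - ?r)"
        proof (cases "i = 0 \<or> i = 1")
          case True
          have "0 \<le> R ^ m (dec i n)" using R by simp
          then have "d n i * (- ?r) \<le> d n i * (R ^ m (dec i n) - ?r)" using d[OF n i] by (intro mult_left_mono) auto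
          moreover have "- D i * ?r \<le> d n i * (- ?r)" using d[OF n i] r by (simp add: mult_right_mono)
          ultimately show ?thesis using True by auto
        next
          case False
          then have "m (dec i n) = m n" by (simp add: m_def)
          then show ?thesis using False by simp
        qed
      qed
      moreover have "(\<Sum>i\<in>K. (if i = 0 then - D 0 * ?r else 0) + (if i = 1 then - D 1 * ?r else 0)) = - (D 0 + D 1) * ?r"
        using K by (simp add: sum.distrib algebra_simps)
      ultimately have downs: "- (D 0 + D 1) * ?r \<le> (\<Sum>i\<in>K. d n i * (R ^ m (dec i n) - ?r))" by simp
      have "?G w n = - ((\<Sum>i\<in>K. b i * (R ^ m (inc i n) - ?r)) + (\<Sum>i\<in>K. d n i * (R ^ m (dec i n) - ?r)))"
        unfolding gen_def w_def by (simp add: sum_negf[symmetric] algebra_simps)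
      also have "\<dots> \<le> - ((l * (R - 1) * ?r) + (- (D 0 + D 1) * ?r))" using ups downs by linarith
      also have "\<dots> = - ((l * (R - 1) - (D 0 + D 1)) * ?r)" by (simp add: algebra_simps)
      also have "\<dots> = - (l * ?r)" by (simp only: lR)
      also have "\<dots> \<le> - l" using l r by simp
      finally show ?thesis .
    qed
    then have "M * \<kappa> * ?G w n \<le> M * \<kappa> * (- l)" using \<open>0 < M\<close> \<kappa> by (intro mult_left_mono) auto
    finally have "?G g n \<le> - (\<kappa> * l) * h n" by (simp add: hn mult.commute mult.left_commute)
    also have "\<dots> \<le> - min (\<epsilon> / 2) (\<kappa> * l) * h n"
      using h(1)[OF n] by (intro mult_right_mono) auto
    finally show ?thesis by (rule conclude[OF n])
  qed
  then show ?thesis using \<epsilon>' pos bound by blast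
qed

lemma gen_single_coordinate:
  assumes "finite K" "k \<in> K"
    and "\<And>i. i \<in> K \<Longrightarrow> i \<noteq> k \<Longrightarrow> f (inc i n) = f n \<and> f (dec i n) = f n"
  shows "gen K b d f n = b k * (f (inc k n) - f n) + d n k * (f (dec k n) - f n)"
proof -
  have "(\<Sum>i\<in>K. b i * (f (inc i n) - f n)) = b k * (f (inc k n) - f n)"
    using assms by (subst sum.remove[of _ k]) (auto intro!: sum.neutral)
  moreover have "(\<Sum>i\<in>K. d n i * (f (dec i n) - f n)) = d n k * (f (dec k n) - f n)"
    using assms by (subst sum.remove[of _ k]) (auto intro!: sum.neutral)
  ultimately show ?thesis by (simp add: gen_def)
qed

text \<open>
  Any \<open>r\<close> between \<open>D / b k\<close> and \<open>1\<close> would do in \<open>r ^ n k\<close>; \<open>r\<close> is the midpoint.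
\<close>

lemma overloaded_class_drift:
  assumes K: "finite K" "k \<in> K" and b: "0 < b k" and d: "\<And>n. n \<in> populations K \<Longrightarrow> 0 \<le> d n k \<and> d n k \<le> D"
    and D: "0 < D" "D < b k"
  shows "\<exists>g B \<epsilon>. 0 < \<epsilon> \<and> (\<forall>n\<in>populations K. 0 < g n \<and> g n \<le> B \<and> gen K b d g n \<le> - \<epsilon> * (g n :: real))"
proof -
  define r where "r = (b k + D) / (2 * b k)"
  have r: "0 < r" "r < 1" "D < b k * r" using b D by (simp_all add: r_def field_simps)
  define g where "g = (\<lambda>n :: nat \<Rightarrow> nat. r ^ n k)"
  define \<epsilon> where "\<epsilon> = (1 - r) * (b k - D / r)"
  have Dr: "D / r < b k" using r by (simp add: divide_less_eq)
  have \<epsilon>: "0 < \<epsilon>" using r Dr by (simp add: \<epsilon>_def)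
  have "gen K b d g n \<le> - \<epsilon> * g n" if n: "n \<in> populations K" for n
  proof -
    have "gen K b d g n = b k * (g (inc k n) - g n) + d n k * (g (dec k n) - g n)"
      by (rule gen_single_coordinate[OF K]) (simp add: g_def)
    also have "g (inc k n) - g n = - (1 - r) * g n" by (simp add: g_def algebra_simps)
    also have "d n k * (g (dec k n) - g n) \<le> D * ((1 / r - 1) * g n)"
    proof (rule mult_mono)
      show "g (dec k n) - g n \<le> (1 / r - 1) * g n"
      proof (cases "n k")
        case 0
        then show ?thesis using r by (simp add: g_def field_simps)
      next
        case (Suc j)
        then show ?thesis using r by (simp add: g_def field_simps)
      qed
      show "0 \<le> g (dec k n) - g n"
        unfolding g_def using r by (simp add: power_decreasing)
    qed (use d[OF n] D in auto)
    also have "b k * (- (1 - r) * g n) + D * ((1 / r - 1) * g n) = - \<epsilon> * g n"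
      using r by (simp add: \<epsilon>_def field_simps)
    finally show ?thesis by simp
  qed
  moreover have "0 < g n" "g n \<le> 1" for n using r by (simp_all add: g_def power_le_one)
  ultimately show ?thesis using \<epsilon> by blast
qed

section \<open>The two slow classes\<close>

lemma theta0_qs_cong: "(\<And>j. 2 \<le> j \<Longrightarrow> x j = y j) \<Longrightarrow> theta0_qs \<alpha> x k = theta0_qs \<alpha> y k"
  by (induction k) auto

lemma phi_qs_cong:
  assumes "\<And>j. 2 \<le> j \<Longrightarrow> n j = n' j" "k = 0 \<or> 2 \<le> k"
  shows "phi_qs L a \<alpha> n k = phi_qs L a \<alpha> n' k"
proof -
  have "theta0_qs \<alpha> (\<lambda>j. a j * real (n j)) i = theta0_qs \<alpha> (\<lambda>j. a j * real (n' j)) i" for i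
    using assms(1) by (intro theta0_qs_cong) simp
  then show ?thesis using assms by (auto simp: phi_qs_def psi_qs_def)
qed

lemma phi0_bar_bounds:
  assumes a: "\<And>k. k \<in> {2..L} \<Longrightarrow> 0 < a k" and \<alpha>: "0 \<le> \<alpha>" "\<alpha> \<le> 1"
  shows "0 \<le> phi0_bar L lam mu a \<alpha>" "phi0_bar L lam mu a \<alpha> \<le> 1"
proof -
  let ?S = "populations {2..L}" and ?p = "pi_qs L lam mu a \<alpha>"
  have phi: "0 \<le> phi_qs L a \<alpha> n 0 \<and> phi_qs L a \<alpha> n 0 \<le> 1" if "n \<in> ?S" for n
    using a that \<alpha> by (rule phi_qs_bounds)
  have sp: "pmf ?p summable_on ?S"
    using pmf_abs_summable[of ?p ?S] by (subst (asm) abs_summable_equivalent[symmetric]) (rule abs_summable_summable)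
  show "0 \<le> phi0_bar L lam mu a \<alpha>"
    unfolding phi0_bar_def using phi by (intro infsum_nonneg) simp
  show "phi0_bar L lam mu a \<alpha> \<le> 1"
    unfolding phi0_bar_def
  proof (rule infsum_le_finite_sums)
    show "(\<lambda>n. pmf ?p n * phi_qs L a \<alpha> n 0) summable_on ?S"
      by (rule summable_on_comparison_test[OF sp]) (use phi in \<open>auto simp: mult_left_le\<close>)
    fix F assume F: "finite F" "F \<subseteq> ?S"
    have "(\<Sum>n\<in>F. pmf ?p n * phi_qs L a \<alpha> n 0) \<le> (\<Sum>n\<in>F. pmf ?p n)"
      using F phi by (intro sum_mono) (auto simp: mult_left_le)
    also have "\<dots> = measure ?p F" using F by (simp add: measure_measure_pmf_finite)
    finally show "(\<Sum>n\<in>F. pmf ?p n * phi_qs L a \<alpha> n 0) \<le> 1"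
      using measure_pmf.prob_le_1[of ?p F] by linarith
  qed
qed

lemma ratio_change:
  fixes x0 x1 y0 y1 :: real
  assumes "0 \<le> x0" "0 \<le> x1" "1 \<le> x0 + x1" "1 \<le> y0 + y1"
  shows "\<bar>y0 / (y0 + y1) - x0 / (x0 + x1)\<bar> \<le> (\<bar>y0 - x0\<bar> + \<bar>y1 - x1\<bar>) / (y0 + y1)"
proof -
  let ?X = "x0 + x1" and ?Y = "y0 + y1"
  have "y0 / ?Y - x0 / ?X = ((y0 - x0) * x1 - x0 * (y1 - x1)) / (?Y * ?X)"
    using assms by (simp add: diff_frac_eq algebra_simps)
  also have "\<bar>\<dots>\<bar> \<le> ((\<bar>y0 - x0\<bar> + \<bar>y1 - x1\<bar>) * ?X) / (?Y * ?X)"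
  proof -
    have "\<bar>(y0 - x0) * x1 - x0 * (y1 - x1)\<bar> \<le> \<bar>y0 - x0\<bar> * x1 + x0 * \<bar>y1 - x1\<bar>"
      using assms by (intro order_trans[OF abs_triangle_ineq4]) (simp add: abs_mult)
    also have "\<dots> \<le> \<bar>y0 - x0\<bar> * ?X + ?X * \<bar>y1 - x1\<bar>"
      using assms by (intro add_mono mult_left_mono mult_right_mono) auto
    also have "\<dots> = (\<bar>y0 - x0\<bar> + \<bar>y1 - x1\<bar>) * ?X" by (simp add: algebra_simps)
    finally have le: "\<bar>(y0 - x0) * x1 - x0 * (y1 - x1)\<bar> \<le> (\<bar>y0 - x0\<bar> + \<bar>y1 - x1\<bar>) * ?X" .
    have YX: "0 < ?Y * ?X" using assms by (intro mult_pos_pos) auto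
    show ?thesis
      unfolding abs_divide abs_of_pos[OF YX] using YX by (intro divide_right_mono le) simp
  qed
  also have "\<dots> = (\<bar>y0 - x0\<bar> + \<bar>y1 - x1\<bar>) / ?Y" using assms by simp
  finally show ?thesis .
qed

lemma exp_le_quadratic:
  fixes s :: real
  assumes "0 \<le> s" "s \<le> 1"
  shows "exp s - 1 \<le> s + s\<^sup>2" "exp (- s) - 1 \<le> - s + s\<^sup>2" "exp s \<le> 3"
proof -
  show 1: "exp s - 1 \<le> s + s\<^sup>2" using exp_bound[OF assms] by simp
  have "exp (- s) \<le> 1 - s + s\<^sup>2"
  proof -
    have "1 \<le> (1 - s + s\<^sup>2) * (1 + s)" using assms by (simp add: power2_eq_square algebra_simps)
    also have "\<dots> \<le> (1 - s + s\<^sup>2) * exp s"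
      using assms exp_ge_add_one_self[of s] by (intro mult_left_mono) auto
    finally show ?thesis by (simp add: exp_minus field_simps)
  qed
  then show "exp (- s) - 1 \<le> - s + s\<^sup>2" by simp
  have "s\<^sup>2 \<le> 1" using assms by (simp add: power_le_one)
  then show "exp s \<le> 3" using 1 assms by linarith
qed

text \<open>
  In this locale \<open>S\<close>, \<open>D\<close> and \<open>G\<close> belong to the network, \<open>S'\<close> and \<open>D'\<close> to the quasi-stationary process.
  Of the populations of classes \<open>0\<close> and \<open>1\<close>, the other classes only see the \<open>share\<close> of class \<open>0\<close> on the
  first link; the \<open>tail\<close> of a state keeps the populations of classes \<open>2..L\<close>.
\<close>

locale linear_network =
  fixes L :: nat and lam mu a :: "nat \<Rightarrow> real"
  assumes L: "2 \<le> L"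
    and lam: "\<And>k. k \<le> L \<Longrightarrow> 0 < lam k"
    and mu: "\<And>k. k \<le> L \<Longrightarrow> 0 < mu k"
    and a: "\<And>k. k \<le> L \<Longrightarrow> 0 < a k"
begin

abbreviation S where "S \<equiv> populations {0..L}"
abbreviation S' where "S' \<equiv> populations {2..L}"
abbreviation D where "D \<equiv> \<lambda>n k. mu k * phi L a n k"
abbreviation D' where "D' \<equiv> \<lambda>\<alpha> n k. mu k * phi_qs L a \<alpha> n k"
abbreviation G where "G \<equiv> gen {0..L} lam D"

text \<open>
  The demand on the first link; the link is saturated if it is at least \<open>1\<close>.
\<close>

definition weight :: "(nat \<Rightarrow> nat) \<Rightarrow> real" where
  "weight n = a 0 * real (n 0) + a 1 * real (n 1)"

definition share :: "(nat \<Rightarrow> nat) \<Rightarrow> real" where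
  "share n = theta0 (\<lambda>j. a j * real (n j)) 1"

definition tail :: "(nat \<Rightarrow> nat) \<Rightarrow> nat \<Rightarrow> nat" where
  "tail n = (\<lambda>k. if 2 \<le> k then n k else 0)"

lemma network_phi_bounds: "n \<in> S \<Longrightarrow> k \<le> L \<Longrightarrow> 0 \<le> phi L a n k \<and> phi L a n k \<le> 1"
  using L a by (intro phi_bounds) auto

lemma D_bounds: "n \<in> S \<Longrightarrow> k \<le> L \<Longrightarrow> 0 \<le> D n k \<and> D n k \<le> mu k"
  using network_phi_bounds[of n k] mu[of k] by (simp add: mult_left_le)

lemma D_zero: "n k = 0 \<Longrightarrow> D n k = 0"
  by (simp add: phi_eq_0)

lemma sum_split: "(\<Sum>k\<in>{0..L}. f k) = f 0 + f 1 + (\<Sum>k\<in>{2..L}. f k :: real)"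
proof -
  have "{0..L} = insert 0 (insert 1 {2..L})" using L by auto
  then show ?thesis by simp
qed

lemma weight_nonneg: "0 \<le> a 0 * real (n 0)" "0 \<le> a 1 * real (n 1)"
  using a[of 0] a[of 1] L by auto

lemma access_rates_nonneg: "n \<in> S \<Longrightarrow> 0 \<le> a j * real (n j)"
  using a[of j] by (cases "j \<le> L") (auto simp: populations_def less_imp_le)

lemma share_in_unit_interval: "n \<in> S \<Longrightarrow> 0 \<le> share n \<and> share n \<le> 1"
  unfolding share_def using theta0_nonneg theta0_le_1[of _ 0] access_rates_nonneg by (simp only: One_nat_def)

lemma share_eq: "1 \<le> weight n \<Longrightarrow> share n = a 0 * real (n 0) / weight n"
  using min_div_eq_capped_share[OF weight_nonneg[of n]] by (simp add: share_def weight_def max_def)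

lemma phi_1:
  assumes "1 \<le> weight n"
  shows "phi L a n 1 = 1 - share n"
proof -
  have "phi L a n 1 = a 1 * real (n 1) / weight n"
    using min_div_eq_capped_share[OF weight_nonneg(2)[of n] weight_nonneg(1)[of n]] assms
    by (simp add: phi_def psi_def weight_def max_def add.commute)
  then show ?thesis using assms by (simp add: share_eq weight_def field_simps)
qed

lemma tail_S': "n \<in> S \<Longrightarrow> tail n \<in> S'"
  by (auto simp: tail_def populations_def)

lemma phi_eq_phi_qs_tail:
  assumes "k = 0 \<or> 2 \<le> k"
  shows "phi L a n k = phi_qs L a (share n) (tail n) k"
  using phi_eq_phi_qs[of L k a n] phi_qs_cong[of n "tail n" k L a "share n"] assms L
  by (simp add: share_def tail_def)

lemma tail_inc_dec:
  "2 \<le> k \<Longrightarrow> tail (inc k n) = inc k (tail n)" "2 \<le> k \<Longrightarrow> tail (dec k n) = dec k (tail n)"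
  "k \<le> 1 \<Longrightarrow> tail (inc k n) = tail n" "k \<le> 1 \<Longrightarrow> tail (dec k n) = tail n"
  by (auto simp: tail_def)

lemma share_inc_dec: "2 \<le> k \<Longrightarrow> share (inc k n) = share n" "2 \<le> k \<Longrightarrow> share (dec k n) = share n"
  by (auto simp: share_def)

lemma share_neighbour:
  assumes "1 \<le> weight n" "1 \<le> weight (inc k n)" "1 \<le> weight (dec k n)" "k \<le> 1"
  shows "\<bar>share (inc k n) - share n\<bar> \<le> (a 0 + a 1) / weight (inc k n)"
    "\<bar>share (dec k n) - share n\<bar> \<le> (a 0 + a 1) / weight (dec k n)"
proof -
  have a01: "0 < a 0" "0 < a 1" using a L by auto
  have k: "k = 0 \<or> k = 1" using assms(4) by auto
  have change: "\<bar>share n' - share n\<bar> \<le> (a 0 + a 1) / weight n'"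
    if n': "1 \<le> weight n'" and le: "\<bar>a 0 * real (n' 0) - a 0 * real (n 0)\<bar> + \<bar>a 1 * real (n' 1) - a 1 * real (n 1)\<bar> \<le> a 0 + a 1" for n'
  proof -
    have "\<bar>share n' - share n\<bar> \<le> (\<bar>a 0 * real (n' 0) - a 0 * real (n 0)\<bar> + \<bar>a 1 * real (n' 1) - a 1 * real (n 1)\<bar>) / weight n'"
      using ratio_change[OF weight_nonneg[of n], of "a 0 * real (n' 0)" "a 1 * real (n' 1)"] assms(1) n'
      by (simp add: share_eq) (simp add: weight_def)
    also have "\<dots> \<le> (a 0 + a 1) / weight n'" using le n' by (intro divide_right_mono) auto
    finally show ?thesis .
  qed
  have real_dec: "\<bar>real (i - Suc 0) - real i\<bar> \<le> 1" for i by (cases i) auto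
  have scaled: "\<bar>c * real (i - Suc 0) - c * real i\<bar> \<le> c" if "0 < c" for c i
    using mult_left_mono[OF real_dec[of i], of c] that by (simp add: right_diff_distrib[symmetric] abs_mult)
  show "\<bar>share (inc k n) - share n\<bar> \<le> (a 0 + a 1) / weight (inc k n)"
    using k a01 by (intro change assms) (auto simp: distrib_left)
  show "\<bar>share (dec k n) - share n\<bar> \<le> (a 0 + a 1) / weight (dec k n)"
    using k a01 scaled[OF a01(1), of "n 0"] scaled[OF a01(2), of "n 1"] by (intro change assms) auto
qed

lemma weight_ge:
  "min (a 0) (a 1) * (real (n 0) + real (n 1)) \<le> weight n"
  by (auto simp: weight_def distrib_left intro!: add_mono mult_right_mono)

text \<open>
  Arrivals and departures in the tail turn the corrector \<open>h\<close> into \<open>u - phi0\<close>, which replaces the actual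
  service rate \<open>phi0\<close> of class \<open>0\<close> by \<open>u\<close>. The price is twofold: the second-order terms of the
  exponential, proportional to \<open>s\<close>, and the changes of \<open>h\<close> caused by transitions of classes \<open>0\<close> and \<open>1\<close>,
  proportional to the variation \<open>\<tau>\<close> of the share.
\<close>

lemma class_0_drift:
  fixes h u :: "real \<Rightarrow> (nat \<Rightarrow> nat) \<Rightarrow> real" and s \<Lambda> H \<tau> :: real
  assumes h: "\<And>\<alpha> n. 0 \<le> \<alpha> \<Longrightarrow> \<alpha> \<le> 1 \<Longrightarrow> n \<in> S' \<Longrightarrow> 0 \<le> h \<alpha> n \<and> h \<alpha> n \<le> H"
    and lip: "\<And>\<alpha> \<beta> n. 0 \<le> \<alpha> \<Longrightarrow> \<alpha> \<le> 1 \<Longrightarrow> 0 \<le> \<beta> \<Longrightarrow> \<beta> \<le> 1 \<Longrightarrow> n \<in> S' \<Longrightarrow> \<bar>h \<alpha> n - h \<beta> n\<bar> \<le> \<Lambda> * \<bar>\<alpha> - \<beta>\<bar>"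
    and poisson: "\<And>\<alpha> n. 0 \<le> \<alpha> \<Longrightarrow> \<alpha> \<le> 1 \<Longrightarrow> n \<in> S' \<Longrightarrow>
      phi_qs L a \<alpha> n 0 + gen {2..L} lam (D' \<alpha>) (h \<alpha>) n = u \<alpha> n"
    and \<Lambda>: "0 \<le> \<Lambda>" and H: "0 \<le> H" and s: "0 < s" "s \<le> 1" and \<tau>: "0 \<le> \<tau>"
    and n: "n \<in> S"
    and near: "\<And>k. k \<le> 1 \<Longrightarrow> \<bar>share (inc k n) - share n\<bar> \<le> \<tau> \<and> \<bar>share (dec k n) - share n\<bar> \<le> \<tau>"
  defines "F \<equiv> \<lambda>n. exp (- s * real (n 0)) * (1 + s * mu 0 * h (share n) (tail n))"
  shows "G F n \<le> s * exp (- s * real (n 0)) *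
    (mu 0 * u (share n) (tail n) - lam 0 + s * (lam 0 + mu 0 * (1 + 2 * mu 0 * H)) +
      \<tau> * (mu 0 * \<Lambda> * (lam 0 + 3 * mu 0 + lam 1 + mu 1)))"
proof -
  define A where "A = (\<lambda>n. 1 + s * mu 0 * h (share n) (tail n))"
  define E where "E = exp (- s * real (n 0))"
  \<comment> \<open>bound for the change of \<open>A\<close> in one transition of class \<open>0\<close> or \<open>1\<close>\<close>
  define e where "e = s * mu 0 * \<Lambda> * \<tau>"
  let ?\<alpha> = "share n" and ?t = "tail n"
  have F: "F m = exp (- s * real (m 0)) * A m" for m by (simp add: F_def A_def)
  have E: "0 < E" by (simp add: E_def)
  have pos: "0 < mu 0" "0 < mu 1" "0 < lam 0" "0 < lam 1" using mu lam L by auto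
  have e: "0 \<le> e" unfolding e_def using s pos \<Lambda> \<tau> by simp
  have \<alpha>: "0 \<le> ?\<alpha>" "?\<alpha> \<le> 1" and t: "?t \<in> S'" using share_in_unit_interval tail_S' n by auto
  have s0: "0 \<le> s" using s by simp
  have A: "1 \<le> A n" "A n \<le> 1 + s * mu 0 * H"
    using h[OF \<alpha> t] s pos by (auto simp: A_def)
  have A_change: "\<bar>A m - A n\<bar> \<le> e" if m: "m \<in> S" "tail m = ?t" "\<bar>share m - ?\<alpha>\<bar> \<le> \<tau>" for m
  proof -
    have "\<bar>h (share m) ?t - h ?\<alpha> ?t\<bar> \<le> \<Lambda> * \<bar>share m - ?\<alpha>\<bar>"
      using share_in_unit_interval[OF m(1)] \<alpha> t by (intro lip) auto
    also have "\<dots> \<le> \<Lambda> * \<tau>" using m(3) \<Lambda> by (rule mult_left_mono)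
    finally have "s * mu 0 * \<bar>h (share m) ?t - h ?\<alpha> ?t\<bar> \<le> s * mu 0 * (\<Lambda> * \<tau>)"
      using s pos by (intro mult_left_mono) auto
    moreover have "A m - A n = s * mu 0 * (h (share m) ?t - h ?\<alpha> ?t)"
      by (simp add: A_def m(2) right_diff_distrib)
    ultimately show ?thesis using s pos by (simp add: e_def abs_mult mult.assoc)
  qed
  have Ai: "\<bar>A (inc k n) - A n\<bar> \<le> e" and Ad: "\<bar>A (dec k n) - A n\<bar> \<le> e" if "k \<le> 1" for k
    using that near[OF that] L n tail_inc_dec[of k n] by (auto intro!: A_change inc_populations dec_populations)
  have inc0: "lam 0 * (F (inc 0 n) - F n) \<le> E * (lam 0 * (- s + s\<^sup>2 + e))"
  proof -
    have "F (inc 0 n) - F n = E * (exp (- s) * (A (inc 0 n) - A n) + (exp (- s) - 1) * A n)"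
      by (simp add: F E_def algebra_simps exp_add[symmetric])
    also have "\<dots> \<le> E * (e + (- s + s\<^sup>2))"
    proof (intro mult_left_mono add_mono)
      have "exp (- s) * (A (inc 0 n) - A n) \<le> exp (- s) * e"
        using Ai[of 0] by (intro mult_left_mono) auto
      also have "\<dots> \<le> 1 * e" using s e by (intro mult_right_mono) auto
      finally show "exp (- s) * (A (inc 0 n) - A n) \<le> e" by simp
      have "(exp (- s) - 1) * A n \<le> (exp (- s) - 1) * 1" using A s by (intro mult_left_mono_neg) auto
      also have "\<dots> \<le> - s + s\<^sup>2" unfolding mult_1_right by (rule exp_le_quadratic(2)[OF s0 s(2)])
      finally show "(exp (- s) - 1) * A n \<le> - s + s\<^sup>2" .
    qed (use E in simp)
    finally show ?thesis using mult_left_mono[of _ _ "lam 0"] pos by (simp add: mult.left_commute add.commute)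
  qed
  have dec0: "D n 0 * (F (dec 0 n) - F n) \<le> E * (mu 0 * (phi L a n 0 * (s + s * (s * (1 + 2 * mu 0 * H))) + 3 * e))"
  proof (cases "n 0 = 0")
    case True
    then show ?thesis using D_zero[of n 0] E pos e by (simp add: phi_eq_0)
  next
    case False
    then have "real (n 0 - Suc 0) = real (n 0) - 1" by simp
    then have "F (dec 0 n) - F n = E * (exp s * (A (dec 0 n) - A n) + (exp s - 1) * A n)"
      by (simp add: F E_def algebra_simps exp_add[symmetric])
    also have "\<dots> \<le> E * (3 * e + (s + s * (s * (1 + 2 * mu 0 * H))))"
    proof (intro mult_left_mono add_mono)
      have "exp s * (A (dec 0 n) - A n) \<le> exp s * e" using Ad[of 0] by (intro mult_left_mono) auto
      also have "\<dots> \<le> 3 * e" using exp_le_quadratic(3)[OF s0 s(2)] s e by (intro mult_right_mono) auto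
      finally show "exp s * (A (dec 0 n) - A n) \<le> 3 * e" .
      have "(exp s - 1) * A n \<le> (s + s\<^sup>2) * (1 + s * mu 0 * H)"
        using A s exp_le_quadratic(1)[OF s0 s(2)] by (intro mult_mono) auto
      also have "\<dots> = s + s * (s * (1 + mu 0 * H + s * (mu 0 * H)))"
        by (simp add: power2_eq_square algebra_simps)
      also have "\<dots> \<le> s + s * (s * (1 + mu 0 * H + 1 * (mu 0 * H)))"
        using s pos H by (intro add_left_mono mult_left_mono mult_right_mono) auto
      finally show "(exp s - 1) * A n \<le> s + s * (s * (1 + 2 * mu 0 * H))" by (simp add: algebra_simps)
    qed (use E in simp)
    finally have "D n 0 * (F (dec 0 n) - F n) \<le> D n 0 * (E * (3 * e + (s + s * (s * (1 + 2 * mu 0 * H)))))"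
      using D_bounds[OF n, of 0] by (intro mult_left_mono) auto
    also have "\<dots> = E * (mu 0 * (phi L a n 0 * (s + s * (s * (1 + 2 * mu 0 * H))) + phi L a n 0 * (3 * e)))"
      by (simp add: algebra_simps)
    also have "\<dots> \<le> E * (mu 0 * (phi L a n 0 * (s + s * (s * (1 + 2 * mu 0 * H))) + 1 * (3 * e)))"
      using network_phi_bounds[OF n, of 0] L e pos E by (intro mult_left_mono add_left_mono mult_right_mono) auto
    finally show ?thesis by simp
  qed
  have inc1: "lam 1 * (F (inc 1 n) - F n) \<le> E * (lam 1 * e)"
  proof -
    have "F (inc 1 n) - F n = E * (A (inc 1 n) - A n)" by (simp add: F E_def right_diff_distrib)
    also have "\<dots> \<le> E * e" using Ai[of 1] E by (intro mult_left_mono) auto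
    finally show ?thesis using mult_left_mono[of _ _ "lam 1"] pos by (simp add: mult.left_commute)
  qed
  have dec1: "D n 1 * (F (dec 1 n) - F n) \<le> E * (mu 1 * e)"
  proof -
    have "F (dec 1 n) - F n = E * (A (dec 1 n) - A n)" by (simp add: F E_def right_diff_distrib)
    also have "\<dots> \<le> E * e" using Ad[of 1] E by (intro mult_left_mono) auto
    finally have "D n 1 * (F (dec 1 n) - F n) \<le> D n 1 * (E * e)"
      using D_bounds[OF n, of 1] L by (intro mult_left_mono) auto
    also have "\<dots> \<le> mu 1 * (E * e)" using D_bounds[OF n, of 1] L E e by (intro mult_right_mono) auto
    finally show ?thesis by (simp add: mult.left_commute)
  qed
  have tail_part: "(\<Sum>k\<in>{2..L}. lam k * (F (inc k n) - F n)) + (\<Sum>k\<in>{2..L}. D n k * (F (dec k n) - F n)) =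
     E * (s * mu 0 * (u ?\<alpha> ?t - phi L a n 0))"
  proof -
    have "(\<Sum>k\<in>{2..L}. lam k * (F (inc k n) - F n)) = (\<Sum>k\<in>{2..L}. E * (s * mu 0) * (lam k * (h ?\<alpha> (inc k ?t) - h ?\<alpha> ?t)))"
      by (intro sum.cong) (auto simp: F A_def E_def tail_inc_dec share_inc_dec algebra_simps)
    moreover have "(\<Sum>k\<in>{2..L}. D n k * (F (dec k n) - F n)) = (\<Sum>k\<in>{2..L}. E * (s * mu 0) * (D' ?\<alpha> ?t k * (h ?\<alpha> (dec k ?t) - h ?\<alpha> ?t)))"
      by (intro sum.cong) (auto simp: F A_def E_def tail_inc_dec share_inc_dec phi_eq_phi_qs_tail algebra_simps)
    ultimately have "(\<Sum>k\<in>{2..L}. lam k * (F (inc k n) - F n)) + (\<Sum>k\<in>{2..L}. D n k * (F (dec k n) - F n)) =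
       E * (s * mu 0) * gen {2..L} lam (D' ?\<alpha>) (h ?\<alpha>) ?t"
      by (simp only: gen_def sum_distrib_left distrib_left)
    also have "gen {2..L} lam (D' ?\<alpha>) (h ?\<alpha>) ?t = u ?\<alpha> ?t - phi L a n 0"
      using poisson[OF \<alpha> t] phi_eq_phi_qs_tail[of 0 n] by simp
    finally show ?thesis by (simp only: mult.assoc[of E "s * mu 0"])
  qed
  have "G F n = lam 0 * (F (inc 0 n) - F n) + lam 1 * (F (inc 1 n) - F n) + D n 0 * (F (dec 0 n) - F n) + D n 1 * (F (dec 1 n) - F n)
    + ((\<Sum>k\<in>{2..L}. lam k * (F (inc k n) - F n)) + (\<Sum>k\<in>{2..L}. D n k * (F (dec k n) - F n)))"
    unfolding gen_def sum_split by simp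
  also have "\<dots> \<le> E * (lam 0 * (- s + s\<^sup>2 + e)) + E * (lam 1 * e)
    + E * (mu 0 * (phi L a n 0 * (s + s * (s * (1 + 2 * mu 0 * H))) + 3 * e)) + E * (mu 1 * e)
    + E * (s * mu 0 * (u ?\<alpha> ?t - phi L a n 0))"
    unfolding tail_part by (intro add_mono inc0 inc1 dec0 dec1 order_refl)
  also have "\<dots> = s * E * (mu 0 * u ?\<alpha> ?t - lam 0 + s * (lam 0 + phi L a n 0 * (mu 0 * (1 + 2 * mu 0 * H)))
    + \<tau> * (mu 0 * \<Lambda> * (lam 0 + 3 * mu 0 + lam 1 + mu 1)))"
    by (simp add: e_def power2_eq_square algebra_simps)
  also have "\<dots> \<le> s * E * (mu 0 * u ?\<alpha> ?t - lam 0 + s * (lam 0 + 1 * (mu 0 * (1 + 2 * mu 0 * H)))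
    + \<tau> * (mu 0 * \<Lambda> * (lam 0 + 3 * mu 0 + lam 1 + mu 1)))"
    using network_phi_bounds[OF n, of 0] L s E pos H
    by (intro mult_left_mono add_mono mult_right_mono order_refl) auto
  finally show ?thesis by (simp add: E_def)
qed

lemma class_1_drift:
  fixes \<sigma> :: real
  assumes \<sigma>: "0 < \<sigma>" "\<sigma> \<le> 1" and n: "n \<in> S"
  defines "F \<equiv> \<lambda>n :: nat \<Rightarrow> nat. exp (- \<sigma> * real (n 1))"
  shows "G F n \<le> \<sigma> * exp (- \<sigma> * real (n 1)) * (mu 1 * phi L a n 1 - lam 1 + \<sigma> * (lam 1 + mu 1))"
proof -
  have pos: "0 < mu 1" "0 < lam 1" using mu lam L by auto
  have F0: "0 < F n" by (simp add: F_def)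
  have phi: "0 \<le> phi L a n 1" "phi L a n 1 \<le> 1" using network_phi_bounds[OF n, of 1] L by auto
  have "G F n = lam 1 * (F (inc 1 n) - F n) + D n 1 * (F (dec 1 n) - F n)"
    using L by (intro gen_single_coordinate) (auto simp: F_def)
  also have "F (inc 1 n) - F n = F n * (exp (- \<sigma>) - 1)"
    by (simp add: F_def algebra_simps exp_add[symmetric])
  also have "lam 1 * (F n * (exp (- \<sigma>) - 1)) \<le> lam 1 * (F n * (- \<sigma> + \<sigma>\<^sup>2))"
    using exp_le_quadratic(2)[of \<sigma>] \<sigma> pos F0 by (intro mult_left_mono) auto
  also have "D n 1 * (F (dec 1 n) - F n) \<le> D n 1 * (F n * (\<sigma> + \<sigma>\<^sup>2))"
  proof (cases "n 1 = 0")
    case True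
    then have "D n 1 = 0" by (rule D_zero)
    then show ?thesis by (simp only: mult_zero_left order_refl)
  next
    case False
    then have "real (n 1 - Suc 0) = real (n 1) - 1" by simp
    then have "F (dec 1 n) - F n = F n * (exp \<sigma> - 1)"
      by (simp add: F_def algebra_simps exp_add[symmetric])
    also have "\<dots> \<le> F n * (\<sigma> + \<sigma>\<^sup>2)" using exp_le_quadratic(1)[of \<sigma>] \<sigma> F0 by (intro mult_left_mono) auto
    finally show ?thesis using D_bounds[OF n, of 1] L by (intro mult_left_mono) auto
  qed
  also have "lam 1 * (F n * (- \<sigma> + \<sigma>\<^sup>2)) + D n 1 * (F n * (\<sigma> + \<sigma>\<^sup>2)) =
      \<sigma> * F n * (mu 1 * phi L a n 1 - lam 1 + \<sigma> * (lam 1 + phi L a n 1 * mu 1))"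
    by (simp add: power2_eq_square algebra_simps)
  also have "\<dots> \<le> \<sigma> * F n * (mu 1 * phi L a n 1 - lam 1 + \<sigma> * (lam 1 + 1 * mu 1))"
    using phi \<sigma> F0 pos by (intro mult_left_mono add_mono mult_right_mono order_refl) auto
  finally show ?thesis by (simp add: F_def)
qed

end

context linear_network
begin

section \<open>Case (ii): averaged drift\<close>

lemma bounded_rates_tail:
  assumes \<alpha>: "0 \<le> \<alpha>" "\<alpha> \<le> 1"
  shows "bounded_rates {2..L} lam (D' \<alpha>) (\<Sum>k\<in>{2..L}. lam k + mu k)"
proof
  have phi: "0 \<le> phi_qs L a \<alpha> n k \<and> phi_qs L a \<alpha> n k \<le> 1" if "n \<in> S'" for n k
    using _ that \<alpha> by (rule phi_qs_bounds) (use a in simp)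
  show "0 \<le> lam k" if "k \<in> {2..L}" for k using lam[of k] that by simp
  show "0 \<le> D' \<alpha> n k" if "n \<in> S'" "k \<in> {2..L}" for n k
    using phi[OF that(1)] mu[of k] that by simp
  show "total_rate {2..L} lam (D' \<alpha>) n \<le> (\<Sum>k\<in>{2..L}. lam k + mu k)" if "n \<in> S'" for n
    unfolding total_rate_def sum.distrib using phi[OF that] mu
    by (intro add_left_mono sum_mono) (auto intro!: mult_left_le less_imp_le)
  show "0 < (\<Sum>k\<in>{2..L}. lam k + mu k)"
    using lam mu L by (intro sum_pos) (auto intro: add_pos_pos)
qed simp

text \<open>
  The corrector is the scaled resolvent of the service rate of class \<open>0\<close>. That \<open>u \<le> \<eta>\<close> extends to
  shares slightly above \<open>c\<close> lets the regions where class \<open>0\<close> and class \<open>1\<close> grow overlap.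
\<close>

lemma corrector:
  assumes c: "0 \<le> c" "c \<le> 1" and \<eta>: "0 \<le> \<eta>0" "\<eta>0 < \<eta>"
    and mean: "\<And>x. x \<in> {0..c} \<Longrightarrow> phi0_bar L lam mu a x \<le> \<eta>0"
  shows "\<exists>\<delta> H \<Lambda> h u. 0 < \<delta> \<and> 0 \<le> H \<and> 0 \<le> \<Lambda> \<and>
    (\<forall>\<alpha> n. 0 \<le> \<alpha> \<longrightarrow> \<alpha> \<le> 1 \<longrightarrow> n \<in> S' \<longrightarrow>
       0 \<le> h \<alpha> n \<and> h \<alpha> n \<le> H \<and> u \<alpha> n \<le> 1 \<and> (\<alpha> \<le> c + \<delta> \<longrightarrow> u \<alpha> n \<le> \<eta>) \<and>
       phi_qs L a \<alpha> n 0 + gen {2..L} lam (D' \<alpha>) (h \<alpha>) n = u \<alpha> n \<and>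
       (\<forall>\<beta>. 0 \<le> \<beta> \<longrightarrow> \<beta> \<le> 1 \<longrightarrow> \<bar>h \<alpha> n - h \<beta> n\<bar> \<le> \<Lambda> * \<bar>\<alpha> - \<beta>\<bar>))"
proof -
  define C where "C = (\<Sum>k\<in>{2..L}. lam k + mu k)"
  have rates: "bounded_rates {2..L} lam (D' \<alpha>) C" if "0 \<le> \<alpha>" "\<alpha> \<le> 1" for \<alpha>
    unfolding C_def by (rule bounded_rates_tail[OF that])
  have C: "0 < C" by (rule bounded_rates.C_pos[OF rates[of 0]]) auto
  have "\<exists>\<gamma> \<delta>. 0 < \<gamma> \<and> \<gamma> < 1 \<and> 0 < \<delta> \<and> (\<forall>\<alpha> n. 0 \<le> \<alpha> \<and> \<alpha> \<le> 1 \<and> \<alpha> \<le> c + \<delta> \<and> n \<in> S' \<longrightarrow>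
    resolvent {2..L} lam (D' \<alpha>) C \<gamma> (\<lambda>n. phi_qs L a \<alpha> n 0) n \<le> \<eta>)"
    by (rule resolvent_le_above_quasi_stationary_mean[OF _ _ _ c \<eta> mean rates])
      (use lam mu a in auto)
  then obtain \<gamma> \<delta> where \<gamma>: "0 < \<gamma>" "\<gamma> < 1" and \<delta>: "0 < \<delta>"
    and le: "\<And>\<alpha> n. 0 \<le> \<alpha> \<and> \<alpha> \<le> 1 \<and> \<alpha> \<le> c + \<delta> \<and> n \<in> S' \<Longrightarrow>
      resolvent {2..L} lam (D' \<alpha>) C \<gamma> (\<lambda>n. phi_qs L a \<alpha> n 0) n \<le> \<eta>"
    by blast
  define B where "B = C * (1 - \<gamma>) / \<gamma>"
  have B: "0 < B" using C \<gamma> by (simp add: B_def)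
  define u where "u = (\<lambda>\<alpha>. resolvent {2..L} lam (D' \<alpha>) C \<gamma> (\<lambda>n. phi_qs L a \<alpha> n 0))"
  define h where "h = (\<lambda>\<alpha> n. (1 / B) * u \<alpha> n + 0)"
  define \<Lambda> where "\<Lambda> = (1 / B) * ((1 + (\<Sum>k\<in>{2..L}. mu k) / C) / (1 - \<gamma>))"
  have phi: "0 \<le> phi_qs L a \<alpha> n k \<and> phi_qs L a \<alpha> n k \<le> 1" if "0 \<le> \<alpha>" "\<alpha> \<le> 1" "n \<in> S'" for \<alpha> n k
    using _ that(3,1,2) by (rule phi_qs_bounds) (use a in simp)
  have u: "0 \<le> u \<alpha> n" "u \<alpha> n \<le> 1" if "0 \<le> \<alpha>" "\<alpha> \<le> 1" "n \<in> S'" for \<alpha> n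
    using bounded_rates.R_bounds[OF rates[OF that(1,2)] \<gamma> _ that(3), of 0 "\<lambda>n. phi_qs L a \<alpha> n 0" 1] phi[OF that(1,2)]
    by (auto simp: u_def)
  have poisson: "phi_qs L a \<alpha> n 0 + gen {2..L} lam (D' \<alpha>) (h \<alpha>) n = u \<alpha> n" if "0 \<le> \<alpha>" "\<alpha> \<le> 1" "n \<in> S'" for \<alpha> n
  proof -
    note r = rates[OF that(1,2)]
    have bd: "bounded_rates.bdd {2..L} (\<lambda>n. phi_qs L a \<alpha> n 0)"
      by (rule bounded_rates.bddI[OF r, of _ 1]) (use phi[OF that(1,2)] in auto)
    have "gen {2..L} lam (D' \<alpha>) (u \<alpha>) n = B * (u \<alpha> n - phi_qs L a \<alpha> n 0)"
      unfolding u_def B_def bounded_rates.G_R[OF r \<gamma> bd that(3)] by (rule bounded_rates.R_G[OF r \<gamma> bd that(3)])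
    moreover have "gen {2..L} lam (D' \<alpha>) (h \<alpha>) n = (1 / B) * gen {2..L} lam (D' \<alpha>) (u \<alpha>) n + gen {2..L} lam (D' \<alpha>) (\<lambda>_. 0) n"
      unfolding h_def by (rule gen_linear)
    ultimately show ?thesis using B by (simp add: gen_const)
  qed
  have lip: "\<bar>h \<alpha> n - h \<beta> n\<bar> \<le> \<Lambda> * \<bar>\<alpha> - \<beta>\<bar>" if "0 \<le> \<alpha>" "\<alpha> \<le> 1" "0 \<le> \<beta>" "\<beta> \<le> 1" "n \<in> S'" for \<alpha> \<beta> n
  proof -
    have phi_lip: "\<bar>phi_qs L a \<alpha> m k - phi_qs L a \<beta> m k\<bar> \<le> \<bar>\<alpha> - \<beta>\<bar>" if "m \<in> S'" for m k
      using _ that \<open>0 \<le> \<alpha>\<close> \<open>\<alpha> \<le> 1\<close> \<open>0 \<le> \<beta>\<close> \<open>\<beta> \<le> 1\<close> by (rule phi_qs_lipschitz) (use a in simp)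
    have "\<bar>u \<alpha> n - u \<beta> n\<bar> \<le> (1 + (\<Sum>k\<in>{2..L}. mu k) / C) / (1 - \<gamma>) * \<bar>\<alpha> - \<beta>\<bar>"
      unfolding u_def
    proof (rule resolvent_lipschitz[OF rates[OF that(1,2)] rates[OF that(3,4)] \<gamma> _ _ _ _ that(5)])
      show "\<bar>D' \<alpha> m k - D' \<beta> m k\<bar> \<le> mu k * \<bar>\<alpha> - \<beta>\<bar>" if "m \<in> S'" "k \<in> {2..L}" for m k
        using mult_left_mono[OF phi_lip[OF that(1), of k], of "mu k"] mu[of k] that
        by (simp add: right_diff_distrib[symmetric] abs_mult)
    qed (use phi that phi_lip in auto)
    then have "(1 / B) * \<bar>u \<alpha> n - u \<beta> n\<bar> \<le> (1 / B) * ((1 + (\<Sum>k\<in>{2..L}. mu k) / C) / (1 - \<gamma>) * \<bar>\<alpha> - \<beta>\<bar>)"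
      using B by (intro mult_left_mono) auto
    moreover have "h \<alpha> n - h \<beta> n = (1 / B) * (u \<alpha> n - u \<beta> n)" by (simp add: h_def diff_divide_distrib)
    ultimately show ?thesis using B by (simp add: \<Lambda>_def abs_mult mult.assoc)
  qed
  have h: "0 \<le> h \<alpha> n" "h \<alpha> n \<le> 1 / B" if "0 \<le> \<alpha>" "\<alpha> \<le> 1" "n \<in> S'" for \<alpha> n
    using u[OF that] B by (simp_all add: h_def divide_right_mono)
  have small: "u \<alpha> n \<le> \<eta>" if "0 \<le> \<alpha>" "\<alpha> \<le> 1" "n \<in> S'" "\<alpha> \<le> c + \<delta>" for \<alpha> n
    unfolding u_def using that by (intro le) auto
  have "0 \<le> (\<Sum>k\<in>{2..L}. mu k)" using mu by (intro sum_nonneg) (auto intro: less_imp_le)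
  then have \<Lambda>: "0 \<le> \<Lambda>" unfolding \<Lambda>_def using B C \<gamma>
    by (intro mult_nonneg_nonneg divide_nonneg_pos add_nonneg_nonneg) auto
  have all: "\<forall>\<alpha> n. 0 \<le> \<alpha> \<longrightarrow> \<alpha> \<le> 1 \<longrightarrow> n \<in> S' \<longrightarrow>
       0 \<le> h \<alpha> n \<and> h \<alpha> n \<le> 1 / B \<and> u \<alpha> n \<le> 1 \<and> (\<alpha> \<le> c + \<delta> \<longrightarrow> u \<alpha> n \<le> \<eta>) \<and>
       phi_qs L a \<alpha> n 0 + gen {2..L} lam (D' \<alpha>) (h \<alpha>) n = u \<alpha> n \<and>
       (\<forall>\<beta>. 0 \<le> \<beta> \<longrightarrow> \<beta> \<le> 1 \<longrightarrow> \<bar>h \<alpha> n - h \<beta> n\<bar> \<le> \<Lambda> * \<bar>\<alpha> - \<beta>\<bar>)"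
    by (intro allI impI conjI h u(2) small poisson lip)
  have B0: "0 \<le> 1 / B" using B by simp
  show ?thesis
    by (rule exI[of _ \<delta>], rule exI[of _ "1 / B"], rule exI[of _ \<Lambda>], rule exI[of _ h], rule exI[of _ u])
      (rule conjI[OF \<delta> conjI[OF B0 conjI[OF \<Lambda> all]]])
qed

text \<open>
  With \<open>c = 1 - \<rho> 1\<close>, class \<open>0\<close> grows where the share is at most \<open>c + \<delta>\<close> and class \<open>1\<close> where it is at
  least \<open>c + \<delta> / 2\<close>. The slope \<open>r\<close> makes the two exponentials \<open>E0\<close> and \<open>E1\<close> equal at the share \<open>p\<close> in the
  middle of the overlap. Outside of the overlap the exponential of the class that may shrink is
  smaller than the other one by an arbitrarily small factor \<open>\<kappa>\<close>, provided that the demand on the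
  first link is large. The constants are chosen in the order \<open>\<eta>\<close>, \<open>\<delta>\<close>, \<open>\<tau>\<close>, \<open>s\<close>, \<open>\<kappa>\<close> and finally the population
  size \<open>B\<close> beyond which the drift is negative.
\<close>

lemma averaged_drift:
  assumes \<rho>1: "lam 1 < mu 1" and \<rho>0: "lam 0 < mu 0"
    and sup: "(SUP x\<in>{0..1 - lam 1 / mu 1}. phi0_bar L lam mu a x) < lam 0 / mu 0"
  shows "\<exists>g B \<epsilon>. 0 < \<epsilon> \<and> (\<forall>n\<in>S. 0 < g n \<and> g n \<le> B \<and> G g n \<le> - \<epsilon> * (g n :: real))"
proof -
  have pos: "0 < mu 0" "0 < mu 1" "0 < lam 0" "0 < lam 1" "0 < a 0" "0 < a 1" using mu lam a L by auto
  define c where "c = 1 - lam 1 / mu 1"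
  have c: "0 < c" "c < 1" using \<rho>1 pos by (simp_all add: c_def)
  have c_mu: "mu 1 * (1 - c) = lam 1" using pos by (simp add: c_def)
  define \<eta>0 where "\<eta>0 = (SUP x\<in>{0..c}. phi0_bar L lam mu a x)"
  have a': "\<And>k. k \<in> {2..L} \<Longrightarrow> 0 < a k" using a by simp
  have mean: "phi0_bar L lam mu a x \<le> \<eta>0" if "x \<in> {0..c}" for x
    unfolding \<eta>0_def
  proof (rule cSUP_upper[OF that])
    show "bdd_above (phi0_bar L lam mu a ` {0..c})"
      using phi0_bar_bounds(2)[where L=L and a=a, OF a'] c by (intro bdd_aboveI[of _ 1]) auto
  qed
  have "0 \<le> phi0_bar L lam mu a 0" using phi0_bar_bounds(1)[where L=L and a=a, OF a'] by simp
  also have "\<dots> \<le> \<eta>0" using c by (intro mean) auto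
  finally have \<eta>0: "0 \<le> \<eta>0" .
  define \<eta> where "\<eta> = (\<eta>0 + lam 0 / mu 0) / 2"
  have half: "x < (x + y) / 2" "(x + y) / 2 < y" if "x < y" for x y :: real using that by simp_all
  have "\<eta>0 < lam 0 / mu 0" using sup by (simp only: \<eta>0_def c_def)
  from half[OF this] have \<eta>: "\<eta>0 < \<eta>" "\<eta> < lam 0 / mu 0" by (simp_all only: \<eta>_def)
  obtain \<delta>0 H \<Lambda> h u where \<delta>0: "0 < \<delta>0" and H: "0 \<le> H" and \<Lambda>: "0 \<le> \<Lambda>"
    and all: "\<forall>\<alpha> n. 0 \<le> \<alpha> \<longrightarrow> \<alpha> \<le> 1 \<longrightarrow> n \<in> S' \<longrightarrow>
       0 \<le> h \<alpha> n \<and> h \<alpha> n \<le> H \<and> u \<alpha> n \<le> 1 \<and> (\<alpha> \<le> c + \<delta>0 \<longrightarrow> u \<alpha> n \<le> \<eta>) \<and>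
       phi_qs L a \<alpha> n 0 + gen {2..L} lam (D' \<alpha>) (h \<alpha>) n = u \<alpha> n \<and>
       (\<forall>\<beta>. 0 \<le> \<beta> \<longrightarrow> \<beta> \<le> 1 \<longrightarrow> \<bar>h \<alpha> n - h \<beta> n\<bar> \<le> \<Lambda> * \<bar>\<alpha> - \<beta>\<bar>)"
    using corrector[OF less_imp_le[OF c(1)] less_imp_le[OF c(2)] \<eta>0 \<eta>(1) mean] by blast
  define \<delta> where "\<delta> = min \<delta>0 ((1 - c) / 2)"
  have \<delta>: "0 < \<delta>" "\<delta> \<le> \<delta>0" "c + \<delta> < 1" using \<delta>0 c by (auto simp: \<delta>_def min_def field_simps)
  define p where "p = c + 3 * \<delta> / 4"
  have p: "0 < p" "p < 1" using c \<delta> by (auto simp: p_def)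
  define K1 where "K1 = lam 0 + mu 0 * (1 + 2 * mu 0 * H)"
  define K2 where "K2 = mu 0 * \<Lambda> * (lam 0 + 3 * mu 0 + lam 1 + mu 1)"
  have K: "0 < K1" "0 \<le> K2" using pos H \<Lambda> by (auto simp: K1_def K2_def intro!: add_pos_nonneg mult_nonneg_nonneg add_nonneg_nonneg)
  define c0 where "c0 = (lam 0 - mu 0 * \<eta>) / 2"
  have c0: "0 < c0" "c0 \<le> lam 0" "mu 0 * \<eta> - lam 0 = - 2 * c0"
  proof -
    have "mu 0 * \<eta> < lam 0" using \<eta>(2) pos by (simp add: field_simps)
    then show "0 < c0" by (simp add: c0_def)
    have "0 \<le> mu 0 * \<eta>" using \<eta> \<eta>0 pos by simp
    then show "c0 \<le> lam 0" using pos by (simp add: c0_def)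
    show "mu 0 * \<eta> - lam 0 = - 2 * c0" by (simp add: c0_def)
  qed
  define c1 where "c1 = mu 1 * \<delta> / 4"
  have c1: "0 < c1" using pos \<delta> by (simp add: c1_def)
  define \<tau> where "\<tau> = c0 / (2 * (K2 + 1))"
  have \<tau>: "0 < \<tau>" "\<tau> * K2 \<le> c0 / 2" using c0 K by (auto simp: \<tau>_def field_simps)
  define r where "r = a 1 * p / (a 0 * (1 - p))"
  have r: "0 < r" using pos p by (simp add: r_def)
  define s where "s = min (min 1 (1 / r)) (min (c0 / (2 * K1)) (c1 / (r * (lam 1 + mu 1))))"
  have s: "0 < s" "s \<le> 1" "s \<le> 1 / r" "s \<le> c0 / (2 * K1)" "s \<le> c1 / (r * (lam 1 + mu 1))"
    using r c0 c1 K pos by (auto simp: s_def)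
  define \<sigma> where "\<sigma> = r * s"
  have \<sigma>: "0 < \<sigma>" "\<sigma> \<le> 1" "\<sigma> * (lam 1 + mu 1) \<le> c1" "s * K1 \<le> c0 / 2"
  proof -
    show "0 < \<sigma>" using s r by (simp add: \<sigma>_def)
    show "\<sigma> \<le> 1" using s(3) r by (simp add: \<sigma>_def field_simps)
    have "0 < r * (lam 1 + mu 1)" using r pos by simp
    with s(5) have "s * (r * (lam 1 + mu 1)) \<le> c1" by (simp only: pos_le_divide_eq)
    then show "\<sigma> * (lam 1 + mu 1) \<le> c1" by (simp only: \<sigma>_def mult.assoc mult.left_commute)
    show "s * K1 \<le> c0 / 2" using s(4) K by (simp add: field_simps)
  qed
  define E0 where "E0 = (\<lambda>n :: nat \<Rightarrow> nat. exp (- s * real (n 0)))"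
  define E1 where "E1 = (\<lambda>n :: nat \<Rightarrow> nat. exp (- \<sigma> * real (n 1)))"
  have E: "0 < E0 n" "0 < E1 n" for n by (simp_all add: E0_def E1_def)
  define F0 where "F0 = (\<lambda>n. E0 n * (1 + s * mu 0 * h (share n) (tail n)))"
  define f where "f = (\<lambda>n. F0 n + E1 n)"
  \<comment> \<open>the growing class must outweigh the other one by a factor of two\<close>
  define \<kappa> where "\<kappa> = min 1 (min (\<sigma> * c1 / (2 * (s * mu 0))) (s * c0 / (2 * (\<sigma> * (mu 1 + c1)))))"
  have \<kappa>: "0 < \<kappa>" "\<kappa> \<le> 1" "s * mu 0 * \<kappa> \<le> \<sigma> * c1 / 2" "\<sigma> * (mu 1 + c1) * \<kappa> \<le> s * c0 / 2"
  proof -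
    show "0 < \<kappa>" "\<kappa> \<le> 1" using s \<sigma> c0 c1 pos by (auto simp: \<kappa>_def)
    have clear: "z * x \<le> y / 2" if "x \<le> y / (2 * z)" "0 < z" for x y z :: real
      using that by (simp add: field_simps)
    have le: "\<kappa> \<le> \<sigma> * c1 / (2 * (s * mu 0))" "\<kappa> \<le> s * c0 / (2 * (\<sigma> * (mu 1 + c1)))"
      by (auto simp: \<kappa>_def)
    show "s * mu 0 * \<kappa> \<le> \<sigma> * c1 / 2" by (rule clear[OF le(1)]) (use s pos in simp)
    show "\<sigma> * (mu 1 + c1) * \<kappa> \<le> s * c0 / 2" by (rule clear[OF le(2)]) (use \<sigma> pos c1 in simp)
  qed
  \<comment> \<open>the demand that separates the exponents by \<open>- ln \<kappa>\<close> outside of the overlap, see \<open>gap\<close>\<close>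
  define X where "X = 4 * (- ln \<kappa>) * (a 0 * (1 - p)) / (s * \<delta>)"
  define am where "am = min (a 0) (a 1)"
  have am: "0 < am" using pos by (simp add: am_def)
  \<comment> \<open>the additional unit leaves room for one departure\<close>
  define B where "B = nat \<lceil>(1 + \<bar>X\<bar> + (a 0 + a 1) / \<tau>) / am\<rceil> + 1"
  have far: "1 \<le> weight n" "X \<le> weight n" "(a 0 + a 1) / weight n \<le> \<tau>"
    if "B \<le> n 0 + n 1 + 1" for n
  proof -
    have "(1 + \<bar>X\<bar> + (a 0 + a 1) / \<tau>) / am \<le> real (n 0) + real (n 1)"
      using that unfolding B_def by linarith
    then have "1 + \<bar>X\<bar> + (a 0 + a 1) / \<tau> \<le> am * (real (n 0) + real (n 1))"
      using am by (simp add: field_simps)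
    also have "\<dots> \<le> weight n" unfolding am_def by (rule weight_ge)
    finally have w: "1 + \<bar>X\<bar> + (a 0 + a 1) / \<tau> \<le> weight n" .
    moreover have q: "0 < (a 0 + a 1) / \<tau>" using pos \<tau> by simp
    ultimately show w1: "1 \<le> weight n" and "X \<le> weight n" by linarith+
    have "(a 0 + a 1) / \<tau> \<le> weight n" using w by linarith
    then show "(a 0 + a 1) / weight n \<le> \<tau>" using w1 \<tau> by (simp add: field_simps)
  qed
  have \<alpha>: "0 \<le> share n" "share n \<le> 1" "tail n \<in> S'" if "n \<in> S" for n
    using share_in_unit_interval[OF that] tail_S'[OF that] by auto
  have A: "1 \<le> 1 + s * mu 0 * h (share n) (tail n)" "1 + s * mu 0 * h (share n) (tail n) \<le> 1 + mu 0 * H" if "n \<in> S" for n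
  proof -
    have hb: "0 \<le> h (share n) (tail n)" "h (share n) (tail n) \<le> H" using all \<alpha>[OF that] by auto
    then show "1 \<le> 1 + s * mu 0 * h (share n) (tail n)" using s pos by simp
    have "s * mu 0 * h (share n) (tail n) \<le> 1 * mu 0 * H" using hb s pos by (intro mult_mono) auto
    then show "1 + s * mu 0 * h (share n) (tail n) \<le> 1 + mu 0 * H" by simp
  qed
  have F0: "E0 n \<le> F0 n" "F0 n \<le> E0 n * (1 + mu 0 * H)" if "n \<in> S" for n
    using mult_left_mono[OF A(1)[OF that], of "E0 n"] mult_left_mono[OF A(2)[OF that], of "E0 n"] E[of n]
    by (simp_all add: F0_def)
  have f_le: "f n \<le> (1 + mu 0 * H) * (E0 n + E1 n)" if "n \<in> S" for n
  proof -
    have "1 * E1 n \<le> (1 + mu 0 * H) * E1 n" using E[of n] pos H by (intro mult_right_mono) auto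
    then show ?thesis using F0(2)[OF that] by (simp add: f_def distrib_left mult.commute)
  qed
  define \<epsilon> where "\<epsilon> = min (s * c0) (\<sigma> * c1) / 4"
  have \<epsilon>: "0 < \<epsilon>" using s c0 \<sigma> c1 by (simp add: \<epsilon>_def)
  have drift: "G f n \<le> - \<epsilon> * (E0 n + E1 n)" if n: "n \<in> S" and large: "B \<le> n 0 + n 1" for n
  proof -
    let ?d = "mu 0 * u (share n) (tail n) - lam 0 + s * K1 + \<tau> * K2" and ?e = "mu 1 * (1 - share n) - lam 1 + \<sigma> * (lam 1 + mu 1)"
    let ?q = "s / (a 0 * (1 - p))"
    note \<alpha>n = \<alpha>[OF n]
    have w: "1 \<le> weight n" "X \<le> weight n" using far[of n] large by auto
    have near: "\<bar>share (inc k n) - share n\<bar> \<le> \<tau> \<and> \<bar>share (dec k n) - share n\<bar> \<le> \<tau>" if "k \<le> 1" for k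
    proof -
      have "k = 0 \<or> k = 1" using that by auto
      then have B: "B \<le> (inc k n) 0 + (inc k n) 1 + 1" "B \<le> (dec k n) 0 + (dec k n) 1 + 1"
        using large by auto
      note change = share_neighbour[OF w(1) far(1)[OF B(1)] far(1)[OF B(2)] that]
      show ?thesis
        by (intro conjI order_trans[OF change(1) far(3)[OF B(1)]] order_trans[OF change(2) far(3)[OF B(2)]])
    qed
    have G0: "G F0 n \<le> s * E0 n * ?d"
    proof -
      have "G (\<lambda>n. exp (- s * real (n 0)) * (1 + s * mu 0 * h (share n) (tail n))) n \<le> s * exp (- s * real (n 0)) *
        (mu 0 * u (share n) (tail n) - lam 0 + s * (lam 0 + mu 0 * (1 + 2 * mu 0 * H)) +
        \<tau> * (mu 0 * \<Lambda> * (lam 0 + 3 * mu 0 + lam 1 + mu 1)))"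
        by (rule class_0_drift[OF _ _ _ \<Lambda> H s(1,2) less_imp_le[OF \<tau>(1)] n near]) (use all in auto)
      then show ?thesis by (simp only: F0_def E0_def K1_def K2_def)
    qed
    have err: "s * K1 + \<tau> * K2 \<le> c0" using \<sigma>(4) \<tau>(2) by simp
    have u: "u (share n) (tail n) \<le> 1" "share n \<le> c + \<delta> \<Longrightarrow> u (share n) (tail n) \<le> \<eta>"
      using all \<alpha>n \<delta>(2) by auto
    have G0_any: "G F0 n \<le> s * mu 0 * E0 n"
    proof -
      have "mu 0 * u (share n) (tail n) \<le> mu 0 * 1" using u(1) pos by (intro mult_left_mono) auto
      then have "?d \<le> mu 0" using err c0(2) by linarith
      then have "s * E0 n * ?d \<le> s * E0 n * mu 0"
        using s E[of n] by (intro mult_left_mono) auto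
      then show ?thesis using G0 by (simp add: mult.commute mult.left_commute)
    qed
    have G0_good: "G F0 n \<le> - (s * c0) * E0 n" if "share n \<le> c + \<delta>"
    proof -
      have "mu 0 * u (share n) (tail n) \<le> mu 0 * \<eta>" using u(2)[OF that] pos by (intro mult_left_mono) auto
      then have "?d \<le> - c0" using err c0(3) by linarith
      then have "s * E0 n * ?d \<le> s * E0 n * (- c0)"
        using s E[of n] by (intro mult_left_mono) auto
      then show ?thesis using G0 by (simp add: mult.commute mult.left_commute)
    qed
    have G1: "G E1 n \<le> \<sigma> * E1 n * ?e"
      using class_1_drift[OF \<sigma>(1,2) n] unfolding phi_1[OF w(1)] E1_def by simp
    have G1_any: "G E1 n \<le> \<sigma> * (mu 1 + c1) * E1 n"
    proof -
      have "mu 1 * (1 - share n) \<le> mu 1 * 1" using \<alpha>n pos by (intro mult_left_mono) auto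
      then have "?e \<le> mu 1 + c1" using \<sigma>(3) pos by linarith
      then have "\<sigma> * E1 n * ?e \<le> \<sigma> * E1 n * (mu 1 + c1)"
        using \<sigma> E[of n] by (intro mult_left_mono) auto
      then show ?thesis using G1 by (simp add: mult.commute mult.left_commute)
    qed
    have G1_good: "G E1 n \<le> - (\<sigma> * c1) * E1 n" if "c + \<delta> / 2 \<le> share n"
    proof -
      have "mu 1 * (1 - share n) \<le> mu 1 * (1 - c - \<delta> / 2)" using that pos by (intro mult_left_mono) auto
      also have "\<dots> = lam 1 - 2 * c1" using c_mu by (simp add: c1_def algebra_simps)
      finally have "?e \<le> - c1" using \<sigma>(3) by linarith
      then have "\<sigma> * E1 n * ?e \<le> \<sigma> * E1 n * (- c1)"
        using \<sigma> E[of n] by (intro mult_left_mono) auto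
      then show ?thesis using G1 by (simp add: mult.commute mult.left_commute)
    qed
    have gap: "s * real (n 0) - \<sigma> * real (n 1) = ?q * (weight n * (share n - p))"
    proof -
      have 1: "weight n * share n = a 0 * real (n 0)" using w(1) by (simp add: share_eq)
      have 2: "weight n * (share n - p) = (1 - p) * (a 0 * real (n 0)) - p * (a 1 * real (n 1))"
        unfolding right_diff_distrib 1 by (simp add: weight_def algebra_simps)
      show ?thesis unfolding 2 using pos p by (simp add: \<sigma>_def r_def field_simps)
    qed
    have X: "- ln \<kappa> \<le> ?q * (weight n * (\<delta> / 4))"
    proof -
      have "?q * (X * (\<delta> / 4)) = - ln \<kappa>" using s \<delta> pos p by (simp add: X_def)
      moreover have "?q * (X * (\<delta> / 4)) \<le> ?q * (weight n * (\<delta> / 4))"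
        using w(2) s \<delta> pos p by (intro mult_left_mono mult_right_mono) auto
      ultimately show ?thesis by simp
    qed
    have E01: "E0 n \<le> \<kappa> * E1 n" if "c + \<delta> \<le> share n"
    proof -
      have "?q * (weight n * (\<delta> / 4)) \<le> ?q * (weight n * (share n - p))"
        using that w(1) s pos p by (intro mult_left_mono) (auto simp: p_def)
      then have "- ln \<kappa> \<le> s * real (n 0) - \<sigma> * real (n 1)" using X gap by linarith
      then have "E0 n \<le> exp (ln \<kappa> + - \<sigma> * real (n 1))" by (simp add: E0_def)
      also have "\<dots> = \<kappa> * E1 n" using \<kappa>(1) by (simp only: E1_def exp_add exp_ln)
      finally show ?thesis .
    qed
    have E10: "E1 n \<le> \<kappa> * E0 n" if "share n \<le> c + \<delta> / 2"
    proof -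
      have "?q * (weight n * (\<delta> / 4)) \<le> ?q * (weight n * (p - share n))"
        using that w(1) s pos p by (intro mult_left_mono) (auto simp: p_def)
      also have "\<dots> = - (?q * (weight n * (share n - p)))" by (simp add: algebra_simps)
      finally have "- ln \<kappa> \<le> \<sigma> * real (n 1) - s * real (n 0)" using X gap by linarith
      then have "E1 n \<le> exp (ln \<kappa> + - s * real (n 0))" by (simp add: E1_def)
      also have "\<dots> = \<kappa> * E0 n" using \<kappa>(1) by (simp only: E0_def exp_add exp_ln)
      finally show ?thesis .
    qed
    have \<epsilon>_le: "4 * \<epsilon> \<le> s * c0" "4 * \<epsilon> \<le> \<sigma> * c1" by (auto simp: \<epsilon>_def)
    have G: "G f n = G F0 n + G E1 n" unfolding f_def by (rule gen_add)
    consider "share n \<le> c + \<delta> / 2" | "c + \<delta> / 2 \<le> share n" "share n \<le> c + \<delta>" | "c + \<delta> \<le> share n" by linarith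
    then show ?thesis
    proof cases
      case 1
      have "\<sigma> * (mu 1 + c1) * E1 n \<le> \<sigma> * (mu 1 + c1) * (\<kappa> * E0 n)"
        using E10[OF 1] \<sigma> pos c1 by (intro mult_left_mono) auto
      also have "\<dots> = (\<sigma> * (mu 1 + c1) * \<kappa>) * E0 n" by simp
      also have "\<dots> \<le> s * c0 / 2 * E0 n" using \<kappa>(4) E[of n] by (intro mult_right_mono) auto
      finally have "G f n \<le> - (s * c0 / 2) * E0 n"
        using G0_good G1_any 1 \<delta> unfolding G by (simp add: field_simps)
      also have "\<dots> \<le> - (2 * \<epsilon>) * E0 n" using \<epsilon>_le E[of n] by (intro mult_right_mono) auto
      also have "\<dots> \<le> - \<epsilon> * (E0 n + E1 n)"
      proof -
        have "E1 n \<le> 1 * E0 n" using E10[OF 1] mult_right_mono[OF \<kappa>(2), of "E0 n"] E[of n] by linarith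
        then have "\<epsilon> * E1 n \<le> \<epsilon> * E0 n" using \<epsilon> by (intro mult_left_mono) auto
        then show ?thesis by (simp add: algebra_simps)
      qed
      finally show ?thesis .
    next
      case 2
      have "G f n \<le> - (s * c0) * E0 n + - (\<sigma> * c1) * E1 n" unfolding G by (intro add_mono G0_good G1_good 2)
      also have "\<dots> \<le> - \<epsilon> * E0 n + - \<epsilon> * E1 n"
        using \<epsilon>_le \<epsilon> E[of n] by (intro add_mono mult_right_mono) auto
      finally show ?thesis by (simp add: algebra_simps)
    next
      case 3
      have "s * mu 0 * E0 n \<le> s * mu 0 * (\<kappa> * E1 n)" using E01[OF 3] s pos by (intro mult_left_mono) auto
      also have "\<dots> = (s * mu 0 * \<kappa>) * E1 n" by simp
      also have "\<dots> \<le> \<sigma> * c1 / 2 * E1 n" using \<kappa>(3) E[of n] by (intro mult_right_mono) auto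
      finally have "G f n \<le> - (\<sigma> * c1 / 2) * E1 n"
        using G1_good G0_any 3 \<delta> unfolding G by (simp add: field_simps)
      also have "\<dots> \<le> - (2 * \<epsilon>) * E1 n" using \<epsilon>_le E[of n] by (intro mult_right_mono) auto
      also have "\<dots> \<le> - \<epsilon> * (E0 n + E1 n)"
      proof -
        have "E0 n \<le> 1 * E1 n" using E01[OF 3] mult_right_mono[OF \<kappa>(2), of "E1 n"] E[of n] by linarith
        then have "\<epsilon> * E0 n \<le> \<epsilon> * E1 n" using \<epsilon> by (intro mult_left_mono) auto
        then show ?thesis by (simp add: algebra_simps)
      qed
      finally show ?thesis .
    qed
  qed
  \<comment> \<open>\<open>f < M\<close> forces \<open>n 0 + n 1\<close> to be at least \<open>B\<close>\<close>
  define M where "M = exp (- s * real B)"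
  have M: "0 < M" by (simp add: M_def)
  have mH: "0 < 1 + mu 0 * H" using pos H by (simp add: add_pos_nonneg)
  have "(\<lambda>j. (1 + mu 0 * H) * (exp (- s) ^ j + exp (- \<sigma>) ^ j)) \<longlonglongrightarrow> (1 + mu 0 * H) * (0 + 0)"
    using s \<sigma> by (intro tendsto_intros LIMSEQ_realpow_zero) auto
  then have "eventually (\<lambda>j. (1 + mu 0 * H) * (exp (- s) ^ j + exp (- \<sigma>) ^ j) < M) sequentially"
    using M by (intro order_tendstoD(2)) auto
  then obtain J where J: "(1 + mu 0 * H) * (exp (- s) ^ J + exp (- \<sigma>) ^ J) < M"
    by (auto simp: eventually_sequentially)
  show ?thesis
  proof (rule global_drift[where f=f and M=M and \<epsilon>="\<epsilon> / (1 + mu 0 * H)" and J=J and D=mu])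
    show "0 < lam k" if "k \<in> {0..L}" for k using lam that by simp
    show "0 \<le> D n k \<and> D n k \<le> mu k" if "n \<in> S" "k \<in> {0..L}" for n k using D_bounds that by simp
    show "0 < f n" if "n \<in> S" for n using F0(1)[OF that] E[of n] by (simp add: f_def)
    show "0 < \<epsilon> / (1 + mu 0 * H)" using \<epsilon> mH by simp
    show "G f n \<le> - (\<epsilon> / (1 + mu 0 * H)) * f n" if n: "n \<in> S" and "f n < M" for n
    proof -
      have "B \<le> n 0 + n 1"
      proof (rule ccontr)
        assume "\<not> B \<le> n 0 + n 1"
        then have "M \<le> E0 n" using s by (simp add: M_def E0_def)
        then show False using F0(1)[OF n] E[of n] \<open>f n < M\<close> by (simp add: f_def)
      qed
      then have "G f n \<le> - \<epsilon> * (E0 n + E1 n)" by (rule drift[OF n])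
      also have "\<epsilon> / (1 + mu 0 * H) * f n \<le> \<epsilon> / (1 + mu 0 * H) * ((1 + mu 0 * H) * (E0 n + E1 n))"
        using f_le[OF n] \<epsilon> mH by (intro mult_left_mono) auto
      then have "- \<epsilon> * (E0 n + E1 n) \<le> - (\<epsilon> / (1 + mu 0 * H)) * f n" using mH by simp
      finally show ?thesis .
    qed
    show "n 0 < J \<or> n 1 < J" if n: "n \<in> S" and "M \<le> f n" for n
    proof (rule ccontr)
      assume "\<not> (n 0 < J \<or> n 1 < J)"
      then have "E0 n \<le> exp (- s) ^ J" "E1 n \<le> exp (- \<sigma>) ^ J"
        using s \<sigma> by (simp_all add: E0_def E1_def exp_of_nat_mult[symmetric] mult.commute)
      then have "(1 + mu 0 * H) * (E0 n + E1 n) \<le> (1 + mu 0 * H) * (exp (- s) ^ J + exp (- \<sigma>) ^ J)"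
        using mH by (intro mult_left_mono add_mono) auto
      then show False using f_le[OF n] J \<open>M \<le> f n\<close> by linarith
    qed
  qed (use L M in auto)
qed

end

theorem theorem2:
  fixes L :: nat and lam mu a :: "nat \<Rightarrow> real"
    and M :: "'w measure" and N :: "real \<Rightarrow> 'w \<Rightarrow> (nat \<Rightarrow> nat)"
  defines "\<rho> \<equiv> \<lambda>k. lam k / mu k"
  assumes "2 \<le> L"
    and "\<And>k. k \<le> L \<Longrightarrow> 0 < lam k"
    and "\<And>k. k \<le> L \<Longrightarrow> 0 < mu k"
    and "\<And>k. k \<le> L \<Longrightarrow> 0 < a k"
    and "markov_jump_process M (populations {0..L}) (network_rate L lam mu a) N"
    and "(\<exists>k0\<le>L. \<rho> k0 > 1) \<or>
         ((\<forall>k\<le>L. \<rho> k < 1) \<and> \<rho> 0 > (SUP x\<in>{0..1 - \<rho> 1}. phi0_bar L lam mu a x))"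
  shows "transient_process M (populations {0..L}) N"
proof -
  interpret linear_network L lam mu a
    using assms(2-5) by unfold_locales
  have "\<exists>g B \<epsilon>. 0 < \<epsilon> \<and> (\<forall>n\<in>S. 0 < g n \<and> g n \<le> B \<and> G g n \<le> - \<epsilon> * (g n :: real))"
    using assms(7)
  proof
    assume "\<exists>k0\<le>L. \<rho> k0 > 1"
    then obtain k where k: "k \<le> L" "mu k < lam k"
      using mu by (auto simp: \<rho>_def)
    show ?thesis
      using k lam mu D_bounds by (intro overloaded_class_drift[where k=k and D="mu k"]) auto
  next
    assume *: "(\<forall>k\<le>L. \<rho> k < 1) \<and> \<rho> 0 > (SUP x\<in>{0..1 - \<rho> 1}. phi0_bar L lam mu a x)"
    then have "\<rho> 0 < 1" "\<rho> 1 < 1" using L by auto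
    then have "lam 0 < mu 0" "lam 1 < mu 1" using mu[of 0] mu[of 1] L by (auto simp: \<rho>_def)
    then show ?thesis using * by (intro averaged_drift) (auto simp: \<rho>_def)
  qed
  then obtain g B \<epsilon> where "0 < \<epsilon>" and g: "\<And>n. n \<in> S \<Longrightarrow> 0 < g n \<and> g n \<le> B"
    and drift: "\<And>n. n \<in> S \<Longrightarrow> G g n \<le> - \<epsilon> * (g n :: real)"
    by blast
  show ?thesis
  proof (rule transient_birth_death[where b=lam and d=D and D=mu, OF _ _ _ _ _ _ g \<open>0 < \<epsilon>\<close> drift])
    show "markov_jump_process M S (birth_death_rate {0..L} lam D) N"
      using assms(6) by (simp add: network_rate_def)
  qed (use lam D_bounds D_zero in auto)
qed

end
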